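(* For all integers $n \ge 5$ and $m \ge 2$, there is a homotopy equivalence $$I(\Delta^m_n) \simeq \Sigma^2 I(\Delta^m_{n-3}) \vee \Sigma^m I(\Delta^m_{n-3}) \vee \Sigma^{m+1} I(\Delta^m_{n-4}).$$
   Context: For positive integers $m,n$, the graph $\Delta^m_n$ is the simple graph with vertex set $\{e_i : 1\le i\le n\}\cup\{f^k_i : 1\le i\le n-1,\ 1\le k\le m\}$ and edges exactly: $f^k_i \sim f^k_{i+1}$ for $1\le i\le n-2$ and each $k$, and $e_i\sim f^k_i$, $f^k_i\sim e_{i+1}$ for $1\le i\le n-1$ and each $k$. For a simple graph $G$, the independence complex $I(G)$ is the simplicial complex whose simplices are the independent sets of vertices of $G$. $\Sigma$ denotes the reduced suspension and $\Sigma^k$ its $k$-fold iterate; $\vee$ denotes the wedge sum. *)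

theory Defs
  imports "HOL-Analysis.Analysis"
begin

section \<open>The graphs\<close>

text \<open>\<open>EV i\<close> is the vertex $e_i$ and \<open>FV k i\<close> is $f^k_i$.\<close>

datatype vert = EV nat | FV nat nat

definition Delta_verts :: "nat \<Rightarrow> nat \<Rightarrow> vert set" where
  "Delta_verts m n =
     {EV i | i. 1 \<le> i \<and> i \<le> n} \<union>
     {FV k i | k i. 1 \<le> k \<and> k \<le> m \<and> 1 \<le> i \<and> i \<le> n - 1}"

definition Delta_edges :: "nat \<Rightarrow> nat \<Rightarrow> vert set set" where
  "Delta_edges m n =
     {{FV k i, FV k (i + 1)} | k i. 1 \<le> k \<and> k \<le> m \<and> 1 \<le> i \<and> i \<le> n - 2} \<union>
     {{EV i, FV k i} | k i. 1 \<le> k \<and> k \<le> m \<and> 1 \<le> i \<and> i \<le> n - 1} \<union>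
     {{FV k i, EV (i + 1)} | k i. 1 \<le> k \<and> k \<le> m \<and> 1 \<le> i \<and> i \<le> n - 1}"

lemma finite_Delta_verts: "finite (Delta_verts m n)"
proof -
  have "Delta_verts m n \<subseteq> EV ` {1..n} \<union> (\<lambda>(k, i). FV k i) ` ({1..m} \<times> {1..n - 1})"
    by (auto simp: Delta_verts_def image_iff)
  then show ?thesis
    by (rule finite_subset) simp
qed

lemma Delta_edges_subset: "e \<in> Delta_edges m n \<Longrightarrow> e \<subseteq> Delta_verts m n \<and> card e = 2"
  by (auto simp: Delta_edges_def Delta_verts_def)


section \<open>Independence complexes and geometric realization\<close>

definition independence_complex :: "'v set \<Rightarrow> 'v set set \<Rightarrow> 'v set set" where
  "independence_complex V E =
     {S. S \<subseteq> V \<and> finite S \<and> (\<forall>u\<in>S. \<forall>v\<in>S. {u, v} \<notin> E)}"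

text \<open>
  Points are given by barycentric coordinates. The topology is that of pointwise
  convergence of the coordinates; it is the usual topology of the realization for
  complexes with finitely many vertices, which are the only ones used here.
\<close>

definition geometric_realization :: "'v set set \<Rightarrow> ('v \<Rightarrow> real) topology" where
  "geometric_realization K =
     subtopology (powertop_real UNIV)
       {x. (\<forall>v. 0 \<le> x v) \<and> {v. x v \<noteq> 0} \<in> K \<and> (\<Sum>v | x v \<noteq> 0. x v) = 1}"

definition I_Delta :: "nat \<Rightarrow> nat \<Rightarrow> (vert \<Rightarrow> real) topology" where
  "I_Delta m n =
     geometric_realization (independence_complex (Delta_verts m n) (Delta_edges m n))"

lemma I_Delta_nonempty:
  assumes "n \<ge> 1"
  shows "topspace (I_Delta m n) \<noteq> {}"
proof -
  define x :: "vert \<Rightarrow> real" where "x = (\<lambda>v. if v = EV 1 then 1 else 0)"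
  have supp: "{v. x v \<noteq> 0} = {EV 1}"
    by (auto simp: x_def)
  have "{EV 1} \<in> independence_complex (Delta_verts m n) (Delta_edges m n)"
    using assms by (auto simp: independence_complex_def Delta_verts_def Delta_edges_def doubleton_eq_iff)
  then have "x \<in> topspace (I_Delta m n)"
    using supp by (simp add: I_Delta_def geometric_realization_def supp) (simp add: x_def)
  then show ?thesis
    by blast
qed


section \<open>Quotient topologies\<close>

definition quotient_topology :: "'a topology \<Rightarrow> ('a \<Rightarrow> 'b) \<Rightarrow> 'b topology" where
  "quotient_topology X q =
     topology (\<lambda>U. U \<subseteq> q ` topspace X \<and> openin X {x \<in> topspace X. q x \<in> U})"

lemma openin_quotient_topology:
  "openin (quotient_topology X q) U \<longleftrightarrow>
     U \<subseteq> q ` topspace X \<and> openin X {x \<in> topspace X. q x \<in> U}"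
proof -
  let ?L = "\<lambda>U. U \<subseteq> q ` topspace X \<and> openin X {x \<in> topspace X. q x \<in> U}"
  have int: "{x \<in> topspace X. q x \<in> S \<inter> T}
      = {x \<in> topspace X. q x \<in> S} \<inter> {x \<in> topspace X. q x \<in> T}" for S T
    by auto
  have union: "{x \<in> topspace X. q x \<in> \<Union>\<K>} = (\<Union>S\<in>\<K>. {x \<in> topspace X. q x \<in> S})" for \<K>
    by auto
  have "istopology ?L"
    unfolding istopology_def int union by blast
  then show ?thesis
    unfolding quotient_topology_def by (simp add: topology_inverse')
qed

lemma topspace_quotient_topology: "topspace (quotient_topology X q) = q ` topspace X"
proof
  show "topspace (quotient_topology X q) \<subseteq> q ` topspace X"
    unfolding topspace_def openin_quotient_topology by auto
  have "{x \<in> topspace X. q x \<in> q ` topspace X} = topspace X"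
    by auto
  then have "openin (quotient_topology X q) (q ` topspace X)"
    by (simp add: openin_quotient_topology)
  then show "q ` topspace X \<subseteq> topspace (quotient_topology X q)"
    by (rule openin_subset)
qed

lemma quotient_map_quotient_topology: "quotient_map X (quotient_topology X q) q"
  by (simp add: quotient_map_def topspace_quotient_topology openin_quotient_topology)


section \<open>Reduced suspensions and wedge sums of pointed spaces\<close>

text \<open>
  A pointed space is a pair of a topology and its base point.

  The reduced suspension of $(X, b)$ is the quotient of $X \times [0,1]$ by the subspace
  $X \times \{0,1\} \cup \{b\} \times [0,1]$. In order to iterate the construction without
  changing the type, the points of all iterated suspensions of a space of type \<open>'a\<close> live in
  one type: \<open>Orig x\<close> is a point of the original space, \<open>Cell p t\<close> is the class of a pair
  $(p,t)$ outside the collapsed subspace, and \<open>Base\<close> is the class of the collapsed subspace.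
\<close>

datatype 'a susp_point = Base | Orig 'a | Cell "'a susp_point" real

fun susp_proj :: "'a susp_point \<Rightarrow> 'a susp_point \<times> real \<Rightarrow> 'a susp_point" where
  "susp_proj b (p, t) = (if p = b \<or> t = 0 \<or> t = 1 then Base else Cell p t)"

fun reduced_suspension ::
  "'a susp_point topology \<times> 'a susp_point \<Rightarrow> 'a susp_point topology \<times> 'a susp_point" where
  "reduced_suspension (X, b) =
     (quotient_topology (prod_topology X (top_of_set {0..1})) (susp_proj b), Base)"

text \<open>\<open>Orig\<close> is injective, so the space at which the iteration starts is a homeomorphic
  copy of \<open>X\<close>.\<close>

definition iterated_suspension ::
  "nat \<Rightarrow> 'a topology \<Rightarrow> 'a \<Rightarrow> 'a susp_point topology \<times> 'a susp_point" where
  "iterated_suspension k X b =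
     (reduced_suspension ^^ k) (quotient_topology X Orig, Orig b)"

lemma homeomorphic_map_Orig: "homeomorphic_map X (quotient_topology X Orig) Orig"
  by (simp add: homeomorphic_map_def quotient_map_quotient_topology inj_on_def)

text \<open>The disjoint union of a family of pointed spaces with all base points identified to
  the point \<open>None\<close>.\<close>

definition wedge_sum :: "'i set \<Rightarrow> ('i \<Rightarrow> 'a topology \<times> 'a) \<Rightarrow> ('i \<times> 'a) option topology" where
  "wedge_sum J F =
     quotient_topology (sum_topology (\<lambda>j. fst (F j)) J)
       (\<lambda>(j, x). if x = snd (F j) then None else Some (j, x))"

end

theory Submission
  imports Defs
begin

text \<open>
  Write \<open>\<Delta>\<close> for the graph $\Delta^m_n$ and regard independence complexes as flag complexes of the
  complementary graphs. All homotopy equivalences between complexes come from one elementary move: the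
  faces containing two given vertices (or one) can be deleted if all of them can be extended by one and
  the same vertex \<open>w\<close>, since the barycentric weight common to the two vertices can be pushed to \<open>w\<close>.
  Moves of this kind delete $e_2$ and all $f^k_3$ from \<open>\<Delta>\<close> and rewire $e_1$ and $e_3$ so that what remains
  is the join of $m$ copies of $S^0$ with $I(\Delta^m_{n-3})$, together with two cones, with apex $e_3$
  over the suspension of $I(\Delta^m_{n-3})$ and with apex $e_1$ over the $m$-fold suspension of
  $I(\Delta^m_{n-4})$. The base of each cone lies in the star of another vertex, and further moves
  shift the cones off the rest, which leaves a wedge of three iterated joins with $S^0$.

  On the topological side, the reduced suspension of a finite complex with any base point is, up to a
  pointed homotopy equivalence, its join with $S^0$, because a neighbourhood of the base point
  contracts to it. Reduced suspensions and wedge sums respect pointed homotopy equivalences.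
\<close>

section \<open>Pointed homotopy equivalences and suspensions\<close>

text \<open>The moves on complexes are free homotopy equivalences, whereas reduced suspensions and
  wedges respect only pointed ones. The two kinds never meet inside a construction: moves act on the
  whole complex until it is homeomorphic to a wedge of flag complexes based at vertices, and pointed
  equivalences are used only to compare each summand with an iterated reduced suspension.

  The exponents are counted as follows. Each pair $f^k_1, f^k_2$ is an edge of the graph, so its
  independence complex is $S^0$; the $m$ pairs give the $m$-fold suspension. A cone that is split
  off turns into the suspension of its base, with the apex and the wedge point as poles. The bases
  are suspended once and $m$ times already, which gives $2$ and $m+1$.

  The wedge point is $f^m_1$. The base of the cone over $e_3$ contains $f^1_1$ and $f^1_2$, so
  $f^m_1$ can see all of that base in the complex only if $m \<ge> 2$.\<close>

definition pointed_heq :: "'a topology \<Rightarrow> 'a \<Rightarrow> 'b topology \<Rightarrow> 'b \<Rightarrow> bool" where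
  "pointed_heq X a Y b \<longleftrightarrow> a \<in> topspace X \<and> b \<in> topspace Y \<and>
     (\<exists>f g. continuous_map X Y f \<and> continuous_map Y X g \<and> f a = b \<and> g b = a \<and>
        homotopic_with (\<lambda>h. h a = a) X X (g \<circ> f) id \<and>
        homotopic_with (\<lambda>h. h b = b) Y Y (f \<circ> g) id)"

lemma pointed_heq_sym: "pointed_heq X a Y b \<Longrightarrow> pointed_heq Y b X a"
  unfolding pointed_heq_def by blast

lemma pointed_heq_trans:
  assumes "pointed_heq X a Y b" and "pointed_heq Y b Z c"
  shows "pointed_heq X a Z c"
proof -
  obtain f g where f: "continuous_map X Y f" "continuous_map Y X g" "f a = b" "g b = a"
      "homotopic_with (\<lambda>h. h a = a) X X (g \<circ> f) id"
      "homotopic_with (\<lambda>h. h b = b) Y Y (f \<circ> g) id"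
    using assms(1) unfolding pointed_heq_def by blast
  obtain f' g' where f': "continuous_map Y Z f'" "continuous_map Z Y g'" "f' b = c" "g' c = b"
      "homotopic_with (\<lambda>h. h b = b) Y Y (g' \<circ> f') id"
      "homotopic_with (\<lambda>h. h c = c) Z Z (f' \<circ> g') id"
    using assms(2) unfolding pointed_heq_def by blast
  have "homotopic_with (\<lambda>h. h a = b) X Y ((g' \<circ> f') \<circ> f) (id \<circ> f)"
    by (rule homotopic_with_compose_continuous_map_right[OF f'(5) f(1)]) (use f(3) in auto)
  then have "homotopic_with (\<lambda>h. h a = a) X X (g \<circ> ((g' \<circ> f') \<circ> f)) (g \<circ> (id \<circ> f))"
    by (rule homotopic_with_compose_continuous_map_left[OF _ f(2)]) (use f(4) in auto)
  then have 1: "homotopic_with (\<lambda>h. h a = a) X X ((g \<circ> g') \<circ> (f' \<circ> f)) id"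
    using homotopic_with_trans[OF _ f(5)] by (simp add: o_assoc)
  have "homotopic_with (\<lambda>h. h c = b) Z Y ((f \<circ> g) \<circ> g') (id \<circ> g')"
    by (rule homotopic_with_compose_continuous_map_right[OF f(6) f'(2)]) (use f'(4) in auto)
  then have "homotopic_with (\<lambda>h. h c = c) Z Z (f' \<circ> ((f \<circ> g) \<circ> g')) (f' \<circ> (id \<circ> g'))"
    by (rule homotopic_with_compose_continuous_map_left[OF _ f'(1)]) (use f'(3) in auto)
  then have 2: "homotopic_with (\<lambda>h. h c = c) Z Z ((f' \<circ> f) \<circ> (g \<circ> g')) id"
    using homotopic_with_trans[OF _ f'(6)] by (simp add: o_assoc)
  have "continuous_map X Z (f' \<circ> f)" "continuous_map Z X (g \<circ> g')"
    using f f' continuous_map_compose by blast+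
  then show ?thesis
    using assms 1 2 f f' unfolding pointed_heq_def by (metis comp_apply)
qed

lemma pointed_heq_homeomorphic:
  assumes "homeomorphic_map X Y f" and "a \<in> topspace X"
  shows "pointed_heq X a Y (f a)"
proof -
  obtain g where g: "homeomorphic_maps X Y f g"
    using assms(1) homeomorphic_map_maps by blast
  then have c: "continuous_map X Y f" "continuous_map Y X g"
    and gf: "\<And>x. x \<in> topspace X \<Longrightarrow> g (f x) = x" and fg: "\<And>y. y \<in> topspace Y \<Longrightarrow> f (g y) = y"
    by (auto simp: homeomorphic_maps_def)
  have fa: "f a \<in> topspace Y"
    using c(1) assms(2) continuous_map_funspace by blast
  have "homotopic_with (\<lambda>h. h a = a) X X (g \<circ> f) id"
    by (rule homotopic_with_equal) (use c gf assms in \<open>auto intro: continuous_map_compose\<close>)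
  moreover have "homotopic_with (\<lambda>h. h (f a) = f a) Y Y (f \<circ> g) id"
    by (rule homotopic_with_equal) (use c fg fa in \<open>auto intro: continuous_map_compose\<close>)
  ultimately show ?thesis
    unfolding pointed_heq_def using c gf assms(2) fa by blast
qed

section \<open>Descending maps and homotopies along quotient maps\<close>

lemma quotient_map_lift:
  assumes "quotient_map X Y q" and "continuous_map X Z h"
    and "\<forall>x\<in>topspace X. \<forall>x'\<in>topspace X. q x = q x' \<longrightarrow> h x = h x'"
  shows "\<exists>g. continuous_map Y Z g \<and> (\<forall>x\<in>topspace X. g (q x) = h x)"
proof (rule quotient_map_lift_exists[OF assms(1,2)])
  fix x x' assume "x \<in> topspace X" "x' \<in> topspace X" "q x = q x'"
  then show "h x = h x'"
    using assms(3) by blast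
next
  fix g assume "continuous_map Y Z g" "\<And>x. x \<in> topspace X \<Longrightarrow> g (q x) = h x"
  then show ?thesis
    by blast
qed

text \<open>The unit interval is locally compact Hausdorff, so the product of \<open>q\<close> with
  its identity is again a quotient map; a homotopy whose stages are all constant on the fibres of
  \<open>q\<close> therefore descends. \<open>P\<close> carries this property of the stages together
  with their value at \<open>a\<close>.\<close>

lemma homotopic_with_quotient:
  assumes q: "quotient_map X Y q"
    and h: "homotopic_with P X Z F G"
    and P: "\<And>h x x'. P h \<Longrightarrow> x \<in> topspace X \<Longrightarrow> x' \<in> topspace X \<Longrightarrow> q x = q x' \<Longrightarrow> h x = h x'"
    and f: "\<And>x. x \<in> topspace X \<Longrightarrow> f (q x) = F x"
    and g: "\<And>x. x \<in> topspace X \<Longrightarrow> g (q x) = G x"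
    and a: "a \<in> topspace X" "\<And>h. P h \<Longrightarrow> h a = c"
  shows "homotopic_with (\<lambda>k. k (q a) = c) Y Z f g"
proof -
  let ?I = "top_of_set {0..1::real}"
  obtain h where h: "continuous_map (prod_topology ?I X) Z h"
      "\<And>x. h (0, x) = F x" "\<And>x. h (1, x) = G x" "\<And>t. t \<in> {0..1} \<Longrightarrow> P (\<lambda>x. h (t, x))"
    using h unfolding homotopic_with_def by blast
  let ?q = "\<lambda>(t, x). (t :: real, q x)"
  have Q: "quotient_map (prod_topology ?I X) (prod_topology ?I Y) ?q"
    by (rule quotient_map_prod_right[OF _ _ q])
      (auto intro!: compact_imp_locally_compact_space compact_space_subtopology
        simp: Hausdorff_space_subtopology)
  have eq: "h z = h z'" if "z \<in> topspace (prod_topology ?I X)" "z' \<in> topspace (prod_topology ?I X)"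
    "?q z = ?q z'" for z z'
    using that P[OF h(4), of "fst z" "snd z" "snd z'"] by (auto simp: case_prod_unfold)
  have "\<exists>k. continuous_map (prod_topology ?I Y) Z k \<and>
      (\<forall>z\<in>topspace (prod_topology ?I X). k (?q z) = h z)"
    by (rule quotient_map_lift[OF Q h(1)]) (intro ballI impI eq)
  then obtain k where k: "continuous_map (prod_topology ?I Y) Z k"
      "\<And>z. z \<in> topspace (prod_topology ?I X) \<Longrightarrow> k (?q z) = h z"
    by blast
  have sur: "q ` topspace X = topspace Y"
    using q quotient_imp_surjective_map by blast
  have qa: "q a \<in> topspace Y"
    using sur a by blast
  have k': "k (t, q x) = h (t, x)" if "t \<in> {0..1}" "x \<in> topspace X" for t x
    using k(2)[of "(t, x)"] that by simp
  show ?thesis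
  proof (rule homotopic_with[where P = "\<lambda>k. k (q a) = c", THEN iffD2])
    show "(h (q a) = c) = (k (q a) = c)" if "\<And>y. y \<in> topspace Y \<Longrightarrow> h y = k y" for h k
      using that[OF qa] by simp
    show "\<exists>h. continuous_map (prod_topology ?I Y) Z h \<and> (\<forall>x\<in>topspace Y. h (0, x) = f x) \<and>
        (\<forall>x\<in>topspace Y. h (1, x) = g x) \<and> (\<forall>t\<in>{0..1}. h (t, q a) = c)"
    proof (rule exI[of _ k], intro conjI ballI)
      show "k (0, y) = f y" "k (1, y) = g y" if "y \<in> topspace Y" for y
      proof -
        have "y \<in> q ` topspace X"
          using that sur by simp
        then obtain x where "x \<in> topspace X" "y = q x"
          by blast
        then show "k (0, y) = f y" "k (1, y) = g y"
          using f g h(2,3) k' by simp_all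
      qed
      show "k (t, q a) = c" if "t \<in> {0..1}" for t
        using k'[OF that a(1)] a(2)[OF h(4)[OF that]] by simp
    qed (fact k)
  qed
qed

text \<open>The map \<open>q\<close> exhibits \<open>(Y, y)\<close> as the reduced suspension of \<open>(X, b)\<close>, up to homeomorphism.\<close>

definition suspension_map :: "'a topology \<Rightarrow> 'a \<Rightarrow> 'b topology \<Rightarrow> 'b \<Rightarrow> ('a \<times> real \<Rightarrow> 'b) \<Rightarrow> bool" where
  "suspension_map X b Y y q \<longleftrightarrow>
     b \<in> topspace X \<and> quotient_map (prod_topology X (top_of_set {0..1})) Y q \<and>
     (\<forall>x\<in>topspace X. \<forall>t\<in>{0..1}. q (x, t) = y \<longleftrightarrow> x = b \<or> t = 0 \<or> t = 1) \<and>
     (\<forall>x\<in>topspace X. \<forall>t\<in>{0..1}. \<forall>x'\<in>topspace X. \<forall>t'\<in>{0..1}.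
        q (x, t) = q (x', t') \<longrightarrow> q (x, t) = y \<or> (x, t) = (x', t'))"

lemma suspension_map_base:
  assumes "suspension_map X b Y y q"
  shows "q (b, 0) = y" "(b, 0) \<in> topspace (prod_topology X (top_of_set {0..1::real}))" "y \<in> topspace Y"
proof -
  show 1: "q (b, 0) = y" and 2: "(b, 0) \<in> topspace (prod_topology X (top_of_set {0..1::real}))"
    using assms unfolding suspension_map_def by auto
  show "y \<in> topspace Y"
    using assms 1 2 quotient_imp_surjective_map unfolding suspension_map_def by blast
qed

lemma suspension_map_cong:
  assumes q: "suspension_map X b Y y q"
    and z: "z \<in> topspace (prod_topology X (top_of_set {0..1::real}))"
      "z' \<in> topspace (prod_topology X (top_of_set {0..1::real}))"
    and eq: "q z = q z'"
    and h: "\<And>x t. x \<in> topspace X \<Longrightarrow> t \<in> {0..1} \<Longrightarrow> x = b \<or> t = 0 \<or> t = 1 \<Longrightarrow> h (x, t) = c"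
  shows "h z = h z'"
proof -
  obtain x t x' t' where [simp]: "z = (x, t)" "z' = (x', t')"
    by (cases z, cases z') auto
  have mem: "x \<in> topspace X" "t \<in> {0..1}" "x' \<in> topspace X" "t' \<in> {0..1}"
    using z by auto
  show ?thesis
  proof (cases "q (x, t) = y")
    case True
    then have "x = b \<or> t = 0 \<or> t = 1" "q (x', t') = y"
      using q mem eq unfolding suspension_map_def by auto
    moreover from this(2) have "x' = b \<or> t' = 0 \<or> t' = 1"
      using q mem unfolding suspension_map_def by blast
    ultimately have "x = b \<or> t = 0 \<or> t = 1" "x' = b \<or> t' = 0 \<or> t' = 1"
      by blast+
    then show ?thesis
      using h[OF mem(1,2)] h[OF mem(3,4)] by simp
  next
    case False
    moreover have "q (x, t) = q (x', t') \<longrightarrow> q (x, t) = y \<or> (x, t) = (x', t')"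
      using q mem unfolding suspension_map_def by blast
    ultimately have "(x, t) = (x', t')"
      using eq by simp
    then show ?thesis
      by simp
  qed
qed

lemma suspension_map_susp_proj:
  assumes "b \<in> topspace X"
  shows "suspension_map X b (fst (reduced_suspension (X, b))) (snd (reduced_suspension (X, b))) (susp_proj b)"
  using assms by (auto simp: suspension_map_def quotient_map_quotient_topology)

text \<open>\<open>reduced_suspension\<close> is confined to the type \<open>susp_point\<close>,
  while the points of a realization are functions. Their reduced suspension is modelled in an option
  type; the comparison lemmas use only \<open>suspension_map\<close>, so the two models are
  interchangeable.\<close>

lemma suspension_map_exists:
  fixes X :: "'a topology"
  assumes "b \<in> topspace X"
  shows "\<exists>(Y :: ('a \<times> real) option topology) y q. suspension_map X b Y y q"
proof -
  let ?q = "\<lambda>(x, t). if x = b \<or> t = 0 \<or> t = (1::real) then None else Some (x, t)"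
  have "suspension_map X b (quotient_topology (prod_topology X (top_of_set {0..1})) ?q) None ?q"
    using assms by (auto simp: suspension_map_def quotient_map_quotient_topology)
  then show ?thesis
    by blast
qed

lemma suspension_map_functorial:
  assumes q: "suspension_map X b Y y q" and q': "suspension_map X' b' Y' y' q'"
    and f: "continuous_map X X' f" "f b = b'"
  shows "\<exists>F. continuous_map Y Y' F \<and> F y = y' \<and>
      (\<forall>x\<in>topspace X. \<forall>t\<in>{0..1}. F (q (x, t)) = q' (f x, t))"
proof -
  let ?I = "top_of_set {0..1::real}"
  have qq: "quotient_map (prod_topology X ?I) Y q" "quotient_map (prod_topology X' ?I) Y' q'"
    using q q' unfolding suspension_map_def by auto
  have c: "continuous_map (prod_topology X ?I) Y' (\<lambda>z. q' (f (fst z), snd z))"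
    by (rule continuous_map_compose[OF _ quotient_imp_continuous_map[OF qq(2)], unfolded o_def])
      (auto intro!: continuous_map_pairedI continuous_map_compose[OF continuous_map_fst f(1), unfolded o_def]
        continuous_map_snd)
  have im: "f x \<in> topspace X'" if "x \<in> topspace X" for x
    using that f(1) continuous_map_funspace by blast
  have eq: "q' (f (fst z), snd z) = q' (f (fst z'), snd z')"
    if "z \<in> topspace (prod_topology X ?I)" "z' \<in> topspace (prod_topology X ?I)" "q z = q z'" for z z'
  proof (rule suspension_map_cong[OF q that])
    fix x t assume "x \<in> topspace X" "t \<in> {0..1::real}" "x = b \<or> t = 0 \<or> t = 1"
    then show "q' (f (fst (x, t)), snd (x, t)) = y'"
      using q' im f(2) unfolding suspension_map_def by auto
  qed
  have "\<exists>F. continuous_map Y Y' F \<and> (\<forall>z\<in>topspace (prod_topology X ?I). F (q z) = q' (f (fst z), snd z))"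
    by (rule quotient_map_lift[OF qq(1) c]) (intro ballI impI eq)
  then obtain F where F: "continuous_map Y Y' F"
      "\<And>z. z \<in> topspace (prod_topology X ?I) \<Longrightarrow> F (q z) = q' (f (fst z), snd z)"
    by blast
  have "F y = y'"
    using F(2)[of "(b, 0)"] suspension_map_base[OF q] suspension_map_base[OF q'] f(2) by auto
  then show ?thesis
    using F by (intro exI[of _ F]) auto
qed

lemma suspension_map_homotopy_inverse:
  assumes q: "suspension_map X b Y y q" and q': "suspension_map X' b' Y' y' q'"
    and F: "\<And>x t. x \<in> topspace X \<Longrightarrow> t \<in> {0..1} \<Longrightarrow> F (q (x, t)) = q' (f x, t)"
    and G: "\<And>x t. x \<in> topspace X' \<Longrightarrow> t \<in> {0..1} \<Longrightarrow> G (q' (x, t)) = q (g x, t)"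
    and f: "continuous_map X X' f"
    and h: "homotopic_with (\<lambda>h. h b = b) X X (g \<circ> f) id"
  shows "homotopic_with (\<lambda>h. h y = y) Y Y (G \<circ> F) id"
proof -
  let ?I = "top_of_set {0..1::real}"
  have qq: "quotient_map (prod_topology X ?I) Y q"
    using q unfolding suspension_map_def by auto
  \<comment> \<open>Every stage is \<open>i\<close> times the identity of the interval with
    \<open>i b = b\<close>, so it maps the collapsed subspace into itself; continuity is recorded to
    know that its values stay in the cylinder. Hence \<open>q\<close> composed with a stage is
    constant on the fibres of \<open>q\<close>.\<close>
  let ?P = "\<lambda>h. continuous_map (prod_topology X ?I) (prod_topology X ?I) h \<and> 
             (\<exists>i. i b = b \<and> (\<forall>x t. h (x, t) = (i x, t)))"
  have "homotopic_with (\<lambda>h. \<exists>i. i b = b \<and> (\<forall>x t. h (x, t) = (i x, t)))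
      (prod_topology X ?I) (prod_topology X ?I)
      (\<lambda>z. ((g \<circ> f) (fst z), id (snd z))) (\<lambda>z. (id (fst z), id (snd z)))"
    by (rule homotopic_with_prod_topology[OF h, where q = "\<lambda>j. j = id"]) auto
  then have "homotopic_with ?P (prod_topology X ?I) (prod_topology X ?I)
      (\<lambda>z. ((g \<circ> f) (fst z), id (snd z))) (\<lambda>z. (id (fst z), id (snd z)))"
    by (rule homotopic_with_mono) auto
  then have 1: "homotopic_with (\<lambda>k. \<exists>h. ?P h \<and> k = q \<circ> h)
      (prod_topology X ?I) Y (q \<circ> (\<lambda>z. ((g \<circ> f) (fst z), id (snd z)))) (q \<circ> (\<lambda>z. (id (fst z), id (snd z))))"
    by (rule homotopic_with_compose_continuous_map_left[OF _ quotient_imp_continuous_map[OF qq]]) blast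
  have base: "q (b, 0) = y" "(b, 0) \<in> topspace (prod_topology X ?I)"
    using suspension_map_base[OF q] by auto
  have fim: "f x \<in> topspace X'" if "x \<in> topspace X" for x
    using that f continuous_map_funspace by blast
  have "homotopic_with (\<lambda>k. k (q (b, 0)) = y) Y Y (G \<circ> F) id"
  proof (rule homotopic_with_quotient[OF qq 1])
    fix k z z' assume "\<exists>h. ?P h \<and> k = q \<circ> h" 
      and z: "z \<in> topspace (prod_topology X ?I)" "z' \<in> topspace (prod_topology X ?I)" "q z = q z'"
    then obtain h i where h: "k = q \<circ> h" "i b = b" "\<And>x t. h (x, t) = (i x, t)"
        "continuous_map (prod_topology X ?I) (prod_topology X ?I) h"
      by blast
    show "k z = k z'"
    proof (rule suspension_map_cong[OF q z])
      fix x t assume *: "x \<in> topspace X" "t \<in> {0..1::real}" "x = b \<or> t = 0 \<or> t = 1"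
      then have "h (x, t) \<in> topspace (prod_topology X ?I)"
        using continuous_map_funspace[OF h(4)] by (auto simp: Pi_iff)
      then show "k (x, t) = y"
        using q h * unfolding suspension_map_def by auto
    qed
  next
    fix k assume "\<exists>h. ?P h \<and> k = q \<circ> h"
    then show "k (b, 0) = y"
      using base(1) by auto
  qed (use F G fim base in auto)
  then show ?thesis
    by (simp add: base)
qed

lemma pointed_heq_suspension:
  assumes q: "suspension_map X b Y y q" and q': "suspension_map X' b' Y' y' q'"
    and heq: "pointed_heq X b X' b'"
  shows "pointed_heq Y y Y' y'"
proof -
  obtain f g where f: "continuous_map X X' f" "continuous_map X' X g" "f b = b'" "g b' = b"
      "homotopic_with (\<lambda>h. h b = b) X X (g \<circ> f) id"
      "homotopic_with (\<lambda>h. h b' = b') X' X' (f \<circ> g) id"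
    using heq unfolding pointed_heq_def by blast
  obtain F where F: "continuous_map Y Y' F" "F y = y'" 
      "\<And>x t. x \<in> topspace X \<Longrightarrow> t \<in> {0..1} \<Longrightarrow> F (q (x, t)) = q' (f x, t)"
    using suspension_map_functorial[OF q q' f(1,3)] by blast
  obtain G where G: "continuous_map Y' Y G" "G y' = y" 
      "\<And>x t. x \<in> topspace X' \<Longrightarrow> t \<in> {0..1} \<Longrightarrow> G (q' (x, t)) = q (g x, t)"
    using suspension_map_functorial[OF q' q f(2,4)] by blast
  have GF: "homotopic_with (\<lambda>h. h y = y) Y Y (G \<circ> F) id"
    by (rule suspension_map_homotopy_inverse[OF q q' F(3) G(3) f(1,5)])
  have FG: "homotopic_with (\<lambda>h. h y' = y') Y' Y' (F \<circ> G) id"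
    by (rule suspension_map_homotopy_inverse[OF q' q G(3) F(3) f(2,6)])
  show ?thesis
    unfolding pointed_heq_def
    by (intro conjI exI[of _ F] exI[of _ G])
      (fact suspension_map_base(3)[OF q] suspension_map_base(3)[OF q'] F G GF FG)+
qed

section \<open>Non-degenerate base points; unreduced versus reduced suspension\<close>

text \<open>A weak form of an NDR pair: \<open>\<mu>\<close> may vanish at more points than
  \<open>a\<close>, and only the final map \<open>\<rho>\<close> of the deformation has to send the
  neighbourhood \<open>\<mu> < 1\<close> to \<open>a\<close>.\<close>

definition ndr_point :: "'a topology \<Rightarrow> 'a \<Rightarrow> bool" where
  "ndr_point X a \<longleftrightarrow> a \<in> topspace X \<and>
     (\<exists>\<mu> \<rho>. continuous_map X (top_of_set {0..1::real}) \<mu> \<and> \<mu> a = 0 \<and>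
        (\<forall>x\<in>topspace X. \<mu> x < 1 \<longrightarrow> \<rho> x = a) \<and>
        homotopic_with (\<lambda>h. h a = a) X X id \<rho>)"

text \<open>The map \<open>p\<close> exhibits \<open>Z\<close> as the unreduced suspension of \<open>X\<close>, with poles \<open>N\<close> and \<open>S\<close>.\<close>

definition double_cone_map :: "'a topology \<Rightarrow> 'b topology \<Rightarrow> 'b \<Rightarrow> 'b \<Rightarrow> ('a \<times> real \<Rightarrow> 'b) \<Rightarrow> bool" where
  "double_cone_map X Z N S p \<longleftrightarrow>
     quotient_map (prod_topology X (top_of_set {0..1})) Z p \<and>
     (\<forall>x\<in>topspace X. p (x, 0) = N \<and> p (x, 1) = S) \<and>
     (\<forall>x\<in>topspace X. \<forall>t\<in>{0..1}. \<forall>x'\<in>topspace X. \<forall>t'\<in>{0..1}.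
        p (x, t) = p (x', t') \<longrightarrow> t = t' \<and> (t = 0 \<or> t = 1 \<or> x = x'))"

text \<open>A homotopy of the cylinder onto the unreduced suspension that descends to both quotients of
  the cylinder ends at a map collapsing the meridian of the base point \<open>a\<close>. It first retracts a
  neighbourhood of \<open>a\<close> to \<open>a\<close>, then extends every meridian by the reversed meridian of \<open>a\<close>, and
  finally shrinks the loops obtained near \<open>a\<close>.\<close>

lemma double_cone_homotopy:
  fixes X :: "'a topology" and Z :: "'b topology"
  assumes p: "double_cone_map X Z N S p" and a: "ndr_point X a"
  defines "P \<equiv> \<lambda>h. (\<forall>x\<in>topspace X. h (x, 0) = N \<and> h (x, 1) = h (a, 1)) \<and>
      (\<forall>t\<in>{0..1}. h (a, t) \<in> (\<lambda>t. p (a, t)) ` {0..1})"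
  shows "\<exists>G. homotopic_with P (prod_topology X (top_of_set {0..1})) Z p G \<and>
    (\<forall>x\<in>topspace X. \<forall>t\<in>{0..1}. x = a \<or> t = 0 \<or> t = 1 \<longrightarrow> G (x, t) = N)"
proof -
  let ?I = "top_of_set {0..1::real}"
  let ?C = "prod_topology X ?I"
  let ?IC = "prod_topology ?I ?C"
  obtain \<mu> \<rho> where \<mu>: "continuous_map X ?I \<mu>" "\<mu> a = 0"
      and \<rho>: "\<And>x. x \<in> topspace X \<Longrightarrow> \<mu> x < 1 \<Longrightarrow> \<rho> x = a"
      and hom: "homotopic_with (\<lambda>h. h a = a) X X id \<rho>"
    using a unfolding ndr_point_def by blast
  have aX: "a \<in> topspace X"
    using a unfolding ndr_point_def by blast
  have \<rho>c: "continuous_map X X \<rho>" and \<rho>a: "\<rho> a = a"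
    using homotopic_with_imp_continuous_maps[OF hom] homotopic_with_imp_property[OF hom] by auto
  have \<rho>X: "\<rho> x \<in> topspace X" if "x \<in> topspace X" for x
    using continuous_map_funspace[OF \<rho>c] that by (auto simp: Pi_iff)
  have \<mu>1: "0 \<le> \<mu> x" "\<mu> x \<le> 1" if "x \<in> topspace X" for x
    using continuous_map_funspace[OF \<mu>(1)] that by (auto simp: Pi_iff)
  have pc: "continuous_map ?C Z p"
    using p quotient_imp_continuous_map unfolding double_cone_map_def by blast
  have pN: "p (x, 0) = N" and pS: "p (x, 1) = S" if "x \<in> topspace X" for x
    using p that unfolding double_cone_map_def by auto
  have cs: "continuous_map ?IC euclideanreal fst"
    using continuous_map_fst continuous_map_in_subtopology by blast
  have cx: "continuous_map ?IC X (\<lambda>z. fst (snd z))"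
    using continuous_map_compose[OF continuous_map_snd continuous_map_fst] by (simp add: o_def)
  have ct: "continuous_map ?IC euclideanreal (\<lambda>z. snd (snd z))"
  proof -
    have "continuous_map ?C euclideanreal snd"
      using continuous_map_snd continuous_map_in_subtopology by blast
    from continuous_map_compose[OF continuous_map_snd this] show ?thesis
      by (simp add: o_def)
  qed
  have c\<mu>: "continuous_map ?IC euclideanreal (\<lambda>z. \<mu> (fst (snd z)))"
  proof -
    have "continuous_map X euclideanreal \<mu>"
      using \<mu>(1) continuous_map_in_subtopology by blast
    from continuous_map_compose[OF cx this] show ?thesis
      by (simp add: o_def)
  qed
  have c\<rho>: "continuous_map ?IC X (\<lambda>z. \<rho> (fst (snd z)))"
    using continuous_map_compose[OF cx \<rho>c] by (simp add: o_def)
  have cp: "continuous_map ?IC Z (\<lambda>z. p (f z, g z))"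
    if "continuous_map ?IC X f" "continuous_map ?IC euclideanreal g"
      "\<And>z. z \<in> topspace ?IC \<Longrightarrow> g z \<in> {0..1}" for f g
  proof -
    have "continuous_map ?IC ?C (\<lambda>z. (f z, g z))"
      using that by (intro continuous_map_pairedI continuous_map_into_subtopology) auto
    from continuous_map_compose[OF this pc] show ?thesis
      by (simp add: o_def)
  qed

  have resp: "P h = P k" if "\<And>z. z \<in> topspace ?C \<Longrightarrow> h z = k z" for h k
    using that aX unfolding P_def by auto

  \<comment> \<open>\<open>F1\<close>, \<open>F2\<close> and \<open>G\<close> are the ends of the
    three stages. The clamps \<open>min 1\<close> take effect only on the half of the interval where
    a branch is not selected: they keep its argument in the unit interval there, so that each branch
    is continuous on the whole product before the two are pasted.\<close>
  define F1 where "F1 = (\<lambda>(x, t). p (\<rho> x, t))"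
  define F2 where "F2 = (\<lambda>(x, t). if 2 * t \<le> 1 then p (\<rho> x, min 1 (2 * t)) else p (a, min 1 (2 - 2 * t)))"
  define G where "G = (\<lambda>(x, t). if 2 * t \<le> 1 then p (\<rho> x, \<mu> x * min 1 (2 * t))
    else p (a, \<mu> x * min 1 (2 - 2 * t)))"

  have 1: "homotopic_with P ?C Z p F1"
  proof -
    have "homotopic_with (\<lambda>h. \<exists>i. i a = a \<and> (\<forall>x\<in>topspace X. i x \<in> topspace X) \<and> h = (\<lambda>(x, t). (i x, t)))
        ?C ?C (\<lambda>z. (id (fst z), id (snd z))) (\<lambda>z. (\<rho> (fst z), id (snd z)))"
    proof (rule homotopic_with_prod_topology[where q = "\<lambda>j. j = id"])
      show "homotopic_with (\<lambda>h. h a = a \<and> (\<forall>x\<in>topspace X. h x \<in> topspace X)) X X id \<rho>"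
        by (rule homotopic_with_mono[OF hom]) (auto simp: continuous_map_def Pi_iff)
    qed auto
    then have "homotopic_with P ?C Z (p \<circ> (\<lambda>z. (id (fst z), id (snd z)))) (p \<circ> (\<lambda>z. (\<rho> (fst z), id (snd z))))"
    proof (rule homotopic_with_compose_continuous_map_left[OF _ pc])
      fix h :: "'a \<times> real \<Rightarrow> 'a \<times> real"
      assume "\<exists>i. i a = a \<and> (\<forall>x\<in>topspace X. i x \<in> topspace X) \<and> h = (\<lambda>(x, t). (i x, t))"
      then show "P (p \<circ> h)"
        using aX by (auto simp: P_def pN pS)
    qed
    then show ?thesis
      by (simp add: o_def F1_def case_prod_unfold)
  qed

  have 2: "homotopic_with P ?C Z F1 F2"
  proof -
    \<comment> \<open>Meridians are traversed at speed \<open>1 + s\<close>; beyond the south pole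
      the motion returns along the meridian of \<open>a\<close>. At time \<open>1\<close> all of
      them end in the same point \<open>p (a, 1 - s)\<close>, which moves with \<open>s\<close>:
      this is why \<open>P\<close> demands a common end instead of the end \<open>S\<close>.\<close>
    define H where "H = (\<lambda>z. if (1 + fst z) * snd (snd z) \<le> 1
      then p (\<rho> (fst (snd z)), min 1 ((1 + fst z) * snd (snd z)))
      else p (a, min 1 (2 - (1 + fst z) * snd (snd z))))"
    have bd: "0 \<le> (1 + s) * t" "(1 + s) * t \<le> 2" if "s \<in> {0..1}" "t \<in> {0..1}" for s t :: real
      using that mult_mono[of "1 + s" 2 t 1] by auto
    have P: "P (\<lambda>z. H (s, z))" if s: "s \<in> {0..1}" for s
      unfolding P_def
    proof (intro conjI ballI)
      fix x assume x: "x \<in> topspace X"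
      show "H (s, x, 0) = N"
        using x by (simp add: H_def pN \<rho>X)
      show "H (s, x, 1) = H (s, a, 1)"
        using x s aX by (simp add: H_def pS \<rho>X \<rho>a min_def)
    next
      fix t :: real assume t: "t \<in> {0..1}"
      show "H (s, a, t) \<in> (\<lambda>t. p (a, t)) ` {0..1}"
        using bd[OF s t] by (auto simp: H_def \<rho>a)
    qed
    have c: "continuous_map ?IC Z H"
      unfolding H_def
    proof (rule continuous_map_cases_le)
      show "continuous_map ?IC euclideanreal (\<lambda>z. (1 + fst z) * snd (snd z))"
        by (intro continuous_intros cs ct) auto
      show "continuous_map ?IC euclideanreal (\<lambda>z. 1)"
        by simp
      show "continuous_map (subtopology ?IC {x \<in> topspace ?IC. (1 + fst x) * snd (snd x) \<le> 1}) Z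
          (\<lambda>z. p (\<rho> (fst (snd z)), min 1 ((1 + fst z) * snd (snd z))))"
        by (rule continuous_map_from_subtopology, rule cp)
          (use bd in \<open>auto intro!: continuous_intros cs ct c\<rho>\<close>)
      show "continuous_map (subtopology ?IC {x \<in> topspace ?IC. 1 \<le> (1 + fst x) * snd (snd x)}) Z
          (\<lambda>z. p (a, min 1 (2 - (1 + fst z) * snd (snd z))))"
        by (rule continuous_map_from_subtopology, rule cp)
          (use bd aX in \<open>auto intro!: continuous_intros cs ct\<close>)
      show "p (\<rho> (fst (snd x)), min 1 ((1 + fst x) * snd (snd x))) = p (a, min 1 (2 - (1 + fst x) * snd (snd x)))"
        if "x \<in> topspace ?IC" "(1 + fst x) * snd (snd x) = 1" for x
        using that aX by (auto simp: pS \<rho>X)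
    qed
    show ?thesis
    proof (rule homotopic_with[where P = P, THEN iffD2, OF resp], assumption, rule exI[of _ H], intro conjI ballI)
      show "H (0, z) = F1 z" "H (1, z) = F2 z" if "z \<in> topspace ?C" for z
        using that by (auto simp: H_def F1_def F2_def)
    qed (fact c P)+
  qed
  have 3: "homotopic_with P ?C Z F2 G"
  proof -
    \<comment> \<open>\<open>l\<close> is the height up to which a meridian is climbed; it shrinks
      from \<open>1\<close> to \<open>\<mu> x\<close>.\<close>
    define l where "l = (\<lambda>z :: real \<times> 'a \<times> real. 1 - fst z + fst z * \<mu> (fst (snd z)))"
    define H where "H = (\<lambda>z. if 2 * snd (snd z) \<le> 1
      then p (\<rho> (fst (snd z)), l z * min 1 (2 * snd (snd z)))
      else p (a, l z * min 1 (2 - 2 * snd (snd z))))"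
    have l: "0 \<le> l (s, x, t)" "l (s, x, t) \<le> 1" if "s \<in> {0..1}" "x \<in> topspace X" for s x t
    proof -
      show "0 \<le> l (s, x, t)"
        using that \<mu>1[of x] by (simp add: l_def)
      have "s * \<mu> x \<le> s"
        using that \<mu>1[of x] by (simp add: mult_left_le)
      then show "l (s, x, t) \<le> 1"
        by (simp add: l_def)
    qed
    have bd: "l (s, x, t) * min 1 u \<in> {0..1}" if "s \<in> {0..1}" "x \<in> topspace X" "0 \<le> u" for s x t u
      using l[OF that(1,2), of t] that(3) by (auto intro: mult_le_one)
    have P: "P (\<lambda>z. H (s, z))" if s: "s \<in> {0..1}" for s
      unfolding P_def
    proof (intro conjI ballI)
      fix x assume x: "x \<in> topspace X"
      show "H (s, x, 0) = N" "H (s, x, 1) = H (s, a, 1)"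
        using x aX by (simp_all add: H_def pN \<rho>X)
    next
      fix t :: real assume t: "t \<in> {0..1}"
      show "H (s, a, t) \<in> (\<lambda>t. p (a, t)) ` {0..1}"
      proof -
        have "p (a, l (s, a, t) * min 1 u) \<in> (\<lambda>t. p (a, t)) ` {0..1}" if "0 \<le> u" for u
          using bd[OF s aX that] by (rule imageI)
        from this[of "2 * t"] this[of "2 - 2 * t"] show ?thesis
          using t by (auto simp: H_def \<rho>a)
      qed
    qed
    have cl: "continuous_map ?IC euclideanreal l"
      unfolding l_def by (intro continuous_intros cs c\<mu>) auto
    have c: "continuous_map ?IC Z H"
      unfolding H_def
    proof (rule continuous_map_cases_le)
      show "continuous_map ?IC euclideanreal (\<lambda>z. 2 * snd (snd z))"
        by (intro continuous_intros ct) auto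
      show "continuous_map ?IC euclideanreal (\<lambda>z. 1)"
        by simp
      show "continuous_map (subtopology ?IC {x \<in> topspace ?IC. 2 * snd (snd x) \<le> 1}) Z
          (\<lambda>z. p (\<rho> (fst (snd z)), l z * min 1 (2 * snd (snd z))))"
      proof (rule continuous_map_from_subtopology, rule cp[OF c\<rho>])
        show "l z * min 1 (2 * snd (snd z)) \<in> {0..1}" if "z \<in> topspace ?IC" for z
          using that bd[of "fst z" "fst (snd z)" "2 * snd (snd z)" "snd (snd z)"] by auto
      qed (intro continuous_intros cl ct, auto)
      show "continuous_map (subtopology ?IC {x \<in> topspace ?IC. 1 \<le> 2 * snd (snd x)}) Z
          (\<lambda>z. p (a, l z * min 1 (2 - 2 * snd (snd z))))"
      proof (rule continuous_map_from_subtopology, rule cp)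
        show "l z * min 1 (2 - 2 * snd (snd z)) \<in> {0..1}" if "z \<in> topspace ?IC" for z
          using that bd[of "fst z" "fst (snd z)" "2 - 2 * snd (snd z)" "snd (snd z)"] by auto
        show "continuous_map ?IC X (\<lambda>z. a)"
          using aX by simp
      qed (intro continuous_intros cl ct, auto)
      show "p (\<rho> (fst (snd z)), l z * min 1 (2 * snd (snd z))) = p (a, l z * min 1 (2 - 2 * snd (snd z)))"
        if z: "z \<in> topspace ?IC" "2 * snd (snd z) = 1" for z
      proof -
        have zX: "fst (snd z) \<in> topspace X"
          using z by auto
        \<comment> \<open>Turning back below the pole is continuous only where both branches follow
          the same meridian. If \<open>\<mu> < 1\<close>, then \<open>\<rho>\<close> has the value
          \<open>a\<close>; otherwise \<open>l\<close> is \<open>1\<close> and the branches meet in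
          the pole.\<close>
        have "l z = 1 \<or> \<rho> (fst (snd z)) = a"
          using \<rho>[OF zX] \<mu>1[OF zX] by (cases "\<mu> (fst (snd z)) < 1") (auto simp: l_def)
        then show ?thesis
          using z(2) aX zX by (auto simp: pS \<rho>X)
      qed
    qed
    show ?thesis
    proof (rule homotopic_with[where P = P, THEN iffD2, OF resp], assumption, rule exI[of _ H], intro conjI ballI)
      show "H (0, z) = F2 z" "H (1, z) = G z" if "z \<in> topspace ?C" for z
        by (auto simp: H_def F2_def G_def l_def case_prod_unfold)
    qed (fact c P)+
  qed
  show ?thesis
  proof (rule exI[of _ G], intro conjI ballI impI)
    show "homotopic_with P ?C Z p G"
      using homotopic_with_trans[OF homotopic_with_trans[OF 1 2] 3] .
    show "G (x, t) = N" if "x \<in> topspace X" "t \<in> {0..1}" "x = a \<or> t = 0 \<or> t = 1" for x t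
      using that aX by (auto simp: G_def \<mu> pN \<rho>X)
  qed
qed

text \<open>Collapsing the meridian of \<open>a\<close> maps \<open>Z\<close> to \<open>Y\<close>.
  The end \<open>G\<close> of the homotopy is constant on this meridian and on both ends of the
  cylinder, so it factors through \<open>Y\<close> and provides the inverse. For the composite on
  \<open>Z\<close>, the stages descend along \<open>p\<close> because on each end of the cylinder
  they do not depend on \<open>x\<close>. For the composite on \<open>Y\<close>, they descend along
  \<open>q\<close> after the collapse, because they also keep the meridian of \<open>a\<close>
  within itself.\<close>

lemma pointed_heq_suspension_double_cone:
  fixes X :: "'a topology" and Z :: "'b topology" and Y :: "'c topology"
  assumes p: "double_cone_map X Z N S p" and a: "ndr_point X a" and q: "suspension_map X a Y y q"
  shows "pointed_heq Y y Z N"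
proof -
  let ?C = "prod_topology X (top_of_set {0..1::real})"
  let ?P = "\<lambda>h. (\<forall>x\<in>topspace X. h (x, 0) = N \<and> h (x, 1) = h (a, 1)) \<and>
      (\<forall>t\<in>{0..1}. h (a, t) \<in> (\<lambda>t. p (a, t)) ` {0..1})"
  obtain G where hG: "homotopic_with ?P ?C Z p G"
      and GN: "\<And>x t. x \<in> topspace X \<Longrightarrow> t \<in> {0..1} \<Longrightarrow> x = a \<or> t = 0 \<or> t = 1 \<Longrightarrow> G (x, t) = N"
    using double_cone_homotopy[OF p a] by (elim exE conjE) blast
  have aX: "a \<in> topspace X"
    using a unfolding ndr_point_def by blast
  have qp: "quotient_map ?C Z p" and qq: "quotient_map ?C Y q"
    using p q unfolding double_cone_map_def suspension_map_def by blast+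
  have pN: "p (x, 0) = N" and pS: "p (x, 1) = S" if "x \<in> topspace X" for x
    using p that unfolding double_cone_map_def by auto
  have qy: "q (x, t) = y \<longleftrightarrow> x = a \<or> t = 0 \<or> t = 1" if "x \<in> topspace X" "t \<in> {0..1}" for x t
    using q that unfolding suspension_map_def by blast
  have cong: "h z = h z'"
    if "z \<in> topspace ?C" "z' \<in> topspace ?C" "p z = p z'"
      and h: "\<And>x. x \<in> topspace X \<Longrightarrow> h (x, 0) = h (a, 0)" "\<And>x. x \<in> topspace X \<Longrightarrow> h (x, 1) = h (a, 1)"
    for h :: "'a \<times> real \<Rightarrow> 'd" and z z'
  proof -
    obtain x t x' t' where z: "z = (x, t)" "z' = (x', t')"
      by (cases z, cases z')
    have mem: "x \<in> topspace X" "t \<in> {0..1}" "x' \<in> topspace X" "t' \<in> {0..1}"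
      using that(1,2) z by auto
    have "p (x, t) = p (x', t') \<longrightarrow> t = t' \<and> (t = 0 \<or> t = 1 \<or> x = x')"
      using p mem unfolding double_cone_map_def by blast
    then have "t = t'" "t = 0 \<or> t = 1 \<or> x = x'"
      using that(3) z by auto
    then show ?thesis
      using h(1)[OF mem(1)] h(1)[OF mem(3)] h(2)[OF mem(1)] h(2)[OF mem(3)] by (auto simp: z)
  qed
  have "\<exists>f. continuous_map Z Y f \<and> (\<forall>z\<in>topspace ?C. f (p z) = q z)"
  proof (rule quotient_map_lift[OF qp quotient_imp_continuous_map[OF qq]], intro ballI impI)
    fix z z' assume "z \<in> topspace ?C" "z' \<in> topspace ?C" "p z = p z'"
    then show "q z = q z'"
    proof (rule cong)
      fix x assume "x \<in> topspace X"
      then show "q (x, 0) = q (a, 0)" "q (x, 1) = q (a, 1)"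
        using qy[of x 0] qy[of a 0] qy[of x 1] qy[of a 1] aX by simp_all
    qed
  qed
  then obtain f where f: "continuous_map Z Y f" "\<And>z. z \<in> topspace ?C \<Longrightarrow> f (p z) = q z"
    by blast
  have Gc: "continuous_map ?C Z G"
    using homotopic_with_imp_continuous_maps[OF hG] by blast
  have "\<exists>g. continuous_map Y Z g \<and> (\<forall>z\<in>topspace ?C. g (q z) = G z)"
  proof (rule quotient_map_lift[OF qq Gc], intro ballI impI)
    fix z z' assume z: "z \<in> topspace ?C" "z' \<in> topspace ?C" "q z = q z'"
    show "G z = G z'"
      by (rule suspension_map_cong[OF q z]) (rule GN)
  qed
  then obtain g where g: "continuous_map Y Z g" "\<And>z. z \<in> topspace ?C \<Longrightarrow> g (q z) = G z"
    by blast
  have base: "(a, 0) \<in> topspace ?C" "p (a, 0) = N" "q (a, 0) = y" "G (a, 0) = N"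
    using aX pN qy[of a 0] GN[of a 0] by auto
  have fN: "f N = y" and gy: "g y = N"
    using f(2)[OF base(1)] g(2)[OF base(1)] base by auto
  have qC: "q z \<in> topspace Y" "p z \<in> topspace Z" if "z \<in> topspace ?C" for z
    using that quotient_imp_surjective_map[OF qq] quotient_imp_surjective_map[OF qp] by blast+
  have yY: "y \<in> topspace Y" and NZ: "N \<in> topspace Z"
    using qC[OF base(1)] base by auto
  have "homotopic_with (\<lambda>k. k (p (a, 0)) = N) Z Z id (g \<circ> f)"
  proof (rule homotopic_with_quotient[OF qp hG])
    fix h :: "'a \<times> real \<Rightarrow> 'b" and z z' assume h: "?P h" and z: "z \<in> topspace ?C" "z' \<in> topspace ?C" "p z = p z'"
    show "h z = h z'"
    proof (rule cong[OF z])
      fix x assume x: "x \<in> topspace X"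
      have "h (x, 0) = N" "h (a, 0) = N" "h (x, 1) = h (a, 1)"
        using h x aX by blast+
      then show "h (x, 0) = h (a, 0)" "h (x, 1) = h (a, 1)"
        by simp_all
    qed
  next
    show "h (a, 0) = N" if "?P h" for h :: "'a \<times> real \<Rightarrow> 'b"
      using that aX by blast
    show "id (p z) = p z" "(g \<circ> f) (p z) = G z" if "z \<in> topspace ?C" for z
      using f(2)[OF that] g(2)[OF that] by simp_all
  qed (rule base(1))
  then have gf: "homotopic_with (\<lambda>k. k N = N) Z Z (g \<circ> f) id"
    using base(2) homotopic_with_symD by auto
  have "homotopic_with (\<lambda>k. \<exists>h. ?P h \<and> k = f \<circ> h) ?C Y (f \<circ> p) (f \<circ> G)"
    by (rule homotopic_with_compose_continuous_map_left[OF hG f(1)]) blast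
  then have "homotopic_with (\<lambda>k. k (q (a, 0)) = y) Y Y id (f \<circ> g)"
  proof (rule homotopic_with_quotient[OF qq])
    fix k :: "'a \<times> real \<Rightarrow> 'c" and z z' assume "\<exists>h. ?P h \<and> k = f \<circ> h"
      and z: "z \<in> topspace ?C" "z' \<in> topspace ?C" "q z = q z'"
    then obtain h where h: "?P h" "k = f \<circ> h"
      by blast
    have arc: "f (p (a, t)) = y" if "t \<in> {0..1}" for t
      using f(2)[of "(a, t)"] that aX qy[of a t] by auto
    show "k z = k z'"
    proof (rule suspension_map_cong[OF q z])
      fix x t assume xt: "x \<in> topspace X" "t \<in> {0..1::real}" "x = a \<or> t = 0 \<or> t = 1"
      have "h (x, t) = N \<or> h (x, t) \<in> (\<lambda>t. p (a, t)) ` {0..1}"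
        using h(1) xt by (metis atLeastAtMost_iff order_refl zero_le_one)
      then show "k (x, t) = y"
        using arc fN h(2) by auto
    qed
  next
    fix k :: "'a \<times> real \<Rightarrow> 'c" assume "\<exists>h. ?P h \<and> k = f \<circ> h"
    then obtain h where "?P h" "k = f \<circ> h"
      by blast
    then show "k (a, 0) = y"
      using aX fN by simp
  next
    show "id (q z) = (f \<circ> p) z" "(f \<circ> g) (q z) = (f \<circ> G) z" if "z \<in> topspace ?C" for z
      using f(2)[OF that] g(2)[OF that] by simp_all
  qed (rule base(1))
  then have fg: "homotopic_with (\<lambda>k. k y = y) Y Y (f \<circ> g) id"
    using base(3) homotopic_with_symD by auto
  show ?thesis
    unfolding pointed_heq_def
    by (intro conjI exI[of _ g] exI[of _ f]) (fact yY NZ f(1) g(1) fN gy gf fg)+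
qed

section \<open>Finite simplicial complexes\<close>

definition simplicial_complex :: "'v set \<Rightarrow> 'v set set \<Rightarrow> bool" where
  "simplicial_complex V K \<longleftrightarrow> finite V \<and> (\<forall>\<sigma>\<in>K. \<sigma> \<subseteq> V) \<and> (\<forall>\<sigma>\<in>K. \<forall>\<tau>. \<tau> \<subseteq> \<sigma> \<longrightarrow> \<tau> \<in> K)"

lemma simplicial_complexD:
  assumes "simplicial_complex V K"
  shows "finite V" "\<sigma> \<in> K \<Longrightarrow> \<sigma> \<subseteq> V" "\<sigma> \<in> K \<Longrightarrow> \<tau> \<subseteq> \<sigma> \<Longrightarrow> \<tau> \<in> K"
  using assms unfolding simplicial_complex_def by auto

lemma topspace_geometric_realization:
  "topspace (geometric_realization K) =
     {x. (\<forall>v. 0 \<le> x v) \<and> {v. x v \<noteq> 0} \<in> K \<and> (\<Sum>v | x v \<noteq> 0. x v) = 1}"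
  by (simp add: geometric_realization_def)

lemma in_geometric_realization_iff:
  assumes "simplicial_complex V K"
  shows "x \<in> topspace (geometric_realization K) \<longleftrightarrow>
     (\<forall>v. 0 \<le> x v) \<and> {v. x v \<noteq> 0} \<in> K \<and> (\<Sum>v\<in>V. x v) = 1"
proof -
  have "(\<Sum>v | x v \<noteq> 0. x v) = (\<Sum>v\<in>V. x v)" if "{v. x v \<noteq> 0} \<in> K"
    by (rule sum.mono_neutral_left) (use simplicial_complexD(1,2)[OF assms] that in auto)
  then show ?thesis
    by (auto simp: topspace_geometric_realization)
qed

lemma continuous_map_into_geometric_realization:
  "continuous_map X (geometric_realization K) f \<longleftrightarrow>
     (\<forall>v. continuous_map X euclideanreal (\<lambda>x. f x v)) \<and>
     f ` topspace X \<subseteq> topspace (geometric_realization K)"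
  unfolding topspace_geometric_realization
  by (auto simp: geometric_realization_def continuous_map_in_subtopology continuous_map_componentwise_UNIV)

lemma continuous_map_geometric_realization_coord [continuous_intros]:
  "continuous_map (geometric_realization K) euclideanreal (\<lambda>x. x v)"
  unfolding geometric_realization_def
  by (intro continuous_map_from_subtopology continuous_map_product_projection) simp

lemma Hausdorff_geometric_realization: "Hausdorff_space (geometric_realization K)"
  by (simp add: geometric_realization_def Hausdorff_space_subtopology Hausdorff_space_product_topology)

lemma compact_geometric_realization:
  fixes K :: "'v set set"
  assumes K: "simplicial_complex V K"
  shows "compact_space (geometric_realization K)"
proof -
  let ?P = "powertop_real (UNIV :: 'v set)"
  define S where "S \<sigma> = {x. (\<forall>v. 0 \<le> x v) \<and> {v. x v \<noteq> 0} \<subseteq> \<sigma> \<and> (\<Sum>v\<in>\<sigma>. x v) = (1::real)}"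
    for \<sigma> :: "'v set"
  have fin: "finite \<sigma>" if "\<sigma> \<in> K" for \<sigma>
    using finite_subset[OF simplicial_complexD(2)[OF K that] simplicial_complexD(1)[OF K]] .
  have "compactin ?P (S \<sigma>)" if "\<sigma> \<in> K" for \<sigma>
  proof -
    \<comment> \<open>The closed simplex on \<open>\<sigma>\<close> is cut out by a closed condition
      from a product of intervals and points, which is compact by Tychonoff.\<close>
    let ?B = "PiE UNIV (\<lambda>v. if v \<in> \<sigma> then {0..1::real} else {0})"
    let ?C = "{x \<in> topspace ?P. (\<Sum>v\<in>\<sigma>. x v) \<in> {1}}"
    have "compactin ?P ?B"
      by (auto simp: compactin_PiE)
    moreover have "closedin ?P ?C"
      by (rule closedin_continuous_map_preimage[where Y = euclideanreal])
        (auto intro!: continuous_map_sum continuous_map_product_projection fin that)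
    moreover have "S \<sigma> = ?B \<inter> ?C"
    proof -
      have "x v \<le> 1" if "\<forall>v. 0 \<le> x v" "(\<Sum>v\<in>\<sigma>. x v) = 1" "v \<in> \<sigma>" for x :: "'v \<Rightarrow> real" and v
        using member_le_sum[of v \<sigma> x] that fin[OF \<open>\<sigma> \<in> K\<close>] by auto
      then show ?thesis
        unfolding S_def set_eq_iff
        by (auto simp: PiE_UNIV_domain Pi_iff subset_iff split: if_splits) (metis order_refl)
    qed
    ultimately show ?thesis
      by (simp add: compact_Int_closedin)
  qed
  moreover have "finite K"
    by (rule finite_subset[of _ "Pow V"]) (use simplicial_complexD(1,2)[OF K] in auto)
  ultimately have "compactin ?P (\<Union>(S ` K))"
    by (intro compactin_Union) auto
  moreover have "\<Union>(S ` K) = topspace (geometric_realization K)"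
  proof -
    have "(\<Sum>v\<in>\<sigma>. x v) = (\<Sum>v\<in>V. x v)" if "\<sigma> \<in> K" "{v. x v \<noteq> 0} \<subseteq> \<sigma>" for \<sigma> and x :: "'v \<Rightarrow> real"
      by (rule sum.mono_neutral_left) (use simplicial_complexD(1,2)[OF K] that in auto)
    moreover have "{v. x v \<noteq> 0} \<in> K" if "\<sigma> \<in> K" "{v. x v \<noteq> 0} \<subseteq> \<sigma>" for \<sigma> and x :: "'v \<Rightarrow> real"
      using simplicial_complexD(3)[OF K that] .
    ultimately show ?thesis
      unfolding S_def set_eq_iff in_geometric_realization_iff[OF K] by (simp add: conj_ac) (metis order_refl)
  qed
  ultimately show ?thesis
    unfolding topspace_geometric_realization by (simp add: geometric_realization_def compact_space_subtopology)
qed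

lemma geometric_realization_convex:
  assumes K: "simplicial_complex V K"
    and x: "x \<in> topspace (geometric_realization K)" and y: "y \<in> topspace (geometric_realization K)"
    and xy: "{v. x v \<noteq> 0 \<or> y v \<noteq> 0} \<in> K" and t: "t \<in> {0..1}"
  shows "(\<lambda>v. (1 - t) * x v + t * y v) \<in> topspace (geometric_realization K)"
  unfolding in_geometric_realization_iff[OF K]
proof (intro conjI allI)
  note fi = in_geometric_realization_iff[OF K]
  show "0 \<le> (1 - t) * x v + t * y v" for v
    using x y t unfolding fi by simp
  have "{v. (1 - t) * x v + t * y v \<noteq> 0} \<subseteq> {v. x v \<noteq> 0 \<or> y v \<noteq> 0}"
    by auto
  then show "{v. (1 - t) * x v + t * y v \<noteq> 0} \<in> K"
    by (rule simplicial_complexD(3)[OF K xy])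
  have "(\<Sum>v\<in>V. (1 - t) * x v + t * y v) = (1 - t) * (\<Sum>v\<in>V. x v) + t * (\<Sum>v\<in>V. y v)"
    by (simp add: sum.distrib sum_distrib_left)
  then show "(\<Sum>v\<in>V. (1 - t) * x v + t * y v) = 1"
    using x y unfolding fi by simp
qed

lemma homotopic_with_geometric_realization_linear:
  assumes K: "simplicial_complex V K"
    and f: "continuous_map X (geometric_realization K) f"
    and g: "continuous_map X (geometric_realization K) g"
    and fg: "\<And>x. x \<in> topspace X \<Longrightarrow> {v. f x v \<noteq> 0 \<or> g x v \<noteq> 0} \<in> K"
    and P: "\<And>t. t \<in> {0..1} \<Longrightarrow> P (\<lambda>x v. (1 - t) * f x v + t * g x v)"
  shows "homotopic_with P X (geometric_realization K) f g"
  unfolding homotopic_with_def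
proof (rule exI[of _ "\<lambda>z v. (1 - fst z) * f (snd z) v + fst z * g (snd z) v"], intro conjI allI ballI)
  let ?I = "top_of_set {0..1::real}"
  have c: "continuous_map (prod_topology ?I X) euclideanreal (\<lambda>z. f (snd z) v)"
      "continuous_map (prod_topology ?I X) euclideanreal (\<lambda>z. g (snd z) v)" for v
    using f g continuous_map_compose[OF continuous_map_snd, unfolded o_def]
    unfolding continuous_map_into_geometric_realization by blast+
  have I: "continuous_map (prod_topology ?I X) euclideanreal fst"
    using continuous_map_fst continuous_map_in_subtopology by blast
  show "continuous_map (prod_topology ?I X) (geometric_realization K)
      (\<lambda>z v. (1 - fst z) * f (snd z) v + fst z * g (snd z) v)"
    unfolding continuous_map_into_geometric_realization
  proof (intro conjI allI subsetI)
    show "continuous_map (prod_topology ?I X) euclideanreal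
         (\<lambda>z. (1 - fst z) * f (snd z) v + fst z * g (snd z) v)" for v
      by (intro continuous_intros c I) auto
    fix y assume "y \<in> (\<lambda>z v. (1 - fst z) * f (snd z) v + fst z * g (snd z) v) ` topspace (prod_topology ?I X)"
    then obtain t x where t: "t \<in> {0..1}" and x: "x \<in> topspace X"
      and y: "y = (\<lambda>v. (1 - t) * f x v + t * g x v)"
      by auto
    have "f x \<in> topspace (geometric_realization K)" "g x \<in> topspace (geometric_realization K)"
      using f g x continuous_map_funspace by blast+
    then show "y \<in> topspace (geometric_realization K)"
      unfolding y by (rule geometric_realization_convex[OF K _ _ fg[OF x] t])
  qed
  show "P (\<lambda>x v. (1 - fst (t, x)) * f (snd (t, x)) v + fst (t, x) * g (snd (t, x)) v)" if "t \<in> {0..1}" for t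
    using P[OF that] by simp
qed auto

lemma geometric_realization_remove_faces:
  assumes K: "simplicial_complex V K"
    and V: "u \<in> V" "v \<in> V" "w \<in> V" and w: "w \<noteq> u" "w \<noteq> v"
    and ext: "\<And>\<sigma>. \<sigma> \<in> K \<Longrightarrow> u \<in> \<sigma> \<Longrightarrow> v \<in> \<sigma> \<Longrightarrow> insert w \<sigma> \<in> K"
  shows "geometric_realization K homotopy_equivalent_space
         geometric_realization {\<sigma> \<in> K. \<not> (u \<in> \<sigma> \<and> v \<in> \<sigma>)}"
proof -
  let ?K' = "{\<sigma> \<in> K. \<not> (u \<in> \<sigma> \<and> v \<in> \<sigma>)}"
  have K': "simplicial_complex V ?K'"
    unfolding simplicial_complex_def
  proof (intro conjI ballI allI impI)
    show "finite V"
      by (rule simplicial_complexD(1)[OF K])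
    fix \<sigma> assume "\<sigma> \<in> ?K'"
    then have \<sigma>: "\<sigma> \<in> K" "\<not> (u \<in> \<sigma> \<and> v \<in> \<sigma>)"
      by auto
    show "\<sigma> \<subseteq> V"
      by (rule simplicial_complexD(2)[OF K \<sigma>(1)])
    show "\<tau> \<in> ?K'" if "\<tau> \<subseteq> \<sigma>" for \<tau>
      using simplicial_complexD(3)[OF K \<sigma>(1) that] \<sigma>(2) that by auto
  qed
  \<comment> \<open>The amount \<open>m x\<close> is taken from \<open>u\<close> and from
    \<open>v\<close>, so \<open>w\<close> gains it twice unless \<open>u = v\<close>. Allowing
    \<open>u = v\<close> makes the deletion of a vertex a case of the same move.\<close>
  define c :: real where "c = (if u = v then 1 else 2)"
  define m where "m x = min (x u) (x v)" for x :: "'a \<Rightarrow> real"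
  define r where "r x z = x z + (if z = w then c * m x else 0) - (if z = u \<or> z = v then m x else 0)"
    for x :: "'a \<Rightarrow> real" and z
  note fi = in_geometric_realization_iff[OF K] and fi' = in_geometric_realization_iff[OF K']
  have m0: "m x \<ge> 0" if "\<forall>v. 0 \<le> x v" for x
    using that by (simp add: m_def)
  have r_id: "r x = x" if "m x = 0" for x
    using that by (auto simp: r_def)
  have sum: "(\<Sum>z\<in>V. r x z) = (\<Sum>z\<in>V. x z)" for x
  proof -
    have *: "(\<Sum>z\<in>V. if z = u \<or> z = v then m x else 0) = c * m x"
    proof -
      have "(\<Sum>z\<in>V. if z = u \<or> z = v then m x else 0) = (\<Sum>z\<in>{u, v}. m x)"
        by (rule sum.mono_neutral_cong_right) (use V simplicial_complexD(1)[OF K] in auto)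
      then show ?thesis
        by (simp add: c_def)
    qed
    show ?thesis
      using V simplicial_complexD(1)[OF K] by (simp add: r_def sum.distrib sum_subtractf *)
  qed
  have ge: "0 \<le> r x z" if "\<forall>v. 0 \<le> x v" for x z
    using that w m0[OF that] by (auto simp: r_def c_def) (auto simp: m_def)
  have supp: "{z. x z \<noteq> 0 \<or> r x z \<noteq> 0} \<in> K" if "x \<in> topspace (geometric_realization K)" for x
  proof (cases "m x = 0")
    case True
    then show ?thesis
      using that by (simp add: r_id fi)
  next
    case False
    then have "x u \<noteq> 0" "x v \<noteq> 0"
      using that unfolding fi by (auto simp: m_def)
    then have "insert w {z. x z \<noteq> 0} \<in> K"
      using that ext unfolding fi by blast
    moreover have "{z. x z \<noteq> 0 \<or> r x z \<noteq> 0} \<subseteq> insert w {z. x z \<noteq> 0}"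
      using \<open>x u \<noteq> 0\<close> \<open>x v \<noteq> 0\<close> by (auto simp: r_def split: if_splits)
    ultimately show ?thesis
      by (rule simplicial_complexD(3)[OF K])
  qed
  have rK': "r x \<in> topspace (geometric_realization ?K')" if "x \<in> topspace (geometric_realization K)" for x
  proof -
    have "r x u = 0 \<or> r x v = 0"
      using w by (auto simp: r_def m_def min_def)
    moreover have "{z. r x z \<noteq> 0} \<in> K"
      by (rule simplicial_complexD(3)[OF K supp[OF that]]) auto
    ultimately show ?thesis
      using that ge sum unfolding fi fi' by auto
  qed
  have sub: "x \<in> topspace (geometric_realization K)" if "x \<in> topspace (geometric_realization ?K')" for x
    using that unfolding fi fi' by auto
  have rc: "continuous_map (geometric_realization K) euclideanreal (\<lambda>x. r x z)" for z
    unfolding r_def m_def by (cases "z = w"; cases "z = u \<or> z = v") (auto intro!: continuous_intros)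
  have "homotopic_with (\<lambda>x. True) (geometric_realization K) (geometric_realization K) r id"
  proof (rule homotopic_with_geometric_realization_linear[OF K])
    show "continuous_map (geometric_realization K) (geometric_realization K) r"
      unfolding continuous_map_into_geometric_realization using rc rK' sub by auto
    show "{z. r x z \<noteq> 0 \<or> id x z \<noteq> 0} \<in> K" if "x \<in> topspace (geometric_realization K)" for x
      using supp[OF that] by (simp add: disj_commute)
  qed auto
  moreover have "retraction_maps (geometric_realization K) (geometric_realization ?K') r id"
    unfolding retraction_maps_def
  proof (intro conjI ballI)
    show "continuous_map (geometric_realization K) (geometric_realization ?K') r"
      unfolding continuous_map_into_geometric_realization using rc rK' by auto
    show "continuous_map (geometric_realization ?K') (geometric_realization K) id"
      unfolding continuous_map_into_geometric_realization using sub
      by (auto intro: continuous_map_geometric_realization_coord)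
    show "r (id x) = x" if "x \<in> topspace (geometric_realization ?K')" for x
    proof -
      have "x u = 0 \<or> x v = 0" "\<forall>z. 0 \<le> x z"
        using that unfolding fi' by auto
      then have "m x = 0"
        by (auto simp: m_def min_def order_antisym)
      then show ?thesis
        by (simp add: r_id)
    qed
  qed
  ultimately show ?thesis
    by (rule deformation_retract_imp_homotopy_equivalent_space)
qed

section \<open>Flag complexes and the deletion of dominated vertices and edges\<close>

definition flag_complex :: "'v set \<Rightarrow> ('v \<Rightarrow> 'v \<Rightarrow> bool) \<Rightarrow> 'v set set" where
  "flag_complex V R = {\<sigma>. \<sigma> \<subseteq> V \<and> (\<forall>u\<in>\<sigma>. \<forall>v\<in>\<sigma>. u \<noteq> v \<longrightarrow> R u v)}"

lemma simplicial_complex_flag: "finite V \<Longrightarrow> simplicial_complex V (flag_complex V R)"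
  unfolding simplicial_complex_def flag_complex_def by (auto simp: subset_iff)

abbreviation flag_space :: "'v set \<Rightarrow> ('v \<Rightarrow> 'v \<Rightarrow> bool) \<Rightarrow> ('v \<Rightarrow> real) topology" where
  "flag_space V R \<equiv> geometric_realization (flag_complex V R)"

lemma in_flag_space_iff:
  assumes "finite V"
  shows "x \<in> topspace (flag_space V R) \<longleftrightarrow>
     (\<forall>v. 0 \<le> x v) \<and> (\<forall>v. x v \<noteq> 0 \<longrightarrow> v \<in> V) \<and>
     (\<forall>u v. x u \<noteq> 0 \<longrightarrow> x v \<noteq> 0 \<longrightarrow> u \<noteq> v \<longrightarrow> R u v) \<and> (\<Sum>v\<in>V. x v) = 1"
  unfolding in_geometric_realization_iff[OF simplicial_complex_flag[OF assms]]
  by (auto simp: flag_complex_def)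

lemma flag_complex_cong:
  assumes "\<And>u v. u \<in> V \<Longrightarrow> v \<in> V \<Longrightarrow> u \<noteq> v \<Longrightarrow> R u v = R' u v"
  shows "flag_complex V R = flag_complex V R'"
  unfolding flag_complex_def using assms by (auto simp: subset_iff)

text \<open>In the complementary graph this is the fold lemma for independence complexes: if every
  neighbour of \<open>w\<close> is a neighbour of \<open>v\<close>, then \<open>v\<close> may be
  dropped.\<close>

lemma flag_space_remove_vertex:
  assumes V: "finite V" and R: "symp R" and v: "v \<in> V" and w: "w \<in> V" "w \<noteq> v" "R v w"
    and dom: "\<And>x. x \<in> V \<Longrightarrow> x \<noteq> w \<Longrightarrow> x \<noteq> v \<Longrightarrow> R x v \<Longrightarrow> R x w"
  shows "flag_space V R homotopy_equivalent_space flag_space (V - {v}) R"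
proof -
  have "flag_space V R homotopy_equivalent_space
      geometric_realization {\<sigma> \<in> flag_complex V R. \<not> (v \<in> \<sigma> \<and> v \<in> \<sigma>)}"
  proof (rule geometric_realization_remove_faces[OF simplicial_complex_flag[OF V] v v w(1,2,2)])
    fix \<sigma> assume \<sigma>: "\<sigma> \<in> flag_complex V R" "v \<in> \<sigma>"
    have "R x w \<and> R w x" if "x \<in> \<sigma>" "x \<noteq> w" for x
    proof -
      have "R x w"
        using \<sigma> that dom[of x] w(3) unfolding flag_complex_def by (cases "x = v") auto
      then show ?thesis
        using sympD[OF R] by blast
    qed
    then show "insert w \<sigma> \<in> flag_complex V R"
      using \<sigma>(1) w(1) unfolding flag_complex_def by auto
  qed
  moreover have "{\<sigma> \<in> flag_complex V R. \<not> (v \<in> \<sigma> \<and> v \<in> \<sigma>)} = flag_complex (V - {v}) R"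
    unfolding flag_complex_def by auto
  ultimately show ?thesis
    by simp
qed

text \<open>The witnesses lie in \<open>U\<close> and are never deleted, and domination persists
  when other vertices disappear, so the deletions can be made in any order.\<close>

lemma flag_space_remove_vertices:
  assumes "finite V" and "symp R" and "U \<subseteq> V"
    and "\<And>v. v \<in> V \<Longrightarrow> v \<notin> U \<Longrightarrow>
           \<exists>w\<in>U. R v w \<and> (\<forall>x\<in>V. x \<noteq> w \<longrightarrow> x \<noteq> v \<longrightarrow> R x v \<longrightarrow> R x w)"
  shows "flag_space V R homotopy_equivalent_space flag_space U R"
  using assms
proof (induction "card (V - U)" arbitrary: V)
  case 0
  then have "V = U"
    by auto
  then show ?case
    by (simp add: homotopy_equivalent_space_refl)
next
  case (Suc k)
  then have "V - U \<noteq> {}"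
    by auto
  then obtain v where v: "v \<in> V" "v \<notin> U"
    by blast
  then obtain w where w: "w \<in> U" "R v w" "\<And>x. x \<in> V \<Longrightarrow> x \<noteq> w \<Longrightarrow> x \<noteq> v \<Longrightarrow> R x v \<Longrightarrow> R x w"
    using Suc.prems(4) by blast
  have "w \<in> V" "w \<noteq> v"
    using w v Suc.prems(3) by auto
  then have "flag_space V R homotopy_equivalent_space flag_space (V - {v}) R"
    using flag_space_remove_vertex[OF Suc.prems(1,2) v(1) _ _ w(2,3)] by blast
  moreover have "flag_space (V - {v}) R homotopy_equivalent_space flag_space U R"
  proof (rule Suc.hyps(1))
    have "V - {v} - U = (V - U) - {v}"
      by auto
    then show "k = card (V - {v} - U)"
      using Suc.hyps(2) v Suc.prems(1) by simp
    show "\<exists>w\<in>U. R u w \<and> (\<forall>x\<in>V - {v}. x \<noteq> w \<longrightarrow> x \<noteq> u \<longrightarrow> R x u \<longrightarrow> R x w)"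
      if "u \<in> V - {v}" "u \<notin> U" for u
      using Suc.prems(4)[of u] that by auto
  qed (use Suc.prems v in auto)
  ultimately show ?case
    by (rule homotopy_eqv_trans)
qed

text \<open>By \<open>dom\<close> and the edges from \<open>w\<close> to \<open>u\<close> and
  \<open>v\<close>, the link of the edge \<open>uv\<close> is a cone with apex \<open>w\<close>, so
  every simplex through the edge extends by \<open>w\<close>.\<close>

lemma flag_space_remove_edge:
  assumes V: "finite V" and R: "symp R" and uv: "u \<in> V" "v \<in> V" "u \<noteq> v"
    and w: "w \<in> V" "w \<noteq> u" "w \<noteq> v" "R w u" "R w v"
    and dom: "\<And>x. x \<in> V \<Longrightarrow> x \<noteq> w \<Longrightarrow> x \<noteq> u \<Longrightarrow> x \<noteq> v \<Longrightarrow> R x u \<Longrightarrow> R x v \<Longrightarrow> R x w"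
  shows "flag_space V R homotopy_equivalent_space flag_space V (\<lambda>x y. R x y \<and> {x, y} \<noteq> {u, v})"
proof -
  have "flag_space V R homotopy_equivalent_space
      geometric_realization {\<sigma> \<in> flag_complex V R. \<not> (u \<in> \<sigma> \<and> v \<in> \<sigma>)}"
  proof (rule geometric_realization_remove_faces[OF simplicial_complex_flag[OF V] uv(1,2) w(1,2,3)])
    fix \<sigma> assume \<sigma>: "\<sigma> \<in> flag_complex V R" "u \<in> \<sigma>" "v \<in> \<sigma>"
    have "R x w \<and> R w x" if "x \<in> \<sigma>" "x \<noteq> w" for x
    proof -
      have "R u w" "R v w"
        using sympD[OF R] w(4,5) by blast+
      then have "R x w"
        using \<sigma> that dom[of x] unfolding flag_complex_def by (cases "x = v \<or> x = u") auto
      then show ?thesis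
        using sympD[OF R] by blast
    qed
    then show "insert w \<sigma> \<in> flag_complex V R"
      using \<sigma>(1) w(1) unfolding flag_complex_def by auto
  qed
  moreover have "{\<sigma> \<in> flag_complex V R. \<not> (u \<in> \<sigma> \<and> v \<in> \<sigma>)}
      = flag_complex V (\<lambda>x y. R x y \<and> {x, y} \<noteq> {u, v})"
    using uv(3) unfolding flag_complex_def by (auto simp: doubleton_eq_iff)
  ultimately show ?thesis
    by simp
qed

text \<open>The witness \<open>w\<close> is required to work for the smaller relation \<open>R'\<close>, so the edges can be
  removed one after the other in any order.\<close>

lemma flag_space_remove_edges:
  assumes "finite V" and "symp R" and "symp R'"
    and "\<And>x y. x \<in> V \<Longrightarrow> y \<in> V \<Longrightarrow> x \<noteq> y \<Longrightarrow> R' x y \<Longrightarrow> R x y"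
    and "\<And>u v. u \<in> V \<Longrightarrow> v \<in> V \<Longrightarrow> u \<noteq> v \<Longrightarrow> R u v \<Longrightarrow> \<not> R' u v \<Longrightarrow>
      \<exists>w\<in>V. w \<noteq> u \<and> w \<noteq> v \<and> R' w u \<and> R' w v \<and>
        (\<forall>x\<in>V. x \<noteq> w \<longrightarrow> x \<noteq> u \<longrightarrow> x \<noteq> v \<longrightarrow> R x u \<longrightarrow> R x v \<longrightarrow> R' x w)"
  shows "flag_space V R homotopy_equivalent_space flag_space V R'"
  using assms(2,4,5)
proof (induction "card {(x, y). x \<in> V \<and> y \<in> V \<and> x \<noteq> y \<and> R x y \<and> \<not> R' x y}" arbitrary: R rule: less_induct)
  case less
  let ?D = "\<lambda>R. {(x, y). x \<in> V \<and> y \<in> V \<and> x \<noteq> y \<and> R x y \<and> \<not> R' x y}"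
  show ?case
  proof (cases "?D R = {}")
    case True
    then have "flag_complex V R = flag_complex V R'"
      using less.prems(2) by (intro flag_complex_cong) blast
    then show ?thesis
      by (simp add: homotopy_equivalent_space_refl)
  next
    case False
    then obtain u v where uv: "u \<in> V" "v \<in> V" "u \<noteq> v" "R u v" "\<not> R' u v"
      by auto
    then obtain w where w: "w \<in> V" "w \<noteq> u" "w \<noteq> v" "R' w u" "R' w v"
        "\<And>x. x \<in> V \<Longrightarrow> x \<noteq> w \<Longrightarrow> x \<noteq> u \<Longrightarrow> x \<noteq> v \<Longrightarrow> R x u \<Longrightarrow> R x v \<Longrightarrow> R' x w"
      using less.prems(3)[OF uv] by blast
    let ?R = "\<lambda>x y. R x y \<and> {x, y} \<noteq> {u, v}"
    have "flag_space V R homotopy_equivalent_space flag_space V ?R"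
      by (rule flag_space_remove_edge[OF assms(1) less.prems(1) uv(1,2,3) w(1,2,3)])
        (use w less.prems(2) uv in auto)
    moreover have "flag_space V ?R homotopy_equivalent_space flag_space V R'"
    proof (rule less.hyps)
      have "finite (?D R)"
        by (rule finite_subset[of _ "V \<times> V"]) (use assms(1) in auto)
      moreover have "?D ?R \<subset> ?D R"
        using uv by auto
      ultimately show "card (?D ?R) < card (?D R)"
        by (rule psubset_card_mono)
      show "symp ?R"
        using less.prems(1) by (auto simp: symp_def insert_commute)
      show "?R x y" if "x \<in> V" "y \<in> V" "x \<noteq> y" "R' x y" for x y
      proof -
        have "R x y"
          by (rule less.prems(2)[OF that])
        moreover have "\<not> R' v u"
          using sympD[OF assms(3)] uv(5) by blast
        ultimately show ?thesis
          using uv(5) that(4) by (auto simp: doubleton_eq_iff)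
      qed
      show "\<exists>w\<in>V. w \<noteq> a \<and> w \<noteq> b \<and> R' w a \<and> R' w b \<and>
          (\<forall>x\<in>V. x \<noteq> w \<longrightarrow> x \<noteq> a \<longrightarrow> x \<noteq> b \<longrightarrow> ?R x a \<longrightarrow> ?R x b \<longrightarrow> R' x w)"
        if "a \<in> V" "b \<in> V" "a \<noteq> b" "?R a b" "\<not> R' a b" for a b
        using less.prems(3)[of a b] that by blast
    qed
    ultimately show ?thesis
      by (rule homotopy_eqv_trans)
  qed
qed

text \<open>\<open>T\<close> orients the edges to be deleted, so a witness has to be given for one
  order of the end points only.\<close>

lemma flag_space_remove_edges_symmetric:
  assumes "finite V" and "symp R" and R': "symp R'"
    and le: "\<And>x y. x \<in> V \<Longrightarrow> y \<in> V \<Longrightarrow> x \<noteq> y \<Longrightarrow> R' x y \<Longrightarrow> R x y"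
    and T: "\<And>u v. u \<in> V \<Longrightarrow> v \<in> V \<Longrightarrow> u \<noteq> v \<Longrightarrow> R u v \<Longrightarrow> \<not> R' u v \<Longrightarrow> T u v \<or> T v u"
    and wit: "\<And>u v. u \<in> V \<Longrightarrow> v \<in> V \<Longrightarrow> u \<noteq> v \<Longrightarrow> T u v \<Longrightarrow>
      \<exists>w\<in>V. w \<noteq> u \<and> w \<noteq> v \<and> R' w u \<and> R' w v \<and>
        (\<forall>x\<in>V. x \<noteq> w \<longrightarrow> x \<noteq> u \<longrightarrow> x \<noteq> v \<longrightarrow> R x u \<longrightarrow> R x v \<longrightarrow> R' x w)"
  shows "flag_space V R homotopy_equivalent_space flag_space V R'"
proof (rule flag_space_remove_edges[OF assms(1-3) le])
  fix u v assume uv: "u \<in> V" "v \<in> V" "u \<noteq> v" "R u v" "\<not> R' u v"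
  then consider "T u v" | "T v u"
    using T by blast
  then show "\<exists>w\<in>V. w \<noteq> u \<and> w \<noteq> v \<and> R' w u \<and> R' w v \<and>
        (\<forall>x\<in>V. x \<noteq> w \<longrightarrow> x \<noteq> u \<longrightarrow> x \<noteq> v \<longrightarrow> R x u \<longrightarrow> R x v \<longrightarrow> R' x w)"
  proof cases
    case 1
    then show ?thesis
      using wit[OF uv(1-3)] by blast
  next
    case 2
    then show ?thesis
      using wit[OF uv(2,1) uv(3)[symmetric]] by blast
  qed
qed

section \<open>Base points and suspensions of realizations\<close>

text \<open>If all coordinates of \<open>x\<close> on the support of \<open>a\<close> are positive,
  then \<open>a\<close> lies in the closed simplex spanned by the support of \<open>x\<close>, and
  \<open>x\<close> can be moved to \<open>a\<close> along a segment. A cut-off function extends this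
  motion to the whole space.\<close>

lemma ndr_point_geometric_realization:
  fixes K :: "'v set set"
  assumes K: "simplicial_complex V K" and a: "a \<in> topspace (geometric_realization K)"
  shows "ndr_point (geometric_realization K) a"
proof -
  let ?X = "geometric_realization K"
  note fi = in_geometric_realization_iff[OF K]
  define \<sigma> where "\<sigma> = {v. a v \<noteq> 0}"
  have \<sigma>K: "\<sigma> \<in> K" and a0: "0 \<le> a v" and a1: "(\<Sum>v\<in>V. a v) = 1" for v
    using a unfolding fi \<sigma>_def by auto
  have finV: "finite V" and \<sigma>V: "\<sigma> \<subseteq> V"
    using simplicial_complexD(1)[OF K] simplicial_complexD(2)[OF K \<sigma>K] by auto
  then have fin\<sigma>: "finite \<sigma>"
    using finite_subset by blast
  have "\<sigma> \<noteq> {}"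
  proof
    assume "\<sigma> = {}"
    then have "a = (\<lambda>v. 0)"
      by (auto simp: \<sigma>_def)
    then show False
      using a1 by simp
  qed
  define \<epsilon> where "\<epsilon> = Min (a ` \<sigma>)"
  have \<epsilon>: "\<epsilon> \<le> a v" if "v \<in> \<sigma>" for v
    using that fin\<sigma> by (simp add: \<epsilon>_def)
  have "\<epsilon> \<in> a ` \<sigma>"
    using fin\<sigma> \<open>\<sigma> \<noteq> {}\<close> by (simp add: \<epsilon>_def)
  then have "\<epsilon> > 0"
    using a0 by (auto simp: \<sigma>_def order_less_le)
  \<comment> \<open>\<open>d x\<close> is the total amount by which \<open>x\<close> falls short of
    \<open>a\<close>. If it is below the least positive coordinate \<open>\<epsilon>\<close> of
    \<open>a\<close>, no coordinate of \<open>x\<close> vanishes on \<open>\<sigma>\<close>. The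
    cut-off \<open>\<theta>\<close> is \<open>1\<close> for \<open>d x \<le> \<epsilon> / 2\<close>
    and \<open>0\<close> for \<open>d x \<ge> \<epsilon>\<close>, while \<open>\<mu> x < 1\<close>
    means \<open>d x < \<epsilon> / 2\<close>: points with \<open>\<mu> x < 1\<close> arrive at
    \<open>a\<close>, and points that may share no simplex with \<open>a\<close> stay fixed.\<close>
  define d where "d x = (\<Sum>v\<in>V. max 0 (a v - x v))" for x
  define \<theta> where "\<theta> x = min 1 (max 0 (2 - (2 / \<epsilon>) * d x))" for x
  define \<mu> where "\<mu> x = min 1 ((2 / \<epsilon>) * d x)" for x
  define \<rho> where "\<rho> x = (\<lambda>v. (1 - \<theta> x) * x v + \<theta> x * a v)" for x
  have d0: "0 \<le> d x" for x
    unfolding d_def by (intro sum_nonneg) auto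
  have dc: "continuous_map ?X euclideanreal d"
    unfolding d_def using finV by (auto intro!: continuous_intros)
  have \<theta>c: "continuous_map ?X euclideanreal \<theta>" and \<mu>c: "continuous_map ?X euclideanreal \<mu>"
    unfolding \<theta>_def \<mu>_def by (intro continuous_intros dc; simp)+
  have \<theta>01: "\<theta> x \<in> {0..1}" for x
    by (auto simp: \<theta>_def)
  have da: "d a = 0"
    by (simp add: d_def)
  have supp: "{v. x v \<noteq> 0 \<or> \<rho> x v \<noteq> 0} \<in> K" and supp': "\<theta> x \<noteq> 0 \<Longrightarrow> {v. x v \<noteq> 0 \<or> a v \<noteq> 0} \<in> K"
    if x: "x \<in> topspace ?X" for x
  proof -
    have xK: "{v. x v \<noteq> 0} \<in> K"
      using x unfolding fi by blast
    show *: "{v. x v \<noteq> 0 \<or> a v \<noteq> 0} \<in> K" if "\<theta> x \<noteq> 0"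
    proof -
      have "(2 / \<epsilon>) * d x < 2"
        using that by (auto simp: \<theta>_def)
      then have "d x < \<epsilon>"
        using \<open>\<epsilon> > 0\<close> by (simp add: field_simps)
      have "x v \<noteq> 0" if "v \<in> \<sigma>" for v
      proof -
        have "max 0 (a v - x v) \<le> d x"
          unfolding d_def by (rule member_le_sum) (use that \<sigma>V finV in auto)
        then show ?thesis
          using \<open>d x < \<epsilon>\<close> \<epsilon>[OF that] by auto
      qed
      then have "{v. x v \<noteq> 0 \<or> a v \<noteq> 0} = {v. x v \<noteq> 0}"
        by (auto simp: \<sigma>_def)
      then show ?thesis
        using xK by simp
    qed
    show "{v. x v \<noteq> 0 \<or> \<rho> x v \<noteq> 0} \<in> K"
    proof (cases "\<theta> x = 0")
      case True
      then show ?thesis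
        using xK by (simp add: \<rho>_def)
    next
      case False
      have "{v. x v \<noteq> 0 \<or> \<rho> x v \<noteq> 0} \<subseteq> {v. x v \<noteq> 0 \<or> a v \<noteq> 0}"
        by (auto simp: \<rho>_def)
      then show ?thesis
        by (rule simplicial_complexD(3)[OF K *[OF False]])
    qed
  qed
  have \<rho>X: "\<rho> x \<in> topspace ?X" if x: "x \<in> topspace ?X" for x
  proof (cases "\<theta> x = 0")
    case True
    then show ?thesis
      using x by (simp add: \<rho>_def)
  next
    case False
    show ?thesis
      unfolding \<rho>_def by (rule geometric_realization_convex[OF K x a supp'[OF x False] \<theta>01])
  qed
  have \<rho>a: "\<rho> a = a"
    by (simp add: \<rho>_def \<theta>_def da)
  have "homotopic_with (\<lambda>h. h a = a) ?X ?X id \<rho>"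
  proof (rule homotopic_with_geometric_realization_linear[OF K])
    have "continuous_map ?X euclideanreal (\<lambda>x. \<rho> x v)" for v
      unfolding \<rho>_def by (intro continuous_intros \<theta>c) auto
    then show "continuous_map ?X ?X \<rho>"
      unfolding continuous_map_into_geometric_realization using \<rho>X by auto
    show "{v. id x v \<noteq> 0 \<or> \<rho> x v \<noteq> 0} \<in> K" if "x \<in> topspace ?X" for x
      using supp[OF that] by simp
    show "(\<lambda>v. (1 - t) * id a v + t * \<rho> a v) = a" for t
      by (simp add: \<rho>a algebra_simps)
  qed simp
  moreover have "continuous_map ?X (top_of_set {0..1}) \<mu>"
    using \<mu>c d0 \<open>\<epsilon> > 0\<close> by (auto simp: continuous_map_in_subtopology \<mu>_def)
  moreover have "\<mu> a = 0"
    by (simp add: \<mu>_def da)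
  moreover have "\<rho> x = a" if "\<mu> x < 1" for x
  proof -
    have "\<theta> x = 1"
      using that by (auto simp: \<mu>_def \<theta>_def)
    then show ?thesis
      by (simp add: \<rho>_def)
  qed
  ultimately show ?thesis
    unfolding ndr_point_def using a by blast
qed

definition vertex_point :: "'v \<Rightarrow> 'v \<Rightarrow> real" where
  "vertex_point u = (\<lambda>v. if v = u then 1 else 0)"

text \<open>For fixed \<open>x\<close> this is the broken line from the pole \<open>N\<close> at
  time \<open>0\<close> through \<open>x\<close> at time \<open>1/2\<close> to the pole
  \<open>S\<close> at time \<open>1\<close>. The two poles never carry weight simultaneously, as
  they span no edge.\<close>

definition join_map :: "'v \<Rightarrow> 'v \<Rightarrow> ('v \<Rightarrow> real) \<times> real \<Rightarrow> 'v \<Rightarrow> real" where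
  "join_map N S = (\<lambda>(x, t) v. if v = N then max 0 (1 - 2 * t) else if v = S then max 0 (2 * t - 1)
     else (1 - \<bar>2 * t - 1\<bar>) * x v)"

lemma double_cone_map_flag_space:
  fixes V :: "'v set"
  assumes V: "finite V" "V \<noteq> {}" and N: "N \<notin> V" and S: "S \<notin> V" and NS: "N \<noteq> S" "\<not> R N S"
    and R: "symp R" and RN: "\<And>x. x \<in> V \<Longrightarrow> R N x" and RS: "\<And>x. x \<in> V \<Longrightarrow> R S x"
  shows "double_cone_map (flag_space V R) (flag_space (insert N (insert S V)) R)
           (vertex_point N) (vertex_point S) (join_map N S)"
proof -
  let ?W = "insert N (insert S V)"
  let ?X = "flag_space V R" and ?Z = "flag_space ?W R"
  let ?C = "prod_topology ?X (top_of_set {0..1::real})"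
  have K: "simplicial_complex V (flag_complex V R)"
    using V(1) by (rule simplicial_complex_flag)
  have W: "finite ?W"
    using V by simp
  note fi = in_flag_space_iff[OF V(1)] and fiW = in_flag_space_iff[OF W]
  have x0: "x v = 0" if "x \<in> topspace ?X" "v \<notin> V" for x v
    using that unfolding fi by auto
  have sumW: "(\<Sum>v\<in>?W. z v) = z N + z S + (\<Sum>v\<in>V. z v)" for z :: "'v \<Rightarrow> real"
    using V N S NS by simp
  have mem: "join_map N S (x, t) \<in> topspace ?Z" if x: "x \<in> topspace ?X" and t: "t \<in> {0..1}" for x t
    unfolding fiW
  proof (intro conjI allI impI)
    let ?z = "join_map N S (x, t)"
    show "0 \<le> ?z v" for v
      using x t unfolding fi by (auto simp: join_map_def intro!: mult_nonneg_nonneg)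
    have "(\<Sum>v\<in>V. ?z v) = (\<Sum>v\<in>V. (1 - \<bar>2 * t - 1\<bar>) * x v)"
      using N S by (intro sum.cong) (auto simp: join_map_def)
    also have "\<dots> = 1 - \<bar>2 * t - 1\<bar>"
      using x unfolding fi by (simp flip: sum_distrib_left)
    finally show "(\<Sum>v\<in>?W. ?z v) = 1"
      unfolding sumW using NS by (auto simp: join_map_def)
    have xK: "\<And>v. x v \<noteq> 0 \<Longrightarrow> v \<in> V" "\<And>u v. x u \<noteq> 0 \<Longrightarrow> x v \<noteq> 0 \<Longrightarrow> u \<noteq> v \<Longrightarrow> R u v"
      using x unfolding fi by auto
    have supp: "v = N \<and> t < 1/2 \<or> v = S \<and> t > 1/2 \<or> v \<in> V \<and> x v \<noteq> 0" if "?z v \<noteq> 0" for v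
      using that xK(1)[of v] by (auto simp: join_map_def max_def split: if_splits)
    show "R u v" if "?z u \<noteq> 0" "?z v \<noteq> 0" "u \<noteq> v" for u v
      using supp[OF that(1)] supp[OF that(2)] that(3) xK(2)[of u v] RN RS sympD[OF R, of N] sympD[OF R, of S]
      by auto
    show "v \<in> ?W" if "?z v \<noteq> 0" for v
      using supp[OF that] by auto
  qed
  have cont: "continuous_map ?C ?Z (join_map N S)"
    unfolding continuous_map_into_geometric_realization
  proof (intro conjI allI)
    have cx: "continuous_map ?C euclideanreal (\<lambda>z. fst z v)" for v
      using continuous_map_compose[OF continuous_map_fst continuous_map_geometric_realization_coord]
      by (simp add: o_def)
    have ct: "continuous_map ?C euclideanreal snd"
      using continuous_map_snd continuous_map_in_subtopology by blast
    show "continuous_map ?C euclideanreal (\<lambda>z. join_map N S z v)" for v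
      unfolding join_map_def case_prod_unfold
      by (cases "v = N"; cases "v = S") (auto intro!: continuous_intros cx ct)
    show "join_map N S ` topspace ?C \<subseteq> topspace ?Z"
      using mem by auto
  qed
  have surj: "join_map N S ` topspace ?C = topspace ?Z"
  proof
    show "join_map N S ` topspace ?C \<subseteq> topspace ?Z"
      using mem by auto
    show "topspace ?Z \<subseteq> join_map N S ` topspace ?C"
    proof
      fix z assume z: "z \<in> topspace ?Z"
      have z0: "0 \<le> z v" for v
        using z unfolding fiW by blast
      have zR: "R u v" if "z u \<noteq> 0" "z v \<noteq> 0" "u \<noteq> v" for u v
        using z that unfolding fiW by blast
      have zW: "z v = 0" if "v \<notin> ?W" for v
        using z that unfolding fiW by blast
      have z1: "z N + z S + (\<Sum>v\<in>V. z v) = 1"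
        using z sumW[of z] unfolding fiW by simp
      have NS0: "z N = 0 \<or> z S = 0"
        using zR NS by blast
      \<comment> \<open>One of the pole weights vanishes, so their difference determines the height,
        and the weight \<open>m\<close> left for \<open>V\<close> equals
        \<open>1 - \<bar>2 * t - 1\<bar>\<close>. If \<open>m = 0\<close>, the point is a pole and
        any point of \<open>?X\<close> lies below it; one exists because \<open>V\<close> is
        nonempty.\<close>
      define t where "t = (1 - z N + z S) / 2"
      have t2: "2 * t = 1 - z N + z S"
        by (simp add: t_def)
      define m where "m = (\<Sum>v\<in>V. z v)"
      have m0: "0 \<le> m"
        unfolding m_def by (rule sum_nonneg) (rule z0)
      have t: "t \<in> {0..1}" 
        using z0[of N] z0[of S] z1 m0 unfolding t_def m_def by auto
      have tN: "max 0 (1 - 2 * t) = z N" and tS: "max 0 (2 * t - 1) = z S" and tm: "1 - \<bar>2 * t - 1\<bar> = m"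
        using NS0 z0[of N] z0[of S] z1 t2 unfolding m_def by auto
      have "\<exists>x\<in>topspace ?X. \<forall>v\<in>V. m * x v = z v"
      proof (cases "m = 0")
        case True
        then have "z v = 0" if "v \<in> V" for v
          using that z0 V(1) unfolding m_def by (simp add: sum_nonneg_eq_0_iff)
        moreover obtain v where "v \<in> V"
          using V by blast
        then have "vertex_point v \<in> topspace ?X"
          unfolding fi using V by (auto simp: vertex_point_def)
        ultimately show ?thesis
          using True by auto
      next
        case False
        define x where "x v = (if v \<in> V then z v / m else 0)" for v
        have "x \<in> topspace ?X"
          unfolding fi
        proof (intro conjI allI impI)
          show "0 \<le> x v" for v
            using z0[of v] m0 by (simp add: x_def)
          show "v \<in> V" if "x v \<noteq> 0" for v
            using that by (simp add: x_def split: if_splits)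
          show "R u v" if "x u \<noteq> 0" "x v \<noteq> 0" "u \<noteq> v" for u v
            using zR[of u v] that by (simp add: x_def split: if_splits)
          show "(\<Sum>v\<in>V. x v) = 1"
            using False by (simp add: x_def m_def flip: sum_divide_distrib)
        qed
        then show ?thesis
          using False by (intro bexI[of _ x]) (auto simp: x_def)
      qed
      then obtain x where x: "x \<in> topspace ?X" "\<And>v. v \<in> V \<Longrightarrow> m * x v = z v"
        by blast
      have "z = join_map N S (x, t)"
      proof
        fix v show "z v = join_map N S (x, t) v"
          using x x0[OF x(1)] zW by (cases "v \<in> V") (auto simp: join_map_def tN tS tm NS)
      qed
      then show "z \<in> join_map N S ` topspace ?C"
        using x t by auto
    qed
  qed
  have "quotient_map ?C ?Z (join_map N S)"
  proof (rule T1_Spaces.continuous_imp_quotient_map[OF cont _ Hausdorff_geometric_realization surj])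
    show "compact_space ?C"
      using compact_geometric_realization[OF K] by (simp add: compact_space_prod_topology compact_space_subtopology)
  qed
  moreover have "join_map N S (x, 0) = vertex_point N \<and> join_map N S (x, 1) = vertex_point S" for x
    using NS by (auto simp: join_map_def vertex_point_def)
  moreover have "t = t' \<and> (t = 0 \<or> t = 1 \<or> x = x')"
    if x: "x \<in> topspace ?X" "x' \<in> topspace ?X" and t: "t \<in> {0..1}" "t' \<in> {0..1}"
      and eq: "join_map N S (x, t) = join_map N S (x', t')" for x x' t t'
  proof -
    have eq': "join_map N S (x, t) v = join_map N S (x', t') v" for v
      using eq by simp
    have tt: "t = t'"
      using eq'[of N] eq'[of S] NS by (auto simp: join_map_def max_def split: if_splits)
    have "x = x'" if "t \<noteq> 0" "t \<noteq> 1"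
    proof
      fix v
      have "1 - \<bar>2 * t - 1\<bar> \<noteq> 0"
        using that t by auto
      moreover have "v \<noteq> N \<and> v \<noteq> S" if "v \<in> V"
        using that N S by blast
      ultimately show "x v = x' v"
        using eq'[of v] x0[OF x(1), of v] x0[OF x(2), of v] tt by (cases "v \<in> V") (simp_all add: join_map_def)
    qed
    then show ?thesis
      using tt by blast
  qed
  ultimately show ?thesis
    unfolding double_cone_map_def by blast
qed

text \<open>The base point \<open>c\<close> may lie inside a simplex, but the result is based at a
  vertex. Thus only the first suspension meets an arbitrary base point, and the wedge can be formed
  at vertices. The change of base point is absorbed by the comparison of the reduced with the
  unreduced suspension.\<close>

lemma pointed_heq_suspension_flag_space:
  assumes heq: "pointed_heq X b (flag_space V R) c" and q: "suspension_map X b Y y q"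
    and V: "finite V" and N: "N \<notin> V" "S \<notin> V" "N \<noteq> S" "\<not> R N S"
    and R: "symp R" "\<And>x. x \<in> V \<Longrightarrow> R N x" "\<And>x. x \<in> V \<Longrightarrow> R S x"
  shows "pointed_heq Y y (flag_space (insert N (insert S V)) R) (vertex_point N)"
proof -
  have c: "c \<in> topspace (flag_space V R)"
    using heq unfolding pointed_heq_def by blast
  have "V \<noteq> {}"
    using c unfolding in_flag_space_iff[OF V] by auto
  then have p: "double_cone_map (flag_space V R) (flag_space (insert N (insert S V)) R)
      (vertex_point N) (vertex_point S) (join_map N S)"
    by (rule double_cone_map_flag_space[OF V _ N R])
  obtain Y' :: "(('b \<Rightarrow> real) \<times> real) option topology" and y' q'
    where q': "suspension_map (flag_space V R) c Y' y' q'"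
    using suspension_map_exists[OF c] by blast
  show ?thesis
    by (rule pointed_heq_trans[OF pointed_heq_suspension[OF q q' heq]])
      (rule pointed_heq_suspension_double_cone[OF p
        ndr_point_geometric_realization[OF simplicial_complex_flag[OF V] c] q'])
qed

section \<open>Wedge sums\<close>

lemma continuous_map_from_sum_topology:
  assumes "\<And>j. j \<in> J \<Longrightarrow> continuous_map (X j) Y (\<lambda>x. f (j, x))"
  shows "continuous_map (sum_topology X J) Y f"
proof -
  have "{x. (j, x) \<in> {z \<in> Sigma J (topspace \<circ> X). f z \<in> U}} = {x \<in> topspace (X j). f (j, x) \<in> U}"
    if "j \<in> J" for j U
    using that by auto
  then show ?thesis
    using assms by (fastforce simp: continuous_map_def openin_sum_topology Pi_iff)
qed

lemma compact_space_sum_topology: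
  assumes "finite J" and "\<And>j. j \<in> J \<Longrightarrow> compact_space (X j)"
  shows "compact_space (sum_topology X J)"
proof -
  have "compactin (sum_topology X J) (\<Union>j\<in>J. Pair j ` topspace (X j))"
  proof (rule compactin_Union)
    fix S assume "S \<in> (\<lambda>j. Pair j ` topspace (X j)) ` J"
    then obtain j where j: "j \<in> J" "S = Pair j ` topspace (X j)"
      by blast
    show "compactin (sum_topology X J) S"
      unfolding j(2)
      by (rule image_compactin[OF _ continuous_map_component_injection[OF j(1)]])
        (use assms(2)[OF j(1)] in \<open>simp add: compact_space_def\<close>)
  qed (use assms(1) in simp)
  moreover have "(\<Union>j\<in>J. Pair j ` topspace (X j)) = topspace (sum_topology X J)"
    by auto
  ultimately show ?thesis
    by (simp add: compact_space_def)
qed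

lemma homeomorphic_space_quotient_maps:
  assumes f: "quotient_map X Y f" and g: "quotient_map X Z g"
    and eq: "\<And>x x'. x \<in> topspace X \<Longrightarrow> x' \<in> topspace X \<Longrightarrow> f x = f x' \<longleftrightarrow> g x = g x'"
  shows "Y homeomorphic_space Z"
proof -
  have "\<exists>h. continuous_map Y Z h \<and> (\<forall>x\<in>topspace X. h (f x) = g x)"
    by (rule quotient_map_lift[OF f quotient_imp_continuous_map[OF g]]) (simp add: eq)
  then obtain h where h: "continuous_map Y Z h" "\<And>x. x \<in> topspace X \<Longrightarrow> h (f x) = g x"
    by blast
  have "\<exists>k. continuous_map Z Y k \<and> (\<forall>x\<in>topspace X. k (g x) = f x)"
    by (rule quotient_map_lift[OF g quotient_imp_continuous_map[OF f]]) (simp add: eq)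
  then obtain k where k: "continuous_map Z Y k" "\<And>x. x \<in> topspace X \<Longrightarrow> k (g x) = f x"
    by blast
  have "homeomorphic_maps Y Z h k"
    unfolding homeomorphic_maps_def
  proof (intro conjI ballI)
    fix y assume "y \<in> topspace Y"
    then obtain x where "x \<in> topspace X" "y = f x"
      using quotient_imp_surjective_map[OF f] by auto
    then show "k (h y) = y"
      using h k by simp
  next
    fix z assume "z \<in> topspace Z"
    then obtain x where "x \<in> topspace X" "z = g x"
      using quotient_imp_surjective_map[OF g] by auto
    then show "h (k z) = z"
      using h k by simp
  qed (fact h k)+
  then show ?thesis
    unfolding homeomorphic_space_def by blast
qed

lemma homotopic_with_sum_topology:
  assumes hom: "\<And>j. j \<in> J \<Longrightarrow> homotopic_with (P j) (X j) (X j) (f j) id"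
    and ne: "\<And>j. j \<in> J \<Longrightarrow> b j \<in> topspace (X j)"
    and q: "continuous_map (sum_topology X J) Y q"
    and P: "\<And>h. (\<And>j. j \<in> J \<Longrightarrow> \<exists>i. P j i \<and> (\<forall>x. h (j, x) = q (j, i x))) \<Longrightarrow> Q h"
    and resp: "\<And>h k. (\<And>z. z \<in> topspace (sum_topology X J) \<Longrightarrow> h z = k z) \<Longrightarrow> Q h = Q k"
  shows "homotopic_with Q (sum_topology X J) Y (\<lambda>(j, x). q (j, f j x)) q"
proof -
  let ?I = "top_of_set {0..1::real}" and ?S = "sum_topology X J"
  have "\<exists>K. continuous_map (prod_topology ?I (X j)) (X j) K \<and> (\<forall>x. K (0, x) = f j x) \<and>
      (\<forall>x. K (1, x) = x) \<and> (\<forall>t\<in>{0..1}. P j (\<lambda>x. K (t, x)))" if "j \<in> J" for j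
    using hom[OF that] unfolding homotopic_with_def by simp
  then have "\<exists>K. \<forall>j\<in>J. continuous_map (prod_topology ?I (X j)) (X j) (K j) \<and> (\<forall>x. K j (0, x) = f j x) \<and>
      (\<forall>x. K j (1, x) = x) \<and> (\<forall>t\<in>{0..1}. P j (\<lambda>x. K j (t, x)))"
    by (intro bchoice ballI)
  then obtain K where K: "\<And>j. j \<in> J \<Longrightarrow> continuous_map (prod_topology ?I (X j)) (X j) (K j)"
      "\<And>j x. j \<in> J \<Longrightarrow> K j (0, x) = f j x" "\<And>j x. j \<in> J \<Longrightarrow> K j (1, x) = x"
      "\<And>j t. j \<in> J \<Longrightarrow> t \<in> {0..1} \<Longrightarrow> P j (\<lambda>x. K j (t, x))"
    by blast
  define H where "H = (\<lambda>(t, j, x). q (j, K j (t, x)))"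
  have "continuous_map (prod_topology ?I ?S) Y H"
  proof (rule pasting_lemma)
    fix j assume j: "j \<in> J"
    \<comment> \<open>\<open>r\<close> retracts the sum onto the summand \<open>j\<close>, sending
      every other summand to \<open>b j\<close>. On the open piece over \<open>j\<close> the
      homotopy is then the restriction of a map that is continuous on the whole product.\<close>
    define r where "r = (\<lambda>(i, x). if i = j then x else b j)"
    have r: "continuous_map ?S (X j) r"
    proof (rule continuous_map_from_sum_topology)
      fix i assume "i \<in> J"
      show "continuous_map (X i) (X j) (\<lambda>x. r (i, x))"
        using ne[OF j] by (cases "i = j") (auto simp: r_def)
    qed
    show "openin (prod_topology ?I ?S) ({0..1} \<times> Pair j ` topspace (X j))"
    proof -
      have "openin ?S (Pair j ` topspace (X j))"
        using open_map_component_injection[OF j, of X] unfolding open_map_def by blast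
      moreover have "openin ?I {0..1}"
        by simp
      ultimately show ?thesis
        unfolding openin_prod_Times_iff by blast
    qed
    have "continuous_map (prod_topology ?I ?S) Y (\<lambda>z. q (j, K j (fst z, r (snd z))))"
    proof -
      have "continuous_map (prod_topology ?I ?S) (prod_topology ?I (X j)) (\<lambda>z. (fst z, r (snd z)))"
        using continuous_map_compose[OF continuous_map_snd r]
        by (intro continuous_map_pairedI continuous_map_fst) (simp add: o_def)
      moreover have "continuous_map (X j) Y (\<lambda>x. q (j, x))"
        using continuous_map_compose[OF continuous_map_component_injection[OF j, of X] q] by (simp add: o_def)
      ultimately show ?thesis
        using continuous_map_compose[OF continuous_map_compose[OF _ K(1)[OF j]]] by (auto simp: o_def)
    qed
    then show "continuous_map (subtopology (prod_topology ?I ?S) ({0..1} \<times> Pair j ` topspace (X j))) Y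
        (\<lambda>z. q (j, K j (fst z, r (snd z))))"
      by (rule continuous_map_from_subtopology)
  qed (auto simp: H_def)
  then show ?thesis
  proof (intro homotopic_with[where P = Q, THEN iffD2, OF resp] exI[of _ H] conjI ballI)
    show "Q (\<lambda>x. H (t, x))" if "t \<in> {0..1}" for t
    proof (rule P)
      fix j assume "j \<in> J"
      then show "\<exists>i. P j i \<and> (\<forall>x. H (t, j, x) = q (j, i x))"
        using K(4)[OF _ that] by (intro exI[of _ "\<lambda>x. K j (t, x)"]) (simp add: H_def)
    qed
  qed (auto simp: H_def K)
qed

section \<open>Wedges of pointed equivalences and wedges of flag complexes\<close>

definition wedge_proj :: "('i \<Rightarrow> 'a topology \<times> 'a) \<Rightarrow> 'i \<times> 'a \<Rightarrow> ('i \<times> 'a) option" where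
  "wedge_proj F = (\<lambda>(j, x). if x = snd (F j) then None else Some (j, x))"

lemma wedge_proj_eq_iff:
  "wedge_proj F (i, x) = wedge_proj F (j, y) \<longleftrightarrow> i = j \<and> x = y \<or> x = snd (F i) \<and> y = snd (F j)"
  by (auto simp: wedge_proj_def)

lemma quotient_map_wedge_proj:
  "quotient_map (sum_topology (\<lambda>j. fst (F j)) J) (wedge_sum J F) (wedge_proj F)"
  by (simp add: wedge_sum_def wedge_proj_def quotient_map_quotient_topology)

lemma wedge_sum_functorial:
  assumes f: "\<And>j. j \<in> J \<Longrightarrow> continuous_map (fst (F j)) (fst (F' j)) (f j)"
    and fb: "\<And>j. j \<in> J \<Longrightarrow> f j (snd (F j)) = snd (F' j)"
  shows "\<exists>\<Phi>. continuous_map (wedge_sum J F) (wedge_sum J F') \<Phi> \<and>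
    (\<forall>j\<in>J. \<forall>x\<in>topspace (fst (F j)). \<Phi> (wedge_proj F (j, x)) = wedge_proj F' (j, f j x))"
proof -
  let ?S = "sum_topology (\<lambda>j. fst (F j)) J"
  have "continuous_map ?S (wedge_sum J F') (\<lambda>z. wedge_proj F' (fst z, f (fst z) (snd z)))"
  proof (rule continuous_map_from_sum_topology)
    fix j assume j: "j \<in> J"
    from continuous_map_compose[OF continuous_map_compose[OF f[OF j]
          continuous_map_component_injection[where X = "\<lambda>j. fst (F' j)", OF j]]
        quotient_imp_continuous_map[OF quotient_map_wedge_proj]]
    show "continuous_map (fst (F j)) (wedge_sum J F') (\<lambda>x. wedge_proj F' (fst (j, x), f (fst (j, x)) (snd (j, x))))"
      by (simp add: o_def)
  qed
  then have "\<exists>\<Phi>. continuous_map (wedge_sum J F) (wedge_sum J F') \<Phi> \<and>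
      (\<forall>z\<in>topspace ?S. \<Phi> (wedge_proj F z) = wedge_proj F' (fst z, f (fst z) (snd z)))"
    by (rule quotient_map_lift[OF quotient_map_wedge_proj]) (auto simp: wedge_proj_eq_iff fb)
  then show ?thesis
    by auto
qed

lemma wedge_sum_homotopy_inverse:
  fixes F :: "'i \<Rightarrow> 'x topology \<times> 'x" and F' :: "'i \<Rightarrow> 'y topology \<times> 'y"
  assumes J: "J \<noteq> {}"
    and \<Phi>: "\<And>j x. j \<in> J \<Longrightarrow> x \<in> topspace (fst (F j)) \<Longrightarrow> \<Phi> (wedge_proj F (j, x)) = wedge_proj F' (j, f j x)"
    and \<Psi>: "\<And>j x. j \<in> J \<Longrightarrow> x \<in> topspace (fst (F' j)) \<Longrightarrow> \<Psi> (wedge_proj F' (j, x)) = wedge_proj F (j, g j x)"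
    and f: "\<And>j. j \<in> J \<Longrightarrow> continuous_map (fst (F j)) (fst (F' j)) (f j)"
    and b: "\<And>j. j \<in> J \<Longrightarrow> snd (F j) \<in> topspace (fst (F j))"
    and gf: "\<And>j. j \<in> J \<Longrightarrow> homotopic_with (\<lambda>h. h (snd (F j)) = snd (F j)) (fst (F j)) (fst (F j)) (g j \<circ> f j) id"
  shows "homotopic_with (\<lambda>h. True) (wedge_sum J F) (wedge_sum J F) (\<Psi> \<circ> \<Phi>) id"
proof -
  let ?S = "sum_topology (\<lambda>j. fst (F j)) J"
  let ?P = "\<lambda>h. (\<forall>j\<in>J. h (j, snd (F j)) = None) \<and>
    (\<forall>z\<in>topspace ?S. \<forall>z'\<in>topspace ?S. wedge_proj F z = wedge_proj F z' \<longrightarrow> h z = h z')"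
  obtain j0 where j0: "j0 \<in> J"
    using J by blast
  have "homotopic_with ?P ?S (wedge_sum J F) (\<lambda>(j, x). wedge_proj F (j, (g j \<circ> f j) x)) (wedge_proj F)"
  proof (rule homotopic_with_sum_topology[OF gf b quotient_imp_continuous_map[OF quotient_map_wedge_proj]])
    fix h :: "'i \<times> 'x \<Rightarrow> ('i \<times> 'x) option"
    assume h: "\<And>j. j \<in> J \<Longrightarrow> \<exists>i. i (snd (F j)) = snd (F j) \<and> (\<forall>x. h (j, x) = wedge_proj F (j, i x))"
    have 1: "h (j, snd (F j)) = None" if "j \<in> J" for j
      using h[OF that] by (auto simp: wedge_proj_def)
    moreover have "h z = h z'" if z: "z \<in> topspace ?S" "z' \<in> topspace ?S" "wedge_proj F z = wedge_proj F z'" for z z'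
    proof -
      obtain i x j y where ij: "z = (i, x)" "z' = (j, y)"
        by (cases z, cases z')
      then have "i = j \<and> x = y \<or> x = snd (F i) \<and> y = snd (F j)" "i \<in> J" "j \<in> J"
        using z wedge_proj_eq_iff[of F i x j y] by auto
      then show ?thesis
        using 1[of i] 1[of j] ij by auto
    qed
    ultimately show "?P h"
      by blast
  next
    fix h k :: "'i \<times> 'x \<Rightarrow> ('i \<times> 'x) option"
    assume hk: "\<And>z. z \<in> topspace ?S \<Longrightarrow> h z = k z"
    have "h (j, snd (F j)) = k (j, snd (F j))" if "j \<in> J" for j
      using hk[of "(j, snd (F j))"] b[OF that] that by simp
    then show "?P h = ?P k"
      using hk by auto
  qed
  \<comment> \<open>Some summand \<open>j0\<close> has to supply a preimage of the wedge point for
    \<open>homotopic_with_quotient\<close>; this is where \<open>J\<close> must be nonempty.\<close>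
  then have "homotopic_with (\<lambda>k. k (wedge_proj F (j0, snd (F j0))) = None) (wedge_sum J F) (wedge_sum J F) (\<Psi> \<circ> \<Phi>) id"
  proof (rule homotopic_with_quotient[OF quotient_map_wedge_proj])
    fix h :: "'i \<times> 'x \<Rightarrow> ('i \<times> 'x) option" and z z'
    assume "?P h" and "z \<in> topspace ?S" "z' \<in> topspace ?S" "wedge_proj F z = wedge_proj F z'"
    then show "h z = h z'"
      by blast
  next
    fix z assume z: "z \<in> topspace ?S"
    obtain j x where jx: "z = (j, x)"
      by (cases z)
    then have mem: "j \<in> J" "x \<in> topspace (fst (F j))"
      using z by auto
    then have "f j x \<in> topspace (fst (F' j))"
      using continuous_map_funspace[OF f[OF mem(1)]] by (auto simp: Pi_iff)
    then show "(\<Psi> \<circ> \<Phi>) (wedge_proj F z) = (case z of (j, x) \<Rightarrow> wedge_proj F (j, (g j \<circ> f j) x))"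
      using \<Phi>[OF mem] \<Psi>[OF mem(1)] jx by simp
  next
    show "(j0, snd (F j0)) \<in> topspace ?S"
      using j0 b by simp
  next
    fix h :: "'i \<times> 'x \<Rightarrow> ('i \<times> 'x) option"
    assume "?P h"
    then show "h (j0, snd (F j0)) = None"
      using j0 by blast
  qed simp
  then show ?thesis
    by (rule homotopic_with_mono) simp
qed

lemma homotopy_equivalent_wedge_sum:
  assumes heq: "\<And>j. j \<in> J \<Longrightarrow> pointed_heq (fst (F j)) (snd (F j)) (fst (F' j)) (snd (F' j))"
    and J: "J \<noteq> {}"
  shows "wedge_sum J F homotopy_equivalent_space wedge_sum J F'"
proof -
  have "\<exists>f g. continuous_map (fst (F j)) (fst (F' j)) f \<and> continuous_map (fst (F' j)) (fst (F j)) g \<and>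
      f (snd (F j)) = snd (F' j) \<and> g (snd (F' j)) = snd (F j) \<and>
      homotopic_with (\<lambda>h. h (snd (F j)) = snd (F j)) (fst (F j)) (fst (F j)) (g \<circ> f) id \<and>
      homotopic_with (\<lambda>h. h (snd (F' j)) = snd (F' j)) (fst (F' j)) (fst (F' j)) (f \<circ> g) id"
    if "j \<in> J" for j
    using heq[OF that] unfolding pointed_heq_def by blast
  then have "\<exists>f. \<forall>j\<in>J. \<exists>g. continuous_map (fst (F j)) (fst (F' j)) (f j) \<and> continuous_map (fst (F' j)) (fst (F j)) g \<and>
      f j (snd (F j)) = snd (F' j) \<and> g (snd (F' j)) = snd (F j) \<and>
      homotopic_with (\<lambda>h. h (snd (F j)) = snd (F j)) (fst (F j)) (fst (F j)) (g \<circ> f j) id \<and>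
      homotopic_with (\<lambda>h. h (snd (F' j)) = snd (F' j)) (fst (F' j)) (fst (F' j)) (f j \<circ> g) id"
    by (intro bchoice ballI)
  then obtain f where "\<forall>j\<in>J. \<exists>g. continuous_map (fst (F j)) (fst (F' j)) (f j) \<and> continuous_map (fst (F' j)) (fst (F j)) g \<and>
      f j (snd (F j)) = snd (F' j) \<and> g (snd (F' j)) = snd (F j) \<and>
      homotopic_with (\<lambda>h. h (snd (F j)) = snd (F j)) (fst (F j)) (fst (F j)) (g \<circ> f j) id \<and>
      homotopic_with (\<lambda>h. h (snd (F' j)) = snd (F' j)) (fst (F' j)) (fst (F' j)) (f j \<circ> g) id"
    by (elim exE)
  then have "\<exists>g. \<forall>j\<in>J. continuous_map (fst (F j)) (fst (F' j)) (f j) \<and> continuous_map (fst (F' j)) (fst (F j)) (g j) \<and>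
      f j (snd (F j)) = snd (F' j) \<and> g j (snd (F' j)) = snd (F j) \<and>
      homotopic_with (\<lambda>h. h (snd (F j)) = snd (F j)) (fst (F j)) (fst (F j)) (g j \<circ> f j) id \<and>
      homotopic_with (\<lambda>h. h (snd (F' j)) = snd (F' j)) (fst (F' j)) (fst (F' j)) (f j \<circ> g j) id"
    by (rule bchoice)
  then obtain g where fg: "\<And>j. j \<in> J \<Longrightarrow> continuous_map (fst (F j)) (fst (F' j)) (f j)"
      "\<And>j. j \<in> J \<Longrightarrow> continuous_map (fst (F' j)) (fst (F j)) (g j)"
      "\<And>j. j \<in> J \<Longrightarrow> f j (snd (F j)) = snd (F' j)" "\<And>j. j \<in> J \<Longrightarrow> g j (snd (F' j)) = snd (F j)"
      "\<And>j. j \<in> J \<Longrightarrow> homotopic_with (\<lambda>h. h (snd (F j)) = snd (F j)) (fst (F j)) (fst (F j)) (g j \<circ> f j) id"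
      "\<And>j. j \<in> J \<Longrightarrow> homotopic_with (\<lambda>h. h (snd (F' j)) = snd (F' j)) (fst (F' j)) (fst (F' j)) (f j \<circ> g j) id"
    by (elim exE) blast
  have b: "snd (F j) \<in> topspace (fst (F j))" "snd (F' j) \<in> topspace (fst (F' j))" if "j \<in> J" for j
    using heq[OF that] unfolding pointed_heq_def by blast+
  obtain \<Phi> where \<Phi>: "continuous_map (wedge_sum J F) (wedge_sum J F') \<Phi>"
      "\<And>j x. j \<in> J \<Longrightarrow> x \<in> topspace (fst (F j)) \<Longrightarrow> \<Phi> (wedge_proj F (j, x)) = wedge_proj F' (j, f j x)"
    using wedge_sum_functorial[where F = F and F' = F' and J = J and f = f, OF fg(1,3)] by auto
  obtain \<Psi> where \<Psi>: "continuous_map (wedge_sum J F') (wedge_sum J F) \<Psi>"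
      "\<And>j x. j \<in> J \<Longrightarrow> x \<in> topspace (fst (F' j)) \<Longrightarrow> \<Psi> (wedge_proj F' (j, x)) = wedge_proj F (j, g j x)"
    using wedge_sum_functorial[where F = F' and F' = F and J = J and f = g, OF fg(2,4)] by auto
  have "homotopic_with (\<lambda>h. True) (wedge_sum J F) (wedge_sum J F) (\<Psi> \<circ> \<Phi>) id"
    by (rule wedge_sum_homotopy_inverse[where F = F and F' = F' and f = f and g = g, OF J]; fact \<Phi> \<Psi> fg b)
  moreover have "homotopic_with (\<lambda>h. True) (wedge_sum J F') (wedge_sum J F') (\<Phi> \<circ> \<Psi>) id"
    by (rule wedge_sum_homotopy_inverse[where F = F' and F' = F and f = g and g = f, OF J]; fact \<Phi> \<Psi> fg b)
  ultimately show ?thesis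
    unfolding homotopy_equivalent_space_def using \<Phi>(1) \<Psi>(1) by blast
qed

text \<open>The flag complex on \<open>W\<close> is the union of copies of the flag complexes on the sets \<open>V j\<close>,
  embedded by \<open>g j\<close> and meeting only in the vertex \<open>b\<close>.\<close>

lemma wedge_sum_flag_space:
  fixes V :: "'i \<Rightarrow> 'v set" and W :: "'w set"
  assumes J: "finite J" "J \<noteq> {}" and V: "\<And>j. j \<in> J \<Longrightarrow> finite (V j)"
    and inj: "\<And>j. j \<in> J \<Longrightarrow> inj_on (g j) (V j)"
    and W: "W = (\<Union>j\<in>J. g j ` V j)"
    and base: "\<And>j. j \<in> J \<Longrightarrow> v j \<in> V j" "\<And>j. j \<in> J \<Longrightarrow> g j (v j) = b"
    and disj: "\<And>i j x y. i \<in> J \<Longrightarrow> j \<in> J \<Longrightarrow> i \<noteq> j \<Longrightarrow> x \<in> V i \<Longrightarrow> y \<in> V j \<Longrightarrow> g i x = g j y \<Longrightarrow> g i x = b"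
    and same: "\<And>j x y. j \<in> J \<Longrightarrow> x \<in> V j \<Longrightarrow> y \<in> V j \<Longrightarrow> x \<noteq> y \<Longrightarrow> Q (g j x) (g j y) \<longleftrightarrow> R j x y"
    and diff: "\<And>i j x y. i \<in> J \<Longrightarrow> j \<in> J \<Longrightarrow> i \<noteq> j \<Longrightarrow> x \<in> V i \<Longrightarrow> y \<in> V j \<Longrightarrow> g i x \<noteq> b \<Longrightarrow> g j y \<noteq> b \<Longrightarrow> \<not> Q (g i x) (g j y)"
  shows "flag_space W Q homeomorphic_space
    wedge_sum J (\<lambda>j. (flag_space (V j) (R j), vertex_point (v j)))"
proof -
  let ?F = "\<lambda>j. (flag_space (V j) (R j), vertex_point (v j))"
  let ?S = "sum_topology (\<lambda>j. fst (?F j)) J"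
  have finW: "finite W"
    using J V W by simp
  note fiW = in_flag_space_iff[OF finW]
  define h where "h j = inv_into (V j) (g j)" for j
  have h: "h j (g j x) = x" if "j \<in> J" "x \<in> V j" for j x
    using that inj by (simp add: h_def)
  define \<Phi> where "\<Phi> = (\<lambda>(j, x) w. if w \<in> g j ` V j then x (h j w) else (0::real))"
  have \<Phi>g: "\<Phi> (j, x) (g j u) = x u" if "j \<in> J" "u \<in> V j" for j x u
    using that h by (simp add: \<Phi>_def)
  have \<Phi>0: "\<exists>u\<in>V j. w = g j u" if "\<Phi> (j, x) w \<noteq> 0" for j x w
    using that by (auto simp: \<Phi>_def split: if_splits)
  have gW: "g j u \<in> W" if "j \<in> J" "u \<in> V j" for j u
    using that W by blast
  have sum\<Phi>: "(\<Sum>w\<in>W. \<Phi> (j, x) w) = (\<Sum>u\<in>V j. x u)" if j: "j \<in> J" for j x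
  proof -
    have "(\<Sum>w\<in>W. \<Phi> (j, x) w) = (\<Sum>w\<in>g j ` V j. \<Phi> (j, x) w)"
      by (rule sum.mono_neutral_right) (use finW gW[OF j] in \<open>auto simp: \<Phi>_def\<close>)
    also have "\<dots> = (\<Sum>u\<in>V j. x u)"
      by (simp add: sum.reindex[OF inj[OF j]] \<Phi>g[OF j])
    finally show ?thesis .
  qed
  have mem: "\<Phi> (j, x) \<in> topspace (flag_space W Q)" if j: "j \<in> J" and x: "x \<in> topspace (flag_space (V j) (R j))" for j x
    unfolding fiW
  proof (intro conjI allI impI)
    note x' = x[unfolded in_flag_space_iff[OF V[OF j]]]
    show "0 \<le> \<Phi> (j, x) w" for w
      using x' by (auto simp: \<Phi>_def)
    show "w \<in> W" if "\<Phi> (j, x) w \<noteq> 0" for w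
      using \<Phi>0[OF that] gW[OF j] by blast
    show "Q w w'" if w: "\<Phi> (j, x) w \<noteq> 0" "\<Phi> (j, x) w' \<noteq> 0" "w \<noteq> w'" for w w'
    proof -
      obtain u u' where u: "u \<in> V j" "w = g j u" "u' \<in> V j" "w' = g j u'"
        using \<Phi>0[OF w(1)] \<Phi>0[OF w(2)] by blast
      then have "x u \<noteq> 0" "x u' \<noteq> 0" "u \<noteq> u'"
        using w \<Phi>g[OF j] by auto
      then show ?thesis
        using x' same[OF j u(1,3)] u by auto
    qed
    show "(\<Sum>w\<in>W. \<Phi> (j, x) w) = 1"
      using x' sum\<Phi>[OF j] by simp
  qed
  have "continuous_map ?S (flag_space W Q) \<Phi>"
  proof (rule continuous_map_from_sum_topology)
    fix j assume j: "j \<in> J"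
    have "continuous_map (flag_space (V j) (R j)) euclideanreal (\<lambda>x. \<Phi> (j, x) w)" for w
      by (cases "w \<in> g j ` V j") (simp_all add: \<Phi>_def continuous_map_geometric_realization_coord)
    then show "continuous_map (fst (?F j)) (flag_space W Q) (\<lambda>x. \<Phi> (j, x))"
      unfolding continuous_map_into_geometric_realization using mem[OF j] by auto
  qed
  moreover have "\<Phi> ` topspace ?S = topspace (flag_space W Q)"
  proof
    show "\<Phi> ` topspace ?S \<subseteq> topspace (flag_space W Q)"
      using mem by auto
    show "topspace (flag_space W Q) \<subseteq> \<Phi> ` topspace ?S"
    proof
      fix z assume z: "z \<in> topspace (flag_space W Q)"
      note z' = z[unfolded fiW]
      \<comment> \<open>Vertices of different pieces span no edge unless one of them is
        \<open>b\<close>. Hence a vertex other than \<open>b\<close> in the support of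
        \<open>z\<close> determines the piece, and a point supported on \<open>b\<close> lies in
        every piece.\<close>
      have "\<exists>j\<in>J. \<forall>w. z w \<noteq> 0 \<longrightarrow> w \<in> g j ` V j"
      proof (cases "\<forall>w. z w \<noteq> 0 \<longrightarrow> w = b")
        case True
        obtain j where j: "j \<in> J"
          using J by blast
        have "b \<in> g j ` V j"
          using base[OF j] by auto
        then show ?thesis
          using True j by auto
      next
        case False
        then obtain w where w: "z w \<noteq> 0" "w \<noteq> b"
          by blast
        then obtain j u where j: "j \<in> J" "u \<in> V j" "w = g j u"
          using z' W by blast
        have "w' \<in> g j ` V j" if w': "z w' \<noteq> 0" for w'
        proof (rule ccontr)
          assume n: "w' \<notin> g j ` V j"
          then have "w' \<noteq> w" "w' \<noteq> b"
            using j base[OF j(1)] by auto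
          obtain i u' where i: "i \<in> J" "u' \<in> V i" "w' = g i u'"
            using z' W w' by blast
          have "i \<noteq> j"
            using i n by auto
          have "Q w' w"
            using z' w w' \<open>w' \<noteq> w\<close> by blast
          then show False
            using diff[OF i(1) j(1) \<open>i \<noteq> j\<close> i(2) j(2)] w(2) \<open>w' \<noteq> b\<close> i j by simp
        qed
        then show ?thesis
          using j by blast
      qed
      then obtain j where j: "j \<in> J" and zj: "\<And>w. z w \<noteq> 0 \<Longrightarrow> w \<in> g j ` V j"
        by blast
      define x where "x u = (if u \<in> V j then z (g j u) else 0)" for u
      have \<Phi>x: "\<Phi> (j, x) = z"
      proof
        fix w show "\<Phi> (j, x) w = z w"
          using zj[of w] h[OF j] by (cases "w \<in> g j ` V j") (auto simp: \<Phi>_def x_def)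
      qed
      have "x \<in> topspace (flag_space (V j) (R j))"
        unfolding in_flag_space_iff[OF V[OF j]]
      proof (intro conjI allI impI)
        show "0 \<le> x u" for u
          using z' by (simp add: x_def)
        show "u \<in> V j" if "x u \<noteq> 0" for u
          using that by (simp add: x_def split: if_splits)
        show "R j u u'" if u: "x u \<noteq> 0" "x u' \<noteq> 0" "u \<noteq> u'" for u u'
        proof -
          have uV: "u \<in> V j" "u' \<in> V j" "z (g j u) \<noteq> 0" "z (g j u') \<noteq> 0"
            using u by (simp_all add: x_def split: if_splits)
          then have "g j u \<noteq> g j u'"
            using inj[OF j] u(3) by (auto dest: inj_onD)
          then have "Q (g j u) (g j u')"
            using z' uV by blast
          then show ?thesis
            using same[OF j uV(1,2) u(3)] by simp
        qed
        show "(\<Sum>u\<in>V j. x u) = 1"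
          using sum\<Phi>[OF j, of x] z' by (simp add: \<Phi>x)
      qed
      then show "z \<in> \<Phi> ` topspace ?S"
        using j \<Phi>x by (intro image_eqI[of _ _ "(j, x)"]) auto
    qed
  qed
  moreover have "compact_space ?S"
    using J V by (intro compact_space_sum_topology)
      (auto intro: compact_geometric_realization simplicial_complex_flag)
  ultimately have q\<Phi>: "quotient_map ?S (flag_space W Q) \<Phi>"
    by (intro T1_Spaces.continuous_imp_quotient_map Hausdorff_geometric_realization)
  have \<Phi>b: "\<Phi> (j, vertex_point (v j)) = vertex_point b" if j: "j \<in> J" for j
  proof
    fix w
    show "\<Phi> (j, vertex_point (v j)) w = vertex_point b w"
    proof (cases "w \<in> g j ` V j")
      case True
      then obtain u where u: "u \<in> V j" "w = g j u"
        by blast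
      then have "w = b \<longleftrightarrow> u = v j"
        using base[OF j] inj_onD[OF inj[OF j]] by metis
      then show ?thesis
        using \<Phi>g[OF j u(1)] u(2) by (simp add: vertex_point_def)
    next
      case False
      then have "w \<noteq> b"
        using base[OF j] by auto
      then show ?thesis
        using False by (simp add: \<Phi>_def vertex_point_def)
    qed
  qed
  have \<Phi>_inj: "x = y" if j: "j \<in> J" and x: "x \<in> topspace (flag_space (V j) (R j))"
    and y: "y \<in> topspace (flag_space (V j) (R j))" and eq: "\<Phi> (j, x) = \<Phi> (j, y)" for j x y
  proof
    fix u show "x u = y u"
    proof (cases "u \<in> V j")
      case True
      then show ?thesis
        using \<Phi>g[OF j True, of x] \<Phi>g[OF j True, of y] eq by simp
    next
      case False
      then show ?thesis
        using x y unfolding in_flag_space_iff[OF V[OF j]] by metis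
    qed
  qed
  \<comment> \<open>Two pieces share only the vertex \<open>b\<close>, so a point reached from both
    has its whole weight there: exactly the identification made by the wedge.\<close>
  have vtx: "x = vertex_point (v i)"
    if ij: "i \<in> J" "j \<in> J" "i \<noteq> j" and x: "x \<in> topspace (flag_space (V i) (R i))"
      and eq: "\<Phi> (i, x) = \<Phi> (j, y)" for i j x y
  proof -
    note x' = x[unfolded in_flag_space_iff[OF V[OF ij(1)]]]
    have 0: "x u = 0" if "u \<noteq> v i" for u
    proof (rule ccontr)
      assume n: "x u \<noteq> 0"
      then have u: "u \<in> V i"
        using x' by blast
      then have "\<Phi> (j, y) (g i u) \<noteq> 0"
        using \<Phi>g[OF ij(1) u, of x] eq n by simp
      then obtain u' where "u' \<in> V j" "g i u = g j u'"
        using \<Phi>0 by blast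
      then have "g i u = b"
        using disj[OF ij u] by blast
      then show False
        using inj_onD[OF inj[OF ij(1)], of u "v i"] u base[OF ij(1)] that by simp
    qed
    have "(\<Sum>u\<in>V i. x u) = (\<Sum>u\<in>{v i}. x u)"
      by (rule sum.mono_neutral_right) (use V[OF ij(1)] base[OF ij(1)] 0 in auto)
    then have "x (v i) = 1"
      using x' by simp
    then show ?thesis
      using 0 by (auto simp: vertex_point_def)
  qed
  show ?thesis
  proof (rule homeomorphic_space_quotient_maps[OF q\<Phi> quotient_map_wedge_proj])
    fix z z' assume z: "z \<in> topspace ?S" "z' \<in> topspace ?S"
    obtain i x j y where ij: "z = (i, x)" "z' = (j, y)"
      by (cases z, cases z')
    have mem': "i \<in> J" "x \<in> topspace (flag_space (V i) (R i))" "j \<in> J" "y \<in> topspace (flag_space (V j) (R j))"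
      using z ij by auto
    show "\<Phi> z = \<Phi> z' \<longleftrightarrow> wedge_proj ?F z = wedge_proj ?F z'"
    proof
      assume eq: "\<Phi> z = \<Phi> z'"
      show "wedge_proj ?F z = wedge_proj ?F z'"
      proof (cases "i = j")
        case True
        then show ?thesis
          using \<Phi>_inj[OF mem'(1,2), of y] mem' eq ij by simp
      next
        case False
        then have "x = vertex_point (v i)" "y = vertex_point (v j)"
          using vtx[OF mem'(1,3) False mem'(2), of y] vtx[OF mem'(3,1) _ mem'(4), of x] eq ij by auto
        then show ?thesis
          by (simp add: ij wedge_proj_def)
      qed
    next
      assume "wedge_proj ?F z = wedge_proj ?F z'"
      then have "i = j \<and> x = y \<or> x = vertex_point (v i) \<and> y = vertex_point (v j)"
        unfolding ij wedge_proj_eq_iff by simp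
      then show "\<Phi> z = \<Phi> z'"
        using \<Phi>b mem' ij by auto
    qed
  qed
qed

section \<open>Iterated suspensions and splitting off cones\<close>

text \<open>Each suspension leaves the base point at its newest pole \<open>p k\<close>, whatever it
  was before; hence the case distinction on \<open>k\<close>.\<close>

lemma pointed_heq_iterated_suspension:
  fixes p q :: "nat \<Rightarrow> 'v"
  assumes V: "finite V" and R: "symp R" and a: "a \<in> topspace (flag_space V R)"
    and W: "\<And>k. W k = V \<union> p ` {..<k} \<union> q ` {..<k}"
    and fresh: "\<And>k. p k \<notin> W k" "\<And>k. q k \<notin> W k" "\<And>k. p k \<noteq> q k" "\<And>k. \<not> R (p k) (q k)"
    and adj: "\<And>k x. x \<in> W k \<Longrightarrow> R (p k) x" "\<And>k x. x \<in> W k \<Longrightarrow> R (q k) x"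
  shows "pointed_heq (fst (iterated_suspension k (flag_space V R) a)) (snd (iterated_suspension k (flag_space V R) a))
     (flag_space (W k) R) (case k of 0 \<Rightarrow> a | Suc i \<Rightarrow> vertex_point (p i))"
proof (induction k)
  case 0
  have "pointed_heq (flag_space V R) a (quotient_topology (flag_space V R) Orig) (Orig a)"
    by (rule pointed_heq_homeomorphic[OF homeomorphic_map_Orig a])
  from pointed_heq_sym[OF this] show ?case
    by (simp add: iterated_suspension_def W)
next
  case (Suc k)
  let ?Y = "iterated_suspension k (flag_space V R) a"
  have step: "iterated_suspension (Suc k) (flag_space V R) a = reduced_suspension (fst ?Y, snd ?Y)"
    by (simp add: iterated_suspension_def)
  have base: "snd ?Y \<in> topspace (fst ?Y)"
    using Suc.IH unfolding pointed_heq_def by blast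
  have fin: "finite (W k)"
    using V by (simp add: W)
  have "W (Suc k) = insert (p k) (insert (q k) (W k))"
    by (auto simp: W less_Suc_eq)
  then show ?case
    unfolding step using pointed_heq_suspension_flag_space[OF Suc.IH suspension_map_susp_proj[OF base] fin
        fresh(1)[of k] fresh(2)[of k] fresh(3)[of k] fresh(4)[of k] R adj] by simp
qed

text \<open>A wedge with a single summand is reached from the complex by the identity and from its
  relabelled copy by \<open>f\<close>, so \<open>wedge_sum_flag_space\<close> applies to
  both.\<close>

lemma flag_space_relabel:
  assumes V: "finite V" "V \<noteq> {}" and f: "inj_on f V"
    and R: "\<And>x y. x \<in> V \<Longrightarrow> y \<in> V \<Longrightarrow> x \<noteq> y \<Longrightarrow> Q (f x) (f y) \<longleftrightarrow> R x y"
  shows "flag_space V R homeomorphic_space flag_space (f ` V) Q"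
proof -
  obtain v where v: "v \<in> V"
    using V by blast
  let ?W = "wedge_sum {()} (\<lambda>_. (flag_space V R, vertex_point v))"
  have "flag_space V R homeomorphic_space ?W"
    by (rule wedge_sum_flag_space[where g = "\<lambda>_ x. x" and b = v]) (use V v in auto)
  moreover have "flag_space (f ` V) Q homeomorphic_space ?W"
    by (rule wedge_sum_flag_space[where g = "\<lambda>_. f" and b = "f v"]) (use V v f R in auto)
  ultimately show ?thesis
    using homeomorphic_space_sym homeomorphic_space_trans by blast
qed

text \<open>If the link \<open>L\<close> of a vertex \<open>v\<close> is contained in the star of a vertex \<open>w\<close>, then the cone over \<open>L\<close>
  with apex \<open>v\<close> can be moved off the rest of the complex: the link is doubled by a copy \<open>c ` L\<close>, and
  the edges joining \<open>v\<close> to \<open>L\<close> and \<open>L\<close> to its copy are removed. What remains is the wedge of the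
  deletion of \<open>v\<close> with the suspension of \<open>c ` L\<close> at the pole \<open>w\<close>, which can be exchanged for a
  neighbour \<open>w0\<close> of \<open>w\<close>.\<close>

lemma flag_space_split:
  fixes V :: "'v set" and c :: "'v \<Rightarrow> 'v"
  assumes V: "finite V" and R: "symp R" and v: "v \<in> V" and w: "w \<in> V" "w \<noteq> v" "\<not> R v w"
    and w0: "w0 \<in> V" "w0 \<noteq> v" "w0 = w \<or> R w0 w"
    and L: "L = {x \<in> V. x \<noteq> v \<and> R v x}" and wL: "\<And>x. x \<in> L \<Longrightarrow> R w x"
    and c: "inj_on c L" "c ` L \<inter> V = {}"
    and Q: "symp Q"
    and QV: "\<And>x y. x \<in> V \<Longrightarrow> y \<in> V \<Longrightarrow> x \<noteq> v \<Longrightarrow> y \<noteq> v \<Longrightarrow> x \<noteq> y \<Longrightarrow> Q x y \<longleftrightarrow> R x y"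
    and Qv: "\<And>y. y \<in> V \<Longrightarrow> y \<noteq> v \<Longrightarrow> \<not> Q v y"
    and QC: "\<And>x y. x \<in> L \<Longrightarrow> y \<in> L \<Longrightarrow> x \<noteq> y \<Longrightarrow> Q (c x) (c y) \<longleftrightarrow> R x y"
    and QCV: "\<And>x y. x \<in> L \<Longrightarrow> y \<in> V \<Longrightarrow> Q (c x) y \<longleftrightarrow> y = v \<or> y = w0"
  shows "flag_space V R homotopy_equivalent_space flag_space (V \<union> c ` L) Q"
proof -
  let ?C = "c ` L" and ?W = "V \<union> c ` L"
  define d where "d = inv_into L c"
  have d: "d (c x) = x" if "x \<in> L" for x
    using that c(1) by (simp add: d_def)
  have LV: "x \<in> V" "x \<noteq> v" "R v x" "R x v" if "x \<in> L" for x
    using that L sympD[OF R] by auto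
  have wL': "w \<notin> L" "R x w" if "x \<in> L" for x
    using L w sympD[OF R] wL[OF that] by auto
  have CV: "c x \<notin> V" "c x \<notin> L" "c x \<noteq> v" "c x \<noteq> w" "c x \<noteq> w0" "c x \<noteq> x" if "x \<in> L" for x
    using c(2) that v w(1) w0(1) L by auto
  have Lmem: "x \<in> L \<longleftrightarrow> x \<in> V \<and> x \<noteq> v \<and> R v x" for x
    using L by blast
  have vL: "v \<notin> L"
    using L by blast
  have finW: "finite ?W"
    using V by (simp add: L)
  have symR: "R x y \<longleftrightarrow> R y x" for x y
    using sympD[OF R] by blast
  \<comment> \<open>In \<open>R1\<close> the copy \<open>c x\<close> is joined to \<open>x\<close>,
    to \<open>v\<close> and \<open>w\<close>, to the neighbours of \<open>x\<close> in
    \<open>L\<close> and to the copies of these. All of them lie in the star of \<open>x\<close>, so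
    \<open>x\<close> dominates \<open>c x\<close> and the copies may be added.\<close>
  define near where "near a b \<longleftrightarrow> a \<in> ?C \<and> (b = v \<or> b = w \<or> b \<in> L \<and> (b = d a \<or> R b (d a)))" for a b
  define R1 where "R1 a b \<longleftrightarrow> (a \<in> V \<and> b \<in> V \<and> R a b) \<or> (a \<in> ?C \<and> b \<in> ?C \<and> R (d a) (d b)) \<or>
     near a b \<or> near b a" for a b
  define R2 where "R2 a b \<longleftrightarrow> R1 a b \<and> \<not> (a = v \<and> b \<in> L) \<and> \<not> (a \<in> L \<and> b = v)" for a b
  define R3 where "R3 a b \<longleftrightarrow> R2 a b \<and> \<not> (a \<in> L \<and> b \<in> ?C) \<and> \<not> (a \<in> ?C \<and> b \<in> L)" for a b
  define R4 where "R4 a b \<longleftrightarrow> R3 a b \<or> (a = w0 \<and> b \<in> ?C) \<or> (a \<in> ?C \<and> b = w0)" for a b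
  have sym: "symp R1" "symp R2" "symp R3" "symp R4"
    using symR by (auto simp: symp_def R1_def R2_def R3_def R4_def)
  have R1V: "R1 a b \<longleftrightarrow> R a b" if "a \<in> V" "b \<in> V" for a b
    using that CV by (auto simp: R1_def near_def)
  have R1C: "R1 (c x) (c y) \<longleftrightarrow> R x y" if "x \<in> L" "y \<in> L" for x y
    using that CV LV w(1) v d by (auto simp: R1_def near_def)
  have R1CV: "R1 (c x) b \<longleftrightarrow> b = v \<or> b = w \<or> b \<in> L \<and> (b = x \<or> R b x)"
      "R1 b (c x) \<longleftrightarrow> b = v \<or> b = w \<or> b \<in> L \<and> (b = x \<or> R b x)" if "x \<in> L" "b \<in> V" for x b
    using that CV d by (auto simp: R1_def near_def)
  have "flag_space V R = flag_space V R1"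
    by (intro arg_cong[where f = geometric_realization] flag_complex_cong) (simp add: R1V)
  also have "flag_space V R1 homotopy_equivalent_space flag_space ?W R1"
  proof (subst homotopy_equivalent_space_sym, rule flag_space_remove_vertices[OF finW sym(1)])
    fix z assume "z \<in> ?W" "z \<notin> V"
    then obtain l where l: "l \<in> L" "z = c l"
      by blast
    show "\<exists>w\<in>V. R1 z w \<and> (\<forall>x\<in>?W. x \<noteq> w \<longrightarrow> x \<noteq> z \<longrightarrow> R1 x z \<longrightarrow> R1 x w)"
    proof (intro bexI[of _ l] conjI ballI impI)
      show "R1 z l"
        using l LV by (simp add: R1CV)
      show "R1 x l" if xW: "x \<in> ?W" "x \<noteq> l" "x \<noteq> z" "R1 x z" for x
        proof (cases "x \<in> V")
          case True
          then have "x = v \<or> x = w \<or> x \<in> L \<and> (x = l \<or> R x l)"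
            using that(4) l R1CV(2)[OF l(1) True] by simp
          then have "R x l"
            using that(2) LV(3)[OF l(1)] wL[OF l(1)] by blast
          then show ?thesis
            using R1V[OF True LV(1)[OF l(1)]] by simp
        next
          case False
          then obtain y where y: "y \<in> L" "x = c y"
            using xW(1) by blast
          then have "R l y"
            using that(4) l symR R1C[of y l] by blast
          then show ?thesis
            using y l LV(1)[OF l(1)] R1CV(1)[of y l] by blast
        qed
    qed (use l LV in auto)
  qed simp
  \<comment> \<open>The edge from \<open>v\<close> to \<open>l\<close> goes with witness
    \<open>c l\<close>: the other common neighbours are neighbours of \<open>l\<close> in
    \<open>L\<close> and copies of such, and all of them are joined to \<open>c l\<close>.\<close>
  also have "flag_space ?W R1 homotopy_equivalent_space flag_space ?W R2"
  proof (rule flag_space_remove_edges_symmetric[OF finW sym(1,2), where T = "\<lambda>a b. a = v \<and> b \<in> L"])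
    show "R1 x y" if "R2 x y" for x y
      using that by (simp add: R2_def)
    show "(x = v \<and> y \<in> L) \<or> (y = v \<and> x \<in> L)" if "R1 x y" "\<not> R2 x y" for x y
      using that by (auto simp: R2_def)
    fix u l assume ul: "u = v \<and> l \<in> L"
    show "\<exists>w\<in>?W. w \<noteq> u \<and> w \<noteq> l \<and> R2 w u \<and> R2 w l \<and>
        (\<forall>x\<in>?W. x \<noteq> w \<longrightarrow> x \<noteq> u \<longrightarrow> x \<noteq> l \<longrightarrow> R1 x u \<longrightarrow> R1 x l \<longrightarrow> R2 x w)"
    proof (intro bexI[of _ "c l"] conjI ballI impI)
      show "R2 (c l) u" "R2 (c l) l" "c l \<noteq> u" "c l \<noteq> l"
        using ul v LV CV by (auto simp: R2_def R1CV)
      show "R2 x (c l)" if x: "x \<in> ?W" "x \<noteq> c l" "x \<noteq> u" "x \<noteq> l" "R1 x u" "R1 x l" for x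
      proof (cases "x \<in> V")
        case True
        then have "R x v" "R x l"
          using x ul v LV(1)[of l] R1V by auto
        then have "x \<in> L"
          using x ul True symR[of x v] Lmem by blast
        note \<open>R x l\<close>
        then show ?thesis
          using ul True \<open>x \<in> L\<close> CV(1-3)[of l] R1CV(2)[of l x] by (auto simp: R2_def)
      next
        case False
        then obtain y where y: "y \<in> L" "x = c y"
          using x(1) by blast
        then have "R l y"
          using x ul LV(1,2)[of l] wL'(1)[OF y(1)] R1CV(1)[of y l] by auto
        then have "R y l"
          using symR by blast
        then show ?thesis
          using y ul CV(2,3)[of l] CV(2,3)[of y] R1C[of y l] by (auto simp: R2_def)
      qed
    qed (use ul in auto)
  qed
  \<comment> \<open>Now that \<open>v\<close> has lost \<open>L\<close>, any common neighbour, other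
    than \<open>w\<close>, of a vertex of \<open>L\<close> and a copy lies in \<open>L\<close> or
    among the copies, and \<open>w\<close> is joined to both sets.\<close>
  also have "flag_space ?W R2 homotopy_equivalent_space flag_space ?W R3"
  proof (rule flag_space_remove_edges_symmetric[OF finW sym(2,3), where T = "\<lambda>a b. a \<in> L \<and> b \<in> ?C"])
    show "R2 x y" if "R3 x y" for x y
      using that by (simp add: R3_def)
    show "(x \<in> L \<and> y \<in> ?C) \<or> (y \<in> L \<and> x \<in> ?C)" if "R2 x y" "\<not> R3 x y" for x y
      using that by (auto simp: R3_def)
    fix l z assume "l \<in> L \<and> z \<in> ?C"
    then obtain y where l: "l \<in> L" and y: "y \<in> L" "z = c y"
      by blast
    show "\<exists>w\<in>?W. w \<noteq> l \<and> w \<noteq> z \<and> R3 w l \<and> R3 w z \<and>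
        (\<forall>x\<in>?W. x \<noteq> w \<longrightarrow> x \<noteq> l \<longrightarrow> x \<noteq> z \<longrightarrow> R2 x l \<longrightarrow> R2 x z \<longrightarrow> R3 x w)"
    proof (intro bexI[of _ w] conjI ballI impI)
      show "R3 w l" "R3 w z" "w \<noteq> l" "w \<noteq> z"
        using l y w LV CV wL wL' by (auto simp: R3_def R2_def R1V R1CV)
      show "R3 x w" if x: "x \<in> ?W" "x \<noteq> w" "x \<noteq> l" "x \<noteq> z" "R2 x l" "R2 x z" for x
      proof (cases "x \<in> V")
        case True
        then have "x = v \<or> x \<in> L"
          using x y by (auto simp: R2_def R1CV)
        moreover have "x \<noteq> v"
          using x l by (auto simp: R2_def)
        ultimately show ?thesis
          using True w wL' CV by (auto simp: R3_def R2_def R1V)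
      next
        case False
        then obtain y' where "y' \<in> L" "x = c y'"
          using x(1) by blast
        then show ?thesis
          using w wL' CV LV v by (auto simp: R3_def R2_def R1CV)
      qed
    qed (use w in auto)
  qed
  \<comment> \<open>If \<open>w0 \<noteq> w\<close>, edges from \<open>w0\<close> to the copies are
    inserted with witness \<open>w\<close>, and then those from \<open>w\<close> are deleted with
    witness \<open>w0\<close>. This slides the pole of the suspension from \<open>w\<close> to
    \<open>w0\<close>; the other pole \<open>v\<close> does not interfere, being joined to no other
    vertex of \<open>V\<close> any more.\<close>
  also have "flag_space ?W R3 homotopy_equivalent_space flag_space ?W R4"
  proof (subst homotopy_equivalent_space_sym,
      rule flag_space_remove_edges_symmetric[OF finW sym(4,3), where T = "\<lambda>a b. a = w0 \<and> b \<in> ?C \<and> w0 \<noteq> w"])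
    show "R4 x y" if "R3 x y" for x y
      using that by (simp add: R4_def)
    have "R3 w z" "R3 z w" if "z \<in> ?C" for z
      using that w CV wL' LV v by (auto simp: R3_def R2_def R1CV)
    then show "(x = w0 \<and> y \<in> ?C \<and> w0 \<noteq> w) \<or> (y = w0 \<and> x \<in> ?C \<and> w0 \<noteq> w)" if "R4 x y" "\<not> R3 x y" for x y
      using that by (auto simp: R4_def)
    fix u z assume "u = w0 \<and> z \<in> ?C \<and> w0 \<noteq> w"
    then obtain y where u: "u = w0" "w0 \<noteq> w" and y: "y \<in> L" "z = c y"
      by blast
    have "R w w0"
      using u w0(3) symR[of w0 w] by blast
    show "\<exists>w\<in>?W. w \<noteq> u \<and> w \<noteq> z \<and> R3 w u \<and> R3 w z \<and>
        (\<forall>x\<in>?W. x \<noteq> w \<longrightarrow> x \<noteq> u \<longrightarrow> x \<noteq> z \<longrightarrow> R4 x u \<longrightarrow> R4 x z \<longrightarrow> R3 x w)"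
    proof (intro bexI[of _ w] conjI ballI impI)
      show "R3 w u" "R3 w z" "w \<noteq> u" "w \<noteq> z"
        using u y w w0 \<open>R w w0\<close> LV CV wL wL' by (auto simp: R3_def R2_def R1V R1CV)
      show "R3 x w" if x: "x \<in> ?W" "x \<noteq> w" "x \<noteq> u" "x \<noteq> z" "R4 x u" "R4 x z" for x
      proof (cases "x \<in> V")
        case True
        then have "x = v"
          using x y u CV by (auto simp: R4_def R3_def R2_def R1CV)
        then have "R v w0"
          using x u v w0 CV by (auto simp: R4_def R3_def R2_def R1V)
        then have "w0 \<in> L"
          using w0 Lmem by blast
        then have False
          using x \<open>x = v\<close> u w0(2) v c(2) by (auto simp: R4_def R3_def R2_def)
        then show ?thesis ..
      next
        case False
        then obtain y' where "y' \<in> L" "x = c y'"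
          using x(1) by blast
        then show ?thesis
          using w wL' CV LV v by (auto simp: R3_def R2_def R1CV)
      qed
    qed (use w in auto)
  qed
  also have "flag_space ?W R4 homotopy_equivalent_space flag_space ?W Q"
  proof (rule flag_space_remove_edges_symmetric[OF finW sym(4) Q, where T = "\<lambda>a b. a = w \<and> b \<in> ?C \<and> w0 \<noteq> w"])
    have QCV': "Q y (c x) \<longleftrightarrow> y = v \<or> y = w0" if "x \<in> L" "y \<in> V" for x y
      using QCV[OF that] sympD[OF Q] by blast
    have Qv': "\<not> Q y v" if "y \<in> V" "y \<noteq> v" for y
      using Qv[OF that] sympD[OF Q] by blast
    have R4CV: "R4 (c x) y \<longleftrightarrow> y = v \<or> y = w \<or> y = w0" "R4 y (c x) \<longleftrightarrow> y = v \<or> y = w \<or> y = w0"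
      if "x \<in> L" "y \<in> V" for x y
      using that CV LV w w0 v vL wL' by (auto simp: R4_def R3_def R2_def R1CV)
    have R4C: "R4 (c x) (c y) \<longleftrightarrow> R x y" if "x \<in> L" "y \<in> L" for x y
      using that CV LV v w0 by (auto simp: R4_def R3_def R2_def R1C)
    have R4V: "R4 x y \<longleftrightarrow> R x y" if "x \<in> V" "y \<in> V" "x \<noteq> v" "y \<noteq> v" for x y
      using that CV by (auto simp: R4_def R3_def R2_def R1V)
    have R4v: "\<not> R4 v y" "\<not> R4 y v" if "y \<in> V" "y \<noteq> v" for y
    proof -
      have "\<not> R2 v y" "\<not> R2 y v"
        using that v R1V Lmem[of y] symR[of y v] by (auto simp: R2_def)
      moreover have "v \<notin> ?C" "y \<notin> ?C"
        using that v c(2) by blast+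
      ultimately show "\<not> R4 v y" "\<not> R4 y v"
        by (auto simp: R4_def R3_def)
    qed
    show "R4 x y" if xy: "x \<in> ?W" "y \<in> ?W" "x \<noteq> y" "Q x y" for x y
    proof -
      consider "x \<in> V" "y \<in> V" | a where "a \<in> L" "x = c a" "y \<in> V" | a where "a \<in> L" "y = c a" "x \<in> V"
        | a b where "a \<in> L" "x = c a" "b \<in> L" "y = c b"
        using xy(1,2) by blast
      then show ?thesis
      proof cases
        case 1
        then show ?thesis
          using xy Qv Qv' QV R4V by (cases "x = v \<or> y = v") auto
      next
        case 4
        then show ?thesis
          using xy QC R4C by auto
      qed (use xy R4CV QCV QCV' in auto)
    qed
    show "(x = w \<and> y \<in> ?C \<and> w0 \<noteq> w) \<or> (y = w \<and> x \<in> ?C \<and> w0 \<noteq> w)"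
      if xy: "x \<in> ?W" "y \<in> ?W" "x \<noteq> y" "R4 x y" "\<not> Q x y" for x y
    proof -
      consider "x \<in> V" "y \<in> V" | a where "a \<in> L" "x = c a" "y \<in> V" | a where "a \<in> L" "y = c a" "x \<in> V"
        | a b where "a \<in> L" "x = c a" "b \<in> L" "y = c b"
        using xy(1,2) by blast
      then show ?thesis
      proof cases
        case 1
        then show ?thesis
          using xy R4v QV R4V by (cases "x = v \<or> y = v") auto
      next
        case 4
        then show ?thesis
          using xy QC R4C by auto
      qed (use xy R4CV QCV QCV' in auto)
    qed
    fix u z assume "u = w \<and> z \<in> ?C \<and> w0 \<noteq> w"
    then obtain y where u: "u = w" "w0 \<noteq> w" and y: "y \<in> L" "z = c y"
      by blast
    have "R w0 w"
      using u w0 by blast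
    show "\<exists>w\<in>?W. w \<noteq> u \<and> w \<noteq> z \<and> Q w u \<and> Q w z \<and>
        (\<forall>x\<in>?W. x \<noteq> w \<longrightarrow> x \<noteq> u \<longrightarrow> x \<noteq> z \<longrightarrow> R4 x u \<longrightarrow> R4 x z \<longrightarrow> Q x w)"
    proof (intro bexI[of _ w0] conjI ballI impI)
      show "Q w0 u" "Q w0 z" "w0 \<noteq> u" "w0 \<noteq> z"
        using u y w w0 \<open>R w0 w\<close> CV QV[of w0 w] by (auto simp: QCV')
      show "Q x w0" if x: "x \<in> ?W" "x \<noteq> w0" "x \<noteq> u" "x \<noteq> z" "R4 x u" "R4 x z" for x
      proof (cases "x \<in> V")
        case True
        then have "x = v"
          using x y u by (auto simp: R4CV)
        then have False
          using x(5) u R4v[OF w(1,2)] by simp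
        then show ?thesis ..
      next
        case False
        then obtain y' where "y' \<in> L" "x = c y'"
          using x(1) by blast
        then show ?thesis
          using w0 QCV by auto
      qed
    qed (use w0 in auto)
  qed
  finally show ?thesis .
qed

section \<open>Reduction of the graph\<close>

fun Delta_adj :: "vert \<Rightarrow> vert \<Rightarrow> bool" where
  "Delta_adj (EV i) (EV j) \<longleftrightarrow> False"
| "Delta_adj (EV i) (FV k j) \<longleftrightarrow> i = j \<or> i = Suc j"
| "Delta_adj (FV k j) (EV i) \<longleftrightarrow> i = j \<or> i = Suc j"
| "Delta_adj (FV k i) (FV l j) \<longleftrightarrow> k = l \<and> (i = Suc j \<or> j = Suc i)"

lemma Delta_adj_commute: "Delta_adj x y \<longleftrightarrow> Delta_adj y x"
  by (cases x; cases y) auto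

lemma EV_in_Delta_verts: "EV i \<in> Delta_verts m n \<longleftrightarrow> 1 \<le> i \<and> i \<le> n"
  and FV_in_Delta_verts: "FV k i \<in> Delta_verts m n \<longleftrightarrow> 1 \<le> k \<and> k \<le> m \<and> 1 \<le> i \<and> i < n"
  by (auto simp: Delta_verts_def)

lemma in_Delta_edges_iff:
  assumes "u \<in> Delta_verts m n" and "v \<in> Delta_verts m n"
  shows "{u, v} \<in> Delta_edges m n \<longleftrightarrow> Delta_adj u v"
proof (cases u; cases v)
  fix i j assume "u = EV i" "v = EV j"
  then show ?thesis
    by (auto simp: Delta_edges_def doubleton_eq_iff)
next
  fix i k j assume "u = EV i" "v = FV k j"
  then show ?thesis
    using assms by (auto simp: Delta_edges_def doubleton_eq_iff EV_in_Delta_verts FV_in_Delta_verts)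
next
  fix i k j assume "u = FV k j" "v = EV i"
  then show ?thesis
    using assms by (auto simp: Delta_edges_def doubleton_eq_iff EV_in_Delta_verts FV_in_Delta_verts)
next
  fix k i l j assume uv: "u = FV k i" "v = FV l j"
  show ?thesis
  proof
    assume "Delta_adj u v"
    then have "{u, v} = {FV k (min i j), FV k (min i j + 1)}" and "k = l" "i = Suc j \<or> j = Suc i"
      using uv by (auto simp: min_def)
    moreover have "1 \<le> k \<and> k \<le> m \<and> 1 \<le> min i j \<and> min i j \<le> n - 2"
      using assms uv \<open>k = l\<close> \<open>i = Suc j \<or> j = Suc i\<close> by (auto simp: FV_in_Delta_verts)
    ultimately show "{u, v} \<in> Delta_edges m n"
      unfolding Delta_edges_def by blast
  qed (use uv in \<open>auto simp: Delta_edges_def doubleton_eq_iff\<close>)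
qed

lemma I_Delta_eq_flag_space: "I_Delta m n = flag_space (Delta_verts m n) (\<lambda>x y. \<not> Delta_adj x y)"
proof -
  \<comment> \<open>Independence is tested for \<open>u = v\<close> as well, which the flag
    condition leaves out.\<close>
  have irr: "\<not> Delta_adj u u" for u
    by (cases u) auto
  have "independence_complex (Delta_verts m n) (Delta_edges m n)
      = flag_complex (Delta_verts m n) (\<lambda>x y. \<not> Delta_adj x y)"
  proof (intro set_eqI iffI)
    fix \<sigma> assume "\<sigma> \<in> independence_complex (Delta_verts m n) (Delta_edges m n)"
    then have "\<sigma> \<subseteq> Delta_verts m n" "\<And>u v. u \<in> \<sigma> \<Longrightarrow> v \<in> \<sigma> \<Longrightarrow> {u, v} \<notin> Delta_edges m n"
      by (auto simp: independence_complex_def)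
    then show "\<sigma> \<in> flag_complex (Delta_verts m n) (\<lambda>x y. \<not> Delta_adj x y)"
      unfolding flag_complex_def using in_Delta_edges_iff by (auto simp: subset_iff)
  next
    fix \<sigma> assume "\<sigma> \<in> flag_complex (Delta_verts m n) (\<lambda>x y. \<not> Delta_adj x y)"
    then have \<sigma>: "\<sigma> \<subseteq> Delta_verts m n" "\<And>u v. u \<in> \<sigma> \<Longrightarrow> v \<in> \<sigma> \<Longrightarrow> u \<noteq> v \<Longrightarrow> \<not> Delta_adj u v"
      by (auto simp: flag_complex_def)
    then have "{u, v} \<notin> Delta_edges m n" if "u \<in> \<sigma>" "v \<in> \<sigma>" for u v
      using in_Delta_edges_iff[of u m n v] irr that by (cases "u = v") (auto simp: subset_iff)
    moreover have "finite \<sigma>"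
      using \<sigma>(1) finite_Delta_verts by (rule finite_subset)
    ultimately show "\<sigma> \<in> independence_complex (Delta_verts m n) (Delta_edges m n)"
      using \<sigma>(1) by (simp add: independence_complex_def)
  qed
  then show ?thesis
    by (simp add: I_Delta_def)
qed

section \<open>Rewiring the neighbourhoods of $e_3$ and $e_1$\<close>

definition sym_closure :: "('a \<Rightarrow> 'a \<Rightarrow> bool) \<Rightarrow> 'a \<Rightarrow> 'a \<Rightarrow> bool" where
  "sym_closure P x y \<longleftrightarrow> P x y \<or> P y x"

lemma sym_closure_commute: "sym_closure P x y \<longleftrightarrow> sym_closure P y x"
  by (auto simp: sym_closure_def)

text \<open>The rewiring of $e_1$ and $e_3$: each name lists the end points of the edges to be inserted or
  deleted. In \<open>adj2\<close> to \<open>adj4\<close> the neighbourhood of $e_3$ becomes the set of all $f^k_1$ and $f^k_2$ with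
  $k \geq 2$, all $f^k_3$, and $e_1$; in \<open>adj5\<close> to \<open>adj7\<close> that of $e_1$ becomes the closed neighbourhood
  of $e_4$ together with $e_3$.\<close>

fun e3_f1 :: "vert \<Rightarrow> vert \<Rightarrow> bool" where
  "e3_f1 (EV i) (FV k j) \<longleftrightarrow> i = 3 \<and> 2 \<le> k \<and> j = 1"
| "e3_f1 _ _ \<longleftrightarrow> False"

fun e3_f2 :: "vert \<Rightarrow> vert \<Rightarrow> bool" where
  "e3_f2 (EV i) (FV k j) \<longleftrightarrow> i = 3 \<and> k = 1 \<and> j = 2"
| "e3_f2 _ _ \<longleftrightarrow> False"

fun e3_e1 :: "vert \<Rightarrow> vert \<Rightarrow> bool" where
  "e3_e1 (EV i) (EV j) \<longleftrightarrow> i = 3 \<and> j = 1"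
| "e3_e1 _ _ \<longleftrightarrow> False"

fun e1_e4_f4 :: "vert \<Rightarrow> vert \<Rightarrow> bool" where
  "e1_e4_f4 (EV i) (EV j) \<longleftrightarrow> i = 1 \<and> j = 4"
| "e1_e4_f4 (EV i) (FV k j) \<longleftrightarrow> i = 1 \<and> j = 4"
| "e1_e4_f4 _ _ \<longleftrightarrow> False"

fun e1_f1 :: "vert \<Rightarrow> vert \<Rightarrow> bool" where
  "e1_f1 (EV i) (FV k j) \<longleftrightarrow> i = 1 \<and> j = 1"
| "e1_f1 _ _ \<longleftrightarrow> False"

fun e1_f3 :: "vert \<Rightarrow> vert \<Rightarrow> bool" where
  "e1_f3 (EV i) (FV k j) \<longleftrightarrow> i = 1 \<and> j = 3"
| "e1_f3 _ _ \<longleftrightarrow> False"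

definition adj2 where "adj2 x y \<longleftrightarrow> Delta_adj x y \<or> sym_closure e3_f1 x y"
definition adj3 where "adj3 x y \<longleftrightarrow> adj2 x y \<and> \<not> sym_closure e3_f2 x y"
definition adj4 where "adj4 x y \<longleftrightarrow> adj3 x y \<or> sym_closure e3_e1 x y"
definition adj5 where "adj5 x y \<longleftrightarrow> adj4 x y \<or> sym_closure e1_e4_f4 x y"
definition adj6 where "adj6 x y \<longleftrightarrow> adj5 x y \<and> \<not> sym_closure e1_f1 x y"
definition adj7 where "adj7 x y \<longleftrightarrow> adj6 x y \<or> sym_closure e1_f3 x y"

lemmas adj_defs = adj2_def adj3_def adj4_def adj5_def adj6_def adj7_def

lemma symp_not_adj: "symp (\<lambda>x y. \<not> Delta_adj x y)" "symp (\<lambda>x y. \<not> adj2 x y)" "symp (\<lambda>x y. \<not> adj3 x y)"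
    "symp (\<lambda>x y. \<not> adj4 x y)" "symp (\<lambda>x y. \<not> adj5 x y)" "symp (\<lambda>x y. \<not> adj6 x y)" "symp (\<lambda>x y. \<not> adj7 x y)"
proof -
  have 1: "adj2 x y \<longleftrightarrow> adj2 y x" for x y
    using Delta_adj_commute[of x y] sym_closure_commute[of _ x y] by (simp add: adj2_def)
  have 2: "adj3 x y \<longleftrightarrow> adj3 y x" for x y
    using 1[of x y] sym_closure_commute[of _ x y] by (simp add: adj3_def)
  have 3: "adj4 x y \<longleftrightarrow> adj4 y x" for x y
    using 2[of x y] sym_closure_commute[of _ x y] by (simp add: adj4_def)
  have 4: "adj5 x y \<longleftrightarrow> adj5 y x" for x y
    using 3[of x y] sym_closure_commute[of _ x y] by (simp add: adj5_def)
  have 5: "adj6 x y \<longleftrightarrow> adj6 y x" for x y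
    using 4[of x y] sym_closure_commute[of _ x y] by (simp add: adj6_def)
  have 6: "adj7 x y \<longleftrightarrow> adj7 y x" for x y
    using 5[of x y] sym_closure_commute[of _ x y] by (simp add: adj7_def)
  show "symp (\<lambda>x y. \<not> Delta_adj x y)" "symp (\<lambda>x y. \<not> adj2 x y)" "symp (\<lambda>x y. \<not> adj3 x y)"
    "symp (\<lambda>x y. \<not> adj4 x y)" "symp (\<lambda>x y. \<not> adj5 x y)" "symp (\<lambda>x y. \<not> adj6 x y)" "symp (\<lambda>x y. \<not> adj7 x y)"
    using Delta_adj_commute 1 2 3 4 5 6 by (blast intro: sympI)+
qed

text \<open>In terms of the graph, an edge \<open>uv\<close> may be inserted or deleted if some vertex \<open>w\<close> is adjacent
  to neither \<open>u\<close> nor \<open>v\<close> and every neighbour of \<open>w\<close> is a neighbour of \<open>u\<close> or of \<open>v\<close>.\<close>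

lemma flag_space_add_graph_edges:
  assumes V: "finite V" and A: "symp (\<lambda>x y. \<not> A x y)" and B: "symp (\<lambda>x y. \<not> B x y)"
    and AB: "\<And>x y. B x y \<longleftrightarrow> A x y \<or> sym_closure P x y"
    and wit: "\<And>u v. u \<in> V \<Longrightarrow> v \<in> V \<Longrightarrow> P u v \<Longrightarrow> 
      \<exists>w\<in>V. w \<noteq> u \<and> w \<noteq> v \<and> \<not> B w u \<and> \<not> B w v \<and>
        (\<forall>x\<in>V. x \<noteq> w \<longrightarrow> x \<noteq> u \<longrightarrow> x \<noteq> v \<longrightarrow> B x w \<longrightarrow> A x u \<or> A x v)"
  shows "flag_space V (\<lambda>x y. \<not> A x y) homotopy_equivalent_space flag_space V (\<lambda>x y. \<not> B x y)"
proof (rule flag_space_remove_edges_symmetric[OF V A B, where T = P])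
  show "\<not> A x y" if "\<not> B x y" for x y
    using that AB[of x y] by blast
  show "P u v \<or> P v u" if "\<not> A u v" "\<not> \<not> B u v" for u v
    using that AB[of u v] unfolding sym_closure_def by blast
  fix u v assume "u \<in> V" "v \<in> V" "P u v"
  from wit[OF this] obtain w where "w \<in> V" "w \<noteq> u" "w \<noteq> v" "\<not> B w u" "\<not> B w v"
      "\<forall>x\<in>V. x \<noteq> w \<longrightarrow> x \<noteq> u \<longrightarrow> x \<noteq> v \<longrightarrow> B x w \<longrightarrow> A x u \<or> A x v"
    by (elim bexE conjE)
  then show "\<exists>w\<in>V. w \<noteq> u \<and> w \<noteq> v \<and> \<not> B w u \<and> \<not> B w v \<and>
      (\<forall>x\<in>V. x \<noteq> w \<longrightarrow> x \<noteq> u \<longrightarrow> x \<noteq> v \<longrightarrow> \<not> A x u \<longrightarrow> \<not> A x v \<longrightarrow> \<not> B x w)"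
    by (intro bexI[of _ w]) auto
qed

lemma flag_space_remove_graph_edges:
  assumes V: "finite V" and A: "symp (\<lambda>x y. \<not> A x y)" and B: "symp (\<lambda>x y. \<not> B x y)"
    and AB: "\<And>x y. B x y \<longleftrightarrow> A x y \<and> \<not> sym_closure P x y"
    and wit: "\<And>u v. u \<in> V \<Longrightarrow> v \<in> V \<Longrightarrow> P u v \<Longrightarrow> 
      \<exists>w\<in>V. w \<noteq> u \<and> w \<noteq> v \<and> \<not> A w u \<and> \<not> A w v \<and>
        (\<forall>x\<in>V. x \<noteq> w \<longrightarrow> x \<noteq> u \<longrightarrow> x \<noteq> v \<longrightarrow> A x w \<longrightarrow> B x u \<or> B x v)"
  shows "flag_space V (\<lambda>x y. \<not> A x y) homotopy_equivalent_space flag_space V (\<lambda>x y. \<not> B x y)"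
proof (subst homotopy_equivalent_space_sym, rule flag_space_remove_edges_symmetric[OF V B A, where T = P])
  show "\<not> B x y" if "\<not> A x y" for x y
    using that AB[of x y] by blast
  show "P u v \<or> P v u" if "\<not> B u v" "\<not> \<not> A u v" for u v
    using that AB[of u v] unfolding sym_closure_def by blast
  fix u v assume "u \<in> V" "v \<in> V" "P u v"
  from wit[OF this] obtain w where "w \<in> V" "w \<noteq> u" "w \<noteq> v" "\<not> A w u" "\<not> A w v"
      "\<forall>x\<in>V. x \<noteq> w \<longrightarrow> x \<noteq> u \<longrightarrow> x \<noteq> v \<longrightarrow> A x w \<longrightarrow> B x u \<or> B x v"
    by (elim bexE conjE)
  then show "\<exists>w\<in>V. w \<noteq> u \<and> w \<noteq> v \<and> \<not> A w u \<and> \<not> A w v \<and>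
      (\<forall>x\<in>V. x \<noteq> w \<longrightarrow> x \<noteq> u \<longrightarrow> x \<noteq> v \<longrightarrow> \<not> B x u \<longrightarrow> \<not> B x v \<longrightarrow> \<not> A x w)"
    by (intro bexI[of _ w]) auto
qed

definition reduced_verts :: "nat \<Rightarrow> nat \<Rightarrow> vert set" where
  "reduced_verts m n = Delta_verts m n - {EV 2} - {FV k 3 | k. True}"

lemma vert_ball_iff: "(\<forall>x\<in>V. P x) \<longleftrightarrow> (\<forall>i. EV i \<in> V \<longrightarrow> P (EV i)) \<and> (\<forall>k i. FV k i \<in> V \<longrightarrow> P (FV k i))"
  by (metis vert.exhaust)

text \<open>The order of the moves matters. The new edges $e_3 f^k_1$ allow $e_3 f^1_2$ to go, its
  removal makes $f^1_2$ a witness for $e_1 e_3$, and this edge in turn takes care of the neighbour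
  $e_3$ of the later witnesses $f^k_2$ and $f^k_3$.\<close>

lemma I_Delta_homotopy_equivalent_reduced:
  assumes n: "n \<ge> 5" and m: "m \<ge> 1"
  shows "I_Delta m n homotopy_equivalent_space flag_space (reduced_verts m n) (\<lambda>x y. \<not> adj7 x y)"
proof -
  let ?V = "Delta_verts m n - {EV 2}"
  note mem = EV_in_Delta_verts FV_in_Delta_verts
  have fin: "finite (Delta_verts m n)" "finite ?V"
    using finite_Delta_verts by auto
  have "I_Delta m n homotopy_equivalent_space flag_space ?V (\<lambda>x y. \<not> Delta_adj x y)"
    unfolding I_Delta_eq_flag_space
  proof (rule flag_space_remove_vertices[OF fin(1) symp_not_adj(1)])
    fix v assume "v \<in> Delta_verts m n" "v \<notin> ?V"
    then have "v = EV 2"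
      by blast
    then show "\<exists>w\<in>?V. \<not> Delta_adj v w \<and> (\<forall>x\<in>Delta_verts m n. x \<noteq> w \<longrightarrow> x \<noteq> v \<longrightarrow> \<not> Delta_adj x v \<longrightarrow> \<not> Delta_adj x w)"
      using n by (intro bexI[of _ "EV 1"]) (auto simp: mem vert_ball_iff)
  qed simp
  \<comment> \<open>Without $e_2$ the witness $f^1_1$ has only the neighbours $e_1$, adjacent to
    $f^k_1$, and $f^1_2$, adjacent to $e_3$.\<close>
  also have "flag_space ?V (\<lambda>x y. \<not> Delta_adj x y) homotopy_equivalent_space flag_space ?V (\<lambda>x y. \<not> adj2 x y)"
  proof (rule flag_space_add_graph_edges[OF fin(2) symp_not_adj(1,2) adj2_def])
    fix u v assume "u \<in> ?V" "v \<in> ?V" "e3_f1 u v"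
    then show "\<exists>w\<in>?V. w \<noteq> u \<and> w \<noteq> v \<and> \<not> adj2 w u \<and> \<not> adj2 w v \<and>
        (\<forall>x\<in>?V. x \<noteq> w \<longrightarrow> x \<noteq> u \<longrightarrow> x \<noteq> v \<longrightarrow> adj2 x w \<longrightarrow> Delta_adj x u \<or> Delta_adj x v)"
      using n m by (cases u; cases v; intro bexI[of _ "FV 1 1"])
        (auto simp: mem vert_ball_iff adj_defs sym_closure_def)
  qed
  \<comment> \<open>The neighbours $f^k_1$ of the witness $e_1$ are adjacent to $f^1_2$ for $k = 1$
    and by now to $e_3$ for $k \<ge> 2$.\<close>
  also have "flag_space ?V (\<lambda>x y. \<not> adj2 x y) homotopy_equivalent_space flag_space ?V (\<lambda>x y. \<not> adj3 x y)"
  proof (rule flag_space_remove_graph_edges[OF fin(2) symp_not_adj(2,3) adj3_def])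
    fix u v assume "u \<in> ?V" "v \<in> ?V" "e3_f2 u v"
    then show "\<exists>w\<in>?V. w \<noteq> u \<and> w \<noteq> v \<and> \<not> adj2 w u \<and> \<not> adj2 w v \<and>
        (\<forall>x\<in>?V. x \<noteq> w \<longrightarrow> x \<noteq> u \<longrightarrow> x \<noteq> v \<longrightarrow> adj2 x w \<longrightarrow> adj3 x u \<or> adj3 x v)"
      using n m by (cases u; cases v; intro bexI[of _ "EV 1"])
        (auto simp: mem vert_ball_iff adj_defs sym_closure_def)
  qed
  \<comment> \<open>The neighbours $f^1_1$ and $f^1_3$ of the witness $f^1_2$ are adjacent to $e_1$
    and $e_3$ respectively.\<close>
  also have "flag_space ?V (\<lambda>x y. \<not> adj3 x y) homotopy_equivalent_space flag_space ?V (\<lambda>x y. \<not> adj4 x y)"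
  proof (rule flag_space_add_graph_edges[OF fin(2) symp_not_adj(3,4) adj4_def])
    fix u v assume "u \<in> ?V" "v \<in> ?V" "e3_e1 u v"
    then show "\<exists>w\<in>?V. w \<noteq> u \<and> w \<noteq> v \<and> \<not> adj4 w u \<and> \<not> adj4 w v \<and>
        (\<forall>x\<in>?V. x \<noteq> w \<longrightarrow> x \<noteq> u \<longrightarrow> x \<noteq> v \<longrightarrow> adj4 x w \<longrightarrow> adj3 x u \<or> adj3 x v)"
      using n m by (cases u; cases v; intro bexI[of _ "FV 1 2"])
        (auto simp: mem vert_ball_iff adj_defs sym_closure_def)
  qed
  \<comment> \<open>For $f^k_4$ the witness is $f^k_2$, and for $e_4$ it is $f^1_2$. Its neighbour
    $f^k_1$ and, for $k \<ge> 2$, also $e_3$ are adjacent to $e_1$; its neighbour $f^k_3$ is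
    adjacent to both $e_4$ and $f^k_4$.\<close>
  also have "flag_space ?V (\<lambda>x y. \<not> adj4 x y) homotopy_equivalent_space flag_space ?V (\<lambda>x y. \<not> adj5 x y)"
  proof (rule flag_space_add_graph_edges[OF fin(2) symp_not_adj(4,5) adj5_def])
    fix u v assume "u \<in> ?V" "v \<in> ?V" "e1_e4_f4 u v"
    then show "\<exists>w\<in>?V. w \<noteq> u \<and> w \<noteq> v \<and> \<not> adj5 w u \<and> \<not> adj5 w v \<and>
        (\<forall>x\<in>?V. x \<noteq> w \<longrightarrow> x \<noteq> u \<longrightarrow> x \<noteq> v \<longrightarrow> adj5 x w \<longrightarrow> adj4 x u \<or> adj4 x v)"
      using n m by (cases u; cases v; intro bexI[of _ "FV (case v of EV _ \<Rightarrow> 1 | FV k _ \<Rightarrow> k) 2"])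
        (auto simp: mem vert_ball_iff adj_defs sym_closure_def)
  qed
  \<comment> \<open>Of the neighbours of the witness $f^k_3$, the vertices $e_3$, $e_4$ and $f^k_4$
    have become adjacent to $e_1$, and $f^k_2$ is adjacent to $f^k_1$.\<close>
  also have "flag_space ?V (\<lambda>x y. \<not> adj5 x y) homotopy_equivalent_space flag_space ?V (\<lambda>x y. \<not> adj6 x y)"
  proof (rule flag_space_remove_graph_edges[OF fin(2) symp_not_adj(5,6) adj6_def])
    fix u v assume "u \<in> ?V" "v \<in> ?V" "e1_f1 u v"
    then show "\<exists>w\<in>?V. w \<noteq> u \<and> w \<noteq> v \<and> \<not> adj5 w u \<and> \<not> adj5 w v \<and>
        (\<forall>x\<in>?V. x \<noteq> w \<longrightarrow> x \<noteq> u \<longrightarrow> x \<noteq> v \<longrightarrow> adj5 x w \<longrightarrow> adj6 x u \<or> adj6 x v)"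
      using n m by (cases u; cases v; intro bexI[of _ "FV (case v of EV _ \<Rightarrow> 1 | FV k _ \<Rightarrow> k) 3"])
        (auto simp: mem vert_ball_iff adj_defs sym_closure_def)
  qed
  \<comment> \<open>The witness $f^k_1$ has only the neighbours $f^k_2$ and, for $k \<ge> 2$, $e_3$,
    which are adjacent to $f^k_3$. The same inclusion lets $f^k_3$ be folded away
    afterwards.\<close>
  also have "flag_space ?V (\<lambda>x y. \<not> adj6 x y) homotopy_equivalent_space flag_space ?V (\<lambda>x y. \<not> adj7 x y)"
  proof (rule flag_space_add_graph_edges[OF fin(2) symp_not_adj(6,7) adj7_def])
    fix u v assume "u \<in> ?V" "v \<in> ?V" "e1_f3 u v"
    then show "\<exists>w\<in>?V. w \<noteq> u \<and> w \<noteq> v \<and> \<not> adj7 w u \<and> \<not> adj7 w v \<and>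
        (\<forall>x\<in>?V. x \<noteq> w \<longrightarrow> x \<noteq> u \<longrightarrow> x \<noteq> v \<longrightarrow> adj7 x w \<longrightarrow> adj6 x u \<or> adj6 x v)"
      using n m by (cases u; cases v; intro bexI[of _ "FV (case v of EV _ \<Rightarrow> 1 | FV k _ \<Rightarrow> k) 1"])
        (auto simp: mem vert_ball_iff adj_defs sym_closure_def)
  qed
  also have "flag_space ?V (\<lambda>x y. \<not> adj7 x y) homotopy_equivalent_space
      flag_space (reduced_verts m n) (\<lambda>x y. \<not> adj7 x y)"
  proof (rule flag_space_remove_vertices[OF fin(2) symp_not_adj(7)])
    fix v assume v: "v \<in> ?V" "v \<notin> reduced_verts m n"
    then obtain k where k: "v = FV k 3"
      by (auto simp: reduced_verts_def)
    then show "\<exists>w\<in>reduced_verts m n. \<not> adj7 v w \<and> (\<forall>x\<in>?V. x \<noteq> w \<longrightarrow> x \<noteq> v \<longrightarrow> \<not> adj7 x v \<longrightarrow> \<not> adj7 x w)"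
      using v n m by (intro bexI[of _ "FV k 1"])
        (auto simp: reduced_verts_def mem vert_ball_iff adj_defs sym_closure_def)
  qed (auto simp: reduced_verts_def)
  finally show ?thesis .
qed

section \<open>The wedge decomposition\<close>

text \<open>The pairs \<open>(l, a)\<close> in \<open>A\<close> are the cones that have been moved off the complex: layer \<open>l\<close> holds the
  copy of the link of the vertex \<open>a\<close>, and it is joined to \<open>a\<close> and to the wedge point \<open>FV m 1\<close>.\<close>

definition glue :: "nat \<Rightarrow> (nat \<times> vert) set \<Rightarrow> nat \<times> vert \<Rightarrow> nat \<times> vert \<Rightarrow> bool" where
  "glue m A = (\<lambda>(i, x) (j, y).
     if i = j then \<not> adj7 x y \<and> (i = 0 \<longrightarrow> x \<notin> snd ` A \<and> y \<notin> snd ` A)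
     else i = 0 \<and> ((j, x) \<in> A \<or> x = FV m 1 \<and> j \<in> fst ` A) \<or>
          j = 0 \<and> ((i, y) \<in> A \<or> y = FV m 1 \<and> i \<in> fst ` A))"

lemma symp_glue: "symp (glue m A)"
  using symp_not_adj(7) by (auto simp: symp_def glue_def)

definition link :: "nat \<Rightarrow> nat \<Rightarrow> vert \<Rightarrow> vert set" where
  "link m n a = {x \<in> reduced_verts m n. x \<noteq> a \<and> \<not> adj7 a x}"

lemma EV_in_reduced_verts: "EV i \<in> reduced_verts m n \<longleftrightarrow> 1 \<le> i \<and> i \<le> n \<and> i \<noteq> 2"
  and FV_in_reduced_verts: "FV k i \<in> reduced_verts m n \<longleftrightarrow> 1 \<le> k \<and> k \<le> m \<and> 1 \<le> i \<and> i < n \<and> i \<noteq> 3"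
  by (auto simp: reduced_verts_def EV_in_Delta_verts FV_in_Delta_verts)

lemma in_link_e3:
  "EV i \<in> link m n (EV 3) \<longleftrightarrow> 4 \<le> i \<and> i \<le> n"
  "FV k i \<in> link m n (EV 3) \<longleftrightarrow> 1 \<le> k \<and> k \<le> m \<and> i < n \<and> (k = 1 \<and> (i = 1 \<or> i = 2) \<or> 4 \<le> i)"
  by (auto simp: link_def EV_in_reduced_verts FV_in_reduced_verts adj_defs sym_closure_def)

lemma in_link_e1:
  "EV i \<in> link m n (EV 1) \<longleftrightarrow> 5 \<le> i \<and> i \<le> n"
  "FV k i \<in> link m n (EV 1) \<longleftrightarrow> 1 \<le> k \<and> k \<le> m \<and> i < n \<and> (i = 1 \<or> i = 2 \<or> 5 \<le> i)"
  by (auto simp: link_def EV_in_reduced_verts FV_in_reduced_verts adj_defs sym_closure_def)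

lemma finite_reduced_verts: "finite (reduced_verts m n)"
  using finite_Delta_verts by (simp add: reduced_verts_def)

lemma flag_space_reduced_verts_split:
  assumes n: "n \<ge> 5" and m: "m \<ge> 2"
  shows "flag_space (reduced_verts m n) (\<lambda>x y. \<not> adj7 x y) homotopy_equivalent_space
    flag_space (Pair 0 ` reduced_verts m n \<union> Pair 1 ` link m n (EV 3) \<union> Pair 2 ` link m n (EV 1))
      (glue m {(1, EV 3), (2, EV 1)})"
proof -
  let ?H = "reduced_verts m n"
  note mem = EV_in_reduced_verts FV_in_reduced_verts
  have "flag_space ?H (\<lambda>x y. \<not> adj7 x y) homeomorphic_space flag_space (Pair 0 ` ?H) (glue m {})"
  proof (rule flag_space_relabel[OF finite_reduced_verts])
    have "EV 1 \<in> ?H"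
      using n by (simp add: EV_in_reduced_verts)
    then show "?H \<noteq> {}"
      by blast
  qed (auto simp: inj_on_def glue_def)
  then have "flag_space ?H (\<lambda>x y. \<not> adj7 x y) homotopy_equivalent_space flag_space (Pair 0 ` ?H) (glue m {})"
    by (rule homeomorphic_imp_homotopy_equivalent_space)
  also have "flag_space (Pair 0 ` ?H) (glue m {}) homotopy_equivalent_space
      flag_space (Pair 0 ` ?H \<union> (\<lambda>(i :: nat, x). (1, x)) ` Pair 0 ` link m n (EV 3)) (glue m {(1, EV 3)})"
  \<comment> \<open>The graph neighbours of $f^m_1$ are $e_3$ and $f^m_2$. The latter is not in the
    link of $e_3$ because $m \<ge> 2$, so this link lies in the star of $f^m_1$, which is the wedge
    point already.\<close>
  proof (rule flag_space_split[where v = "(0, EV 3)" and w = "(0, FV m 1)" and ?w0.0 = "(0, FV m 1)"])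
    show "glue m {} (0, FV m 1) z" if z: "z \<in> Pair 0 ` link m n (EV 3)" for z
    proof -
      obtain x where x: "x \<in> link m n (EV 3)" "z = (0, x)"
        using z by blast
      then show ?thesis
        using m by (cases x) (auto simp: glue_def adj_defs sym_closure_def in_link_e3)
    qed
  qed (use n m finite_reduced_verts symp_glue in
      \<open>auto simp: glue_def link_def mem inj_on_def adj_defs(6) adj_defs sym_closure_def\<close>)
  also have "(\<lambda>(i :: nat, x). (1 :: nat, x)) ` Pair 0 ` link m n (EV 3) = Pair 1 ` link m n (EV 3)"
    by auto
  also have "flag_space (Pair 0 ` ?H \<union> Pair 1 ` link m n (EV 3)) (glue m {(1, EV 3)}) homotopy_equivalent_space
      flag_space (Pair 0 ` ?H \<union> Pair 1 ` link m n (EV 3) \<union> (\<lambda>(i :: nat, x). (2, x)) ` Pair 0 ` link m n (EV 1))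
        (glue m {(1, EV 3), (2, EV 1)})"
  \<comment> \<open>By the rewiring, all other graph neighbours of $e_4$ are neighbours of $e_1$, so
    the link of $e_1$ lies in the star of $e_4$. Exchanging $e_4$ for $f^m_1$ attaches this cone at
    the same wedge point as the other one.\<close>
  proof (rule flag_space_split[where v = "(0, EV 1)" and w = "(0, EV 4)" and ?w0.0 = "(0, FV m 1)"])
    show "glue m {(1, EV 3)} (0, EV 4) z" if z: "z \<in> Pair 0 ` link m n (EV 1)" for z
    proof -
      obtain x where x: "x \<in> link m n (EV 1)" "z = (0, x)"
        using z by blast
      then show ?thesis
        using m by (cases x) (auto simp: glue_def adj_defs sym_closure_def in_link_e1[unfolded One_nat_def])
    qed
    show "finite (Pair 0 ` ?H \<union> Pair 1 ` link m n (EV 3))"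
      using finite_reduced_verts by (simp add: link_def)
    have adj: "adj7 (EV (Suc 0)) (EV 3)" "adj7 (EV (Suc 0)) (EV 4)" "\<not> adj7 (FV m (Suc 0)) (EV 4)"
      by (auto simp: adj_defs sym_closure_def)
    show "\<not> glue m {(1, EV 3)} (0, EV 1) (0, EV 4)"
      "(0, FV m 1) = (0, EV 4) \<or> glue m {(1, EV 3)} (0, FV m 1) (0, EV 4)"
      by (simp_all add: glue_def adj)
    \<comment> \<open>The first split leaves the link of $e_1$ unchanged: layer $1$ is joined to
      layer $0$ only at $e_3$ and $f^m_1$, and the detached $e_3$ was a graph neighbour of $e_1$
      before.\<close>
    show "Pair 0 ` link m n (EV 1) = {z \<in> Pair 0 ` ?H \<union> Pair 1 ` link m n (EV 3).
        z \<noteq> (0, EV 1) \<and> glue m {(1, EV 3)} (0, EV 1) z}"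
      using adj by (auto simp: glue_def link_def)
    show "symp (glue m {(1, EV 3)})" "symp (glue m {(1, EV 3), (2, EV 1)})"
      by (rule symp_glue)+
  qed (use n m in \<open>auto simp: glue_def mem inj_on_def in_link_e1(1)[unfolded One_nat_def]\<close>)
  also have "(\<lambda>(i :: nat, x). (2 :: nat, x)) ` Pair 0 ` link m n (EV 1) = Pair 2 ` link m n (EV 1)"
    by auto
  finally show ?thesis .
qed

section \<open>Suspensions of the smaller complexes as pieces of the wedge\<close>

fun pole :: "vert \<Rightarrow> bool" where
  "pole (EV i) \<longleftrightarrow> False"
| "pole (FV k i) \<longleftrightarrow> k = 0 \<or> i = 0"

fun opposite :: "vert \<Rightarrow> vert \<Rightarrow> bool" where
  "opposite (FV k i) (FV l j) \<longleftrightarrow> i = 0 \<and> l = 0 \<and> k = j \<or> k = 0 \<and> j = 0 \<and> i = l"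
| "opposite _ _ \<longleftrightarrow> False"

text \<open>Every vertex \<open>FV k i\<close> of \<open>\<Delta>\<close> has \<open>k \<ge> 1\<close> and \<open>i \<ge> 1\<close>, so \<open>FV k 0\<close> and \<open>FV 0 k\<close> can serve as the poles of
  the \<open>k\<close>-th suspension.\<close>

definition susp_rel :: "vert \<Rightarrow> vert \<Rightarrow> bool" where
  "susp_rel x y \<longleftrightarrow> (if pole x \<or> pole y then \<not> opposite x y else \<not> Delta_adj x y)"

definition susp_verts :: "nat \<Rightarrow> nat \<Rightarrow> nat \<Rightarrow> vert set" where
  "susp_verts m n k = Delta_verts m n \<union> (\<lambda>i. FV (Suc i) 0) ` {..<k} \<union> (\<lambda>i. FV 0 (Suc i)) ` {..<k}"

lemma EV_in_susp_verts: "EV i \<in> susp_verts m n k \<longleftrightarrow> 1 \<le> i \<and> i \<le> n"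
  by (auto simp: susp_verts_def EV_in_Delta_verts)

lemma FV_in_susp_verts: "FV l i \<in> susp_verts m n k \<longleftrightarrow>
    1 \<le> l \<and> l \<le> m \<and> 1 \<le> i \<and> i < n \<or> i = 0 \<and> 1 \<le> l \<and> l \<le> k \<or> l = 0 \<and> 1 \<le> i \<and> i \<le> k"
  by (cases l; cases i) (auto simp: susp_verts_def FV_in_Delta_verts)

lemma symp_susp_rel: "symp susp_rel"
proof (rule sympI)
  fix x y assume "susp_rel x y"
  then show "susp_rel y x"
    by (cases x; cases y) (auto simp: susp_rel_def)
qed

lemma pointed_heq_iterated_suspension_I_Delta:
  assumes a: "a \<in> topspace (I_Delta m n)" and k: "k \<ge> 1"
  shows "pointed_heq (fst (iterated_suspension k (I_Delta m n) a)) (snd (iterated_suspension k (I_Delta m n) a))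
    (flag_space (susp_verts m n k) susp_rel) (vertex_point (FV k 0))"
proof -
  have np: "\<not> pole x" if "x \<in> Delta_verts m n" for x
    using that by (cases x) (auto simp: FV_in_Delta_verts)
  have eq: "I_Delta m n = flag_space (Delta_verts m n) susp_rel"
    unfolding I_Delta_eq_flag_space
    by (intro arg_cong[where f = geometric_realization] flag_complex_cong) (simp add: susp_rel_def np)
  have "pointed_heq (fst (iterated_suspension k (I_Delta m n) a)) (snd (iterated_suspension k (I_Delta m n) a))
    (flag_space (susp_verts m n k) susp_rel) (case k of 0 \<Rightarrow> a | Suc i \<Rightarrow> vertex_point (FV (Suc i) 0))"
    unfolding eq
  proof (rule pointed_heq_iterated_suspension[where q = "\<lambda>i. FV 0 (Suc i)" and p = "\<lambda>i. FV (Suc i) 0",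
        OF finite_Delta_verts symp_susp_rel a[unfolded eq] susp_verts_def])
    show "susp_rel (FV (Suc k) 0) x" "susp_rel (FV 0 (Suc k)) x" if "x \<in> susp_verts m n k" for k x
      using that by (cases x; auto simp: susp_rel_def FV_in_susp_verts)+
  qed (auto simp: FV_in_susp_verts susp_rel_def)
  then show ?thesis
    using k by (cases k) auto
qed

text \<open>The first pair of poles goes to $f^1_1, f^1_2$ in layer $1$, the poles of the link of
  $e_3$; the second goes to the wedge point and the apex $e_3$. The shift by $3$ identifies the
  smaller graph with the part of the reduced graph from $e_4$ onwards.\<close>

fun emb0 :: "nat \<Rightarrow> vert \<Rightarrow> nat \<times> vert" where
  "emb0 m (EV i) = (1, EV (i + 3))"
| "emb0 m (FV k i) = (if i = 0 then if k = 1 then (1, FV 1 1) else (0, FV m 1)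
     else if k = 0 then if i = 1 then (1, FV 1 2) else (0, EV 3) else (1, FV k (i + 3)))"

text \<open>The \<open>k\<close>-th pair of poles becomes $f^k_1, f^k_2$. The base point of the
  suspension is its last pole \<open>FV m 0\<close>, whose image $f^m_1$ thereby becomes the wedge
  point.\<close>

fun emb1 :: "vert \<Rightarrow> nat \<times> vert" where
  "emb1 (EV i) = (0, EV (i + 3))"
| "emb1 (FV k i) = (0, if i = 0 then FV k 1 else if k = 0 then FV i 2 else FV k (i + 3))"

text \<open>The first \<open>m\<close> pairs of poles become $f^k_1, f^k_2$ in layer $2$, and the
  last becomes the wedge point and the apex $e_1$. The shift is $4$ because the link of $e_1$ misses
  $e_4$ and all $f^k_4$.\<close>

fun emb2 :: "nat \<Rightarrow> vert \<Rightarrow> nat \<times> vert" where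
  "emb2 m (EV i) = (2, EV (i + 4))"
| "emb2 m (FV k i) = (if i = 0 then if k \<le> m then (2, FV k 1) else (0, FV m 1)
     else if k = 0 then if i \<le> m then (2, FV i 2) else (0, EV 1) else (2, FV k (i + 4)))"

lemma image_emb0:
  assumes "n \<ge> 5" and "m \<ge> 2"
  shows "emb0 m ` susp_verts m (n - 3) 2 = Pair 1 ` link m n (EV 3) \<union> {(0, FV m 1), (0, EV 3)}"
proof
  show "emb0 m ` susp_verts m (n - 3) 2 \<subseteq> Pair 1 ` link m n (EV 3) \<union> {(0, FV m 1), (0, EV 3)}"
  proof (rule image_subsetI)
    fix x assume "x \<in> susp_verts m (n - 3) 2"
    then show "emb0 m x \<in> Pair 1 ` link m n (EV 3) \<union> {(0, FV m 1), (0, EV 3)}"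
      using assms by (cases x) (auto simp: EV_in_susp_verts FV_in_susp_verts in_link_e3)
  qed
  have "(1, x) \<in> emb0 m ` susp_verts m (n - 3) 2" if "x \<in> link m n (EV 3)" for x
  proof (cases x)
    case (EV i)
    then show ?thesis
      using that by (intro image_eqI[of _ _ "EV (i - 3)"]) (auto simp: EV_in_susp_verts in_link_e3)
  next
    case (FV k i)
    define y where "y = (if i = 1 then FV 1 0 else if i = 2 then FV 0 1 else FV k (i - 3))"
    show ?thesis
      using that FV by (intro image_eqI[of _ _ y]) (auto simp: y_def FV_in_susp_verts in_link_e3)
  qed
  moreover have "(0, FV m 1) \<in> emb0 m ` susp_verts m (n - 3) 2"
    by (intro image_eqI[of _ _ "FV 2 0"]) (auto simp: FV_in_susp_verts)
  moreover have "(0, EV 3) \<in> emb0 m ` susp_verts m (n - 3) 2"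
    by (intro image_eqI[of _ _ "FV 0 2"]) (auto simp: FV_in_susp_verts)
  ultimately show "Pair 1 ` link m n (EV 3) \<union> {(0, FV m 1), (0, EV 3)} \<subseteq> emb0 m ` susp_verts m (n - 3) 2"
    by blast
qed

lemma image_emb1:
  assumes "n \<ge> 5" and "m \<ge> 2"
  shows "emb1 ` susp_verts m (n - 3) m = Pair 0 ` (reduced_verts m n - {EV 1, EV 3})"
proof
  show "emb1 ` susp_verts m (n - 3) m \<subseteq> Pair 0 ` (reduced_verts m n - {EV 1, EV 3})"
  proof (rule image_subsetI)
    fix x assume "x \<in> susp_verts m (n - 3) m"
    then show "emb1 x \<in> Pair 0 ` (reduced_verts m n - {EV 1, EV 3})"
      using assms by (cases x) (auto simp: EV_in_susp_verts FV_in_susp_verts EV_in_reduced_verts FV_in_reduced_verts)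
  qed
  show "Pair 0 ` (reduced_verts m n - {EV 1, EV 3}) \<subseteq> emb1 ` susp_verts m (n - 3) m"
  proof (rule image_subsetI)
    fix x assume x: "x \<in> reduced_verts m n - {EV 1, EV 3}"
    show "(0, x) \<in> emb1 ` susp_verts m (n - 3) m"
    proof (cases x)
      case (EV i)
      then show ?thesis
        using x by (intro image_eqI[of _ _ "EV (i - 3)"]) (auto simp: EV_in_susp_verts EV_in_reduced_verts)
    next
      case (FV k i)
      define y where "y = (if i = 1 then FV k 0 else if i = 2 then FV 0 k else FV k (i - 3))"
      show ?thesis
        using x FV by (intro image_eqI[of _ _ y]) (auto simp: y_def FV_in_susp_verts FV_in_reduced_verts)
    qed
  qed
qed

lemma image_emb2:
  assumes "n \<ge> 5" and "m \<ge> 2"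
  shows "emb2 m ` susp_verts m (n - 4) (m + 1) = Pair 2 ` link m n (EV 1) \<union> {(0, FV m 1), (0, EV 1)}"
proof
  show "emb2 m ` susp_verts m (n - 4) (m + 1) \<subseteq> Pair 2 ` link m n (EV 1) \<union> {(0, FV m 1), (0, EV 1)}"
  proof (rule image_subsetI)
    fix x assume "x \<in> susp_verts m (n - 4) (m + 1)"
    then show "emb2 m x \<in> Pair 2 ` link m n (EV 1) \<union> {(0, FV m 1), (0, EV 1)}"
      using assms by (cases x) (auto simp: EV_in_susp_verts FV_in_susp_verts in_link_e1[unfolded One_nat_def])
  qed
  have "(2, x) \<in> emb2 m ` susp_verts m (n - 4) (m + 1)" if "x \<in> link m n (EV 1)" for x
  proof (cases x)
    case (EV i)
    then show ?thesis
      using that by (intro image_eqI[of _ _ "EV (i - 4)"]) (auto simp: EV_in_susp_verts in_link_e1[unfolded One_nat_def])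
  next
    case (FV k i)
    define y where "y = (if i = 1 then FV k 0 else if i = 2 then FV 0 k else FV k (i - 4))"
    show ?thesis
      using that FV by (intro image_eqI[of _ _ y]) (auto simp: y_def FV_in_susp_verts in_link_e1[unfolded One_nat_def])
  qed
  moreover have "(0, FV m 1) \<in> emb2 m ` susp_verts m (n - 4) (m + 1)"
    by (intro image_eqI[of _ _ "FV (m + 1) 0"]) (auto simp: FV_in_susp_verts)
  moreover have "(0, EV 1) \<in> emb2 m ` susp_verts m (n - 4) (m + 1)"
    by (intro image_eqI[of _ _ "FV 0 (m + 1)"]) (auto simp: FV_in_susp_verts)
  ultimately show "Pair 2 ` link m n (EV 1) \<union> {(0, FV m 1), (0, EV 1)} \<subseteq> emb2 m ` susp_verts m (n - 4) (m + 1)"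
    by blast
qed

lemma inj_on_emb:
  assumes "m \<ge> 2"
  shows "inj_on (emb0 m) (susp_verts m n 2)" "inj_on emb1 (susp_verts m n m)" "inj_on (emb2 m) (susp_verts m n (m + 1))"
proof -
  show "inj_on (emb0 m) (susp_verts m n 2)"
  proof (rule inj_onI)
    fix x y assume "x \<in> susp_verts m n 2" "y \<in> susp_verts m n 2" "emb0 m x = emb0 m y"
    then show "x = y"
      by (cases x; cases y) (auto simp: FV_in_susp_verts split: if_splits)
  qed
  show "inj_on emb1 (susp_verts m n m)"
  proof (rule inj_onI)
    fix x y assume "x \<in> susp_verts m n m" "y \<in> susp_verts m n m" "emb1 x = emb1 y"
    then show "x = y"
      by (cases x; cases y) (auto simp: FV_in_susp_verts split: if_splits)
  qed
  show "inj_on (emb2 m) (susp_verts m n (m + 1))"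
  proof (rule inj_onI)
    fix x y assume "x \<in> susp_verts m n (m + 1)" "y \<in> susp_verts m n (m + 1)" "emb2 m x = emb2 m y"
    then show "x = y"
      by (cases x; cases y) (auto simp: FV_in_susp_verts split: if_splits)
  qed
qed

lemma glue_emb0:
  assumes "m \<ge> 2" "x \<in> susp_verts m n 2" "y \<in> susp_verts m n 2" "x \<noteq> y"
  shows "glue m {(1, EV 3), (2, EV 1)} (emb0 m x) (emb0 m y) \<longleftrightarrow> susp_rel x y"
  using assms
  by (cases x; cases y)
    (auto simp: glue_def susp_rel_def adj_defs sym_closure_def EV_in_susp_verts FV_in_susp_verts)

lemma glue_emb1:
  assumes "m \<ge> 2" "x \<in> susp_verts m n m" "y \<in> susp_verts m n m" "x \<noteq> y"
  shows "glue m {(1, EV 3), (2, EV 1)} (emb1 x) (emb1 y) \<longleftrightarrow> susp_rel x y"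
  using assms
  by (cases x; cases y)
    (auto simp: glue_def susp_rel_def adj_defs sym_closure_def EV_in_susp_verts FV_in_susp_verts)

lemma glue_emb2:
  assumes "m \<ge> 2" "x \<in> susp_verts m n (m + 1)" "y \<in> susp_verts m n (m + 1)" "x \<noteq> y"
  shows "glue m {(1, EV 3), (2, EV 1)} (emb2 m x) (emb2 m y) \<longleftrightarrow> susp_rel x y"
  using assms
  by (cases x; cases y)
    (auto simp: glue_def susp_rel_def adj_defs sym_closure_def EV_in_susp_verts FV_in_susp_verts)

lemma wedge_sum_susp_verts:
  assumes n: "n \<ge> 5" and m: "m \<ge> 2"
  shows "flag_space (Pair 0 ` reduced_verts m n \<union> Pair 1 ` link m n (EV 3) \<union> Pair 2 ` link m n (EV 1))
      (glue m {(1, EV 3), (2, EV 1)}) homeomorphic_space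
    wedge_sum {..<3} (\<lambda>j. (flag_space ([susp_verts m (n - 3) 2, susp_verts m (n - 3) m, susp_verts m (n - 4) (m + 1)] ! j)
        susp_rel, vertex_point ([FV 2 0, FV m 0, FV (m + 1) 0] ! j)))"
proof -
  let ?V = "\<lambda>j. [susp_verts m (n - 3) 2, susp_verts m (n - 3) m, susp_verts m (n - 4) (m + 1)] ! j"
  let ?g = "\<lambda>j. [emb0 m, emb1, emb2 m] ! j"
  let ?Q = "glue m {(1, EV 3), (2, EV 1)}"
  have J: "{..<3} = {0, 1, 2 :: nat}"
    by auto
  define S :: "(nat \<times> vert) set list" where "S = [Pair 1 ` link m n (EV 3) \<union> {(0, FV m 1), (0, EV 3)}, Pair 0 ` (reduced_verts m n - {EV 1, EV 3}),
    Pair 2 ` link m n (EV 1) \<union> {(0, FV m 1), (0, EV 1)}]"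
  have S: "S ! 0 = Pair 1 ` link m n (EV 3) \<union> {(0, FV m 1), (0, EV 3)}"
      "S ! 1 = Pair 0 ` (reduced_verts m n - {EV 1, EV 3})"
      "S ! 2 = Pair 2 ` link m n (EV 1) \<union> {(0, FV m 1), (0, EV 1)}"
    by (simp_all add: S_def)
  have im: "?g j ` ?V j = S ! j" if "j \<in> {..<3}" for j
  proof -
    from that consider "j = 0" | "j = 1" | "j = 2"
      unfolding J by blast
    then show ?thesis
      by cases (simp_all add: S_def image_emb0[OF n m] image_emb1[OF n m, unfolded One_nat_def]
          image_emb2[OF n m, simplified])
  qed
  have bH: "FV m 1 \<in> reduced_verts m n" "EV 1 \<in> reduced_verts m n" "EV 3 \<in> reduced_verts m n"
    using n m by (auto simp: EV_in_reduced_verts FV_in_reduced_verts)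
  \<comment> \<open>The apexes $e_3$ and $e_1$ belong to the outer pieces and are excluded from the
    middle one, so $f^m_1$ in layer $0$ is all that two pieces share.\<close>
  have inter: "z = (0, FV m 1)" if "i \<in> {..<3}" "j \<in> {..<3}" "i \<noteq> j" "z \<in> S ! i" "z \<in> S ! j" for i j z
    using that(1-3) that(4,5) unfolding J by (elim insertE emptyE; hypsubst; simp only: S; auto)
  \<comment> \<open>Layers $1$ and $2$ reach layer $0$ only at the wedge point and at their own
    apex, which belongs to the same piece; within layer $0$ the apexes are joined to
    nothing.\<close>
  have sep: "\<not> ?Q z z'" if "i \<in> {..<3}" "j \<in> {..<3}" "i \<noteq> j" "z \<in> S ! i" "z' \<in> S ! j"
    "z \<noteq> (0, FV m 1)" "z' \<noteq> (0, FV m 1)" for i j z z'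
    using that(1-3) that(4-7) unfolding J by (elim insertE emptyE; hypsubst; simp only: S; auto simp: glue_def)
  show ?thesis
  proof (rule wedge_sum_flag_space[where g = ?g and b = "(0, FV m 1)"])
    show "finite (?V j)" if "j \<in> {..<3}" for j
      using that finite_Delta_verts unfolding J by (auto simp: susp_verts_def)
    show "inj_on (?g j) (?V j)" if "j \<in> {..<3}" for j
      using that inj_on_emb[OF m] unfolding J by (auto simp: numeral_2_eq_2)
    show "Pair 0 ` reduced_verts m n \<union> Pair 1 ` link m n (EV 3) \<union> Pair 2 ` link m n (EV 1) = (\<Union>j\<in>{..<3}. ?g j ` ?V j)"
    proof -
      have "(\<Union>j\<in>{..<3}. ?g j ` ?V j) = (\<Union>j\<in>{..<3}. S ! j)"
        using im by (rule SUP_cong[OF refl])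
      also have "\<dots> = S ! 0 \<union> S ! 1 \<union> S ! 2"
        unfolding J by blast
      also have "\<dots> = Pair 0 ` reduced_verts m n \<union> Pair 1 ` link m n (EV 3) \<union> Pair 2 ` link m n (EV 1)"
        unfolding S using bH by auto
      finally show ?thesis ..
    qed
    show "[FV 2 0, FV m 0, FV (m + 1) 0] ! j \<in> ?V j" if "j \<in> {..<3}" for j
      using that m unfolding J by (auto simp: FV_in_susp_verts)
    show "?g j ([FV 2 0, FV m 0, FV (m + 1) 0] ! j) = (0, FV m 1)" if "j \<in> {..<3}" for j
      using that m unfolding J by auto
    show "?g i x = (0, FV m 1)" if "i \<in> {..<3}" "j \<in> {..<3}" "i \<noteq> j" "x \<in> ?V i" "y \<in> ?V j" "?g i x = ?g j y" for i j x y
      by (rule inter[OF that(1-3)])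
        (use that(4) im[OF that(1)] that(5,6) im[OF that(2)] in blast)+
    show "\<not> ?Q (?g i x) (?g j y)" if "i \<in> {..<3}" "j \<in> {..<3}" "i \<noteq> j" "x \<in> ?V i" "y \<in> ?V j"
      "?g i x \<noteq> (0, FV m 1)" "?g j y \<noteq> (0, FV m 1)" for i j x y
      by (rule sep[OF that(1-3) _ _ that(6,7)])
        (use that(4) im[OF that(1)] that(5) im[OF that(2)] in blast)+
    show "?Q (?g j x) (?g j y) \<longleftrightarrow> susp_rel x y" if "j \<in> {..<3}" "x \<in> ?V j" "y \<in> ?V j" "x \<noteq> y" for j x y
    proof -
      from that(1) consider "j = 0" | "j = 1" | "j = 2"
        unfolding J by blast
      then show ?thesis
      proof cases
        case 1
        then show ?thesis
          using glue_emb0[OF m, of x "n - 3" y] that(2-4) by simp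
      next
        case 2
        then show ?thesis
          using glue_emb1[OF m, of x "n - 3" y] that(2-4) by simp
      next
        case 3
        then show ?thesis
          using glue_emb2[OF m, of x "n - 4" y] that(2-4) by simp
      qed
    qed
    show "{..<3 :: nat} \<noteq> {}"
      unfolding J by simp
  qed auto
qed

theorem theorem1p2:
  fixes m n :: nat and a b c :: "vert \<Rightarrow> real"
  assumes "n \<ge> 5" and "m \<ge> 2"
    and "a \<in> topspace (I_Delta m (n - 3))"
    and "b \<in> topspace (I_Delta m (n - 3))"
    and "c \<in> topspace (I_Delta m (n - 4))"
  shows "I_Delta m n homotopy_equivalent_space
    wedge_sum {..<3}
      ((!) [iterated_suspension 2 (I_Delta m (n - 3)) a,
            iterated_suspension m (I_Delta m (n - 3)) b,
            iterated_suspension (m + 1) (I_Delta m (n - 4)) c])"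
proof -
  let ?F = "(!) [iterated_suspension 2 (I_Delta m (n - 3)) a,
            iterated_suspension m (I_Delta m (n - 3)) b,
            iterated_suspension (m + 1) (I_Delta m (n - 4)) c]"
  let ?F' = "\<lambda>j. (flag_space ([susp_verts m (n - 3) 2, susp_verts m (n - 3) m, susp_verts m (n - 4) (m + 1)] ! j)
        susp_rel, vertex_point ([FV 2 0, FV m 0, FV (m + 1) 0] ! j))"
  have J: "{..<3} = {0, 1, 2 :: nat}"
    by auto
  have ne: "{..<3 :: nat} \<noteq> {}"
    unfolding J by simp
  have "pointed_heq (fst (?F j)) (snd (?F j)) (fst (?F' j)) (snd (?F' j))" if "j \<in> {..<3}" for j
    using that pointed_heq_iterated_suspension_I_Delta[OF assms(3), of 2]
      pointed_heq_iterated_suspension_I_Delta[OF assms(4), of m]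
      pointed_heq_iterated_suspension_I_Delta[OF assms(5), of "m + 1"] assms(2)
    unfolding J by (auto simp: numeral_2_eq_2)
  then have W: "wedge_sum {..<3} ?F homotopy_equivalent_space wedge_sum {..<3} ?F'"
    by (rule homotopy_equivalent_wedge_sum[OF _ ne])
  have "I_Delta m n homotopy_equivalent_space wedge_sum {..<3} ?F'"
    using homotopy_eqv_trans[OF homotopy_eqv_trans[OF I_Delta_homotopy_equivalent_reduced flag_space_reduced_verts_split]
        homeomorphic_imp_homotopy_equivalent_space[OF wedge_sum_susp_verts]] assms(1,2) by simp
  then show ?thesis
    by (rule homotopy_eqv_trans[OF _ iffD1[OF homotopy_equivalent_space_sym W]])
qed

end
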